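(* Let $\Omega$ be a bounded domain in $\mathbb{R}^{n+1}$ ($n\ge 2$) with smooth boundary, and let $f$ be a smooth function on $\overline{\Omega}$ satisfying $$\overline{\mathcal{L}} f = g \ \text{ in } \Omega, \qquad f = u \ \text{ on } \partial\Omega.$$ Then $$\int_\Omega g^2\rho = \int_\Omega |\overline{\nabla}^2 f|^2 \rho + \frac12 \int_\Omega |\overline{\nabla} f|^2\rho + 2\int_{\partial\Omega} f_\nu\, \mathcal{L}u\, \rho - \int_{\partial\Omega} h(\nabla u,\nabla u)\rho - \int_{\partial\Omega} f_\nu^2\left(\frac{\langle X,\nu\rangle}{2} + H\right)\rho.$$
   Context: $\rho = e^{-|X|^2/4}$, where $X$ is the position vector in $\mathbb{R}^{n+1}$. $\overline{\nabla}, \overline{\Delta}$ are the Euclidean gradient (and Hessian $\overline{\nabla}^2$) and Laplacian, and $\overline{\mathcal{L}} = \overline{\Delta} - \frac12\langle X, \overline{\nabla}\,\cdot\,\rangle$. On the hypersurface $\partial\Omega$ with induced metric, $\nabla$ and $\Delta$ are the gradient and Laplacian, and $\mathcal{L} = \Delta - \frac12 \langle X, \nabla\,\cdot\,\rangle$. $\nu$ is the outward unit normal of $\partial\Omega$, $f_\nu = \langle \overline{\nabla} f, \nu\rangle$, $h(V,W) = \langle \overline{\nabla}_V W, \nu\rangle$ for tangent vectors $V,W$ of $\partial\Omega$ (the second fundamental form with respect to $\nu$), and $H = \mathrm{trace}(h)$. Integrals over $\Omega$ are with respect to Lebesgue measure and over $\partial\Omega$ with respect to the induced area measure. *)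

theory Defs
  imports "HOL-Analysis.Analysis"
begin

definition pd :: "'a::euclidean_space \<Rightarrow> ('a \<Rightarrow> real) \<Rightarrow> 'a \<Rightarrow> real" where
  "pd v F x = frechet_derivative F (at x) v"

fun iter_pd :: "'a::euclidean_space list \<Rightarrow> ('a \<Rightarrow> real) \<Rightarrow> 'a \<Rightarrow> real" where
  "iter_pd [] F = F"
| "iter_pd (b # bs) F = pd b (iter_pd bs F)"

definition smooth_on :: "'a::euclidean_space set \<Rightarrow> ('a \<Rightarrow> real) \<Rightarrow> bool" where
  "smooth_on U F \<longleftrightarrow> (\<forall>bs. set bs \<subseteq> Basis \<longrightarrow> (\<forall>x\<in>U. iter_pd bs F differentiable (at x)))"

definition grad :: "('a::euclidean_space \<Rightarrow> real) \<Rightarrow> 'a \<Rightarrow> 'a" where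
  "grad F x = (\<Sum>b\<in>Basis. pd b F x *\<^sub>R b)"

definition lap :: "('a::euclidean_space \<Rightarrow> real) \<Rightarrow> 'a \<Rightarrow> real" where
  "lap F x = (\<Sum>b\<in>Basis. pd b (pd b F) x)"

definition hess_norm2 :: "('a::euclidean_space \<Rightarrow> real) \<Rightarrow> 'a \<Rightarrow> real" where
  "hess_norm2 F x = (\<Sum>b\<in>Basis. \<Sum>c\<in>Basis. (pd b (pd c F) x)\<^sup>2)"

definition drift_lap :: "('a::euclidean_space \<Rightarrow> real) \<Rightarrow> 'a \<Rightarrow> real" where
  "drift_lap F x = lap F x - (1/2) * (x \<bullet> grad F x)"

definition gauss :: "'a::euclidean_space \<Rightarrow> real" where
  "gauss x = exp (- (norm x)\<^sup>2 / 4)"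

text \<open>outward unit normal of the boundary of {phi < 0}\<close>
definition outer_normal :: "('a::euclidean_space \<Rightarrow> real) \<Rightarrow> 'a \<Rightarrow> 'a" where
  "outer_normal \<phi> x = grad \<phi> x /\<^sub>R norm (grad \<phi> x)"

definition ext :: "'a::euclidean_space set \<Rightarrow> ('a \<Rightarrow> real) \<Rightarrow> 'a \<Rightarrow> real" where
  "ext S w = (SOME W. smooth_on UNIV W \<and> (\<forall>y\<in>S. W y = w y))"

text \<open>tangential derivative in direction b (depends only on w restricted to S)\<close>
definition tdiff :: "'a::euclidean_space set \<Rightarrow> ('a \<Rightarrow> 'a) \<Rightarrow> 'a \<Rightarrow> ('a \<Rightarrow> real) \<Rightarrow> 'a \<Rightarrow> real" where
  "tdiff S N b w x = pd b (ext S w) x - (N x \<bullet> b) * (N x \<bullet> grad (ext S w) x)"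

definition tgrad :: "'a::euclidean_space set \<Rightarrow> ('a \<Rightarrow> 'a) \<Rightarrow> ('a \<Rightarrow> real) \<Rightarrow> 'a \<Rightarrow> 'a" where
  "tgrad S N w x = (\<Sum>b\<in>Basis. tdiff S N b w x *\<^sub>R b)"

definition tlap :: "'a::euclidean_space set \<Rightarrow> ('a \<Rightarrow> 'a) \<Rightarrow> ('a \<Rightarrow> real) \<Rightarrow> 'a \<Rightarrow> real" where
  "tlap S N w x = (\<Sum>b\<in>Basis. tdiff S N b (tdiff S N b w) x)"

definition drift_tlap :: "'a::euclidean_space set \<Rightarrow> ('a \<Rightarrow> 'a) \<Rightarrow> ('a \<Rightarrow> real) \<Rightarrow> 'a \<Rightarrow> real" where
  "drift_tlap S N w x = tlap S N w x - (1/2) * (x \<bullet> tgrad S N w x)"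

definition dnormal :: "'a::euclidean_space set \<Rightarrow> ('a \<Rightarrow> 'a) \<Rightarrow> 'a \<Rightarrow> 'a \<Rightarrow> 'a" where
  "dnormal S N V x = (\<Sum>b\<in>Basis. (\<Sum>c\<in>Basis. (V \<bullet> c) * tdiff S N c (\<lambda>y. N y \<bullet> b) x) *\<^sub>R b)"

text \<open>second fundamental form h(V,W) = <D_V W, N> = - <W, D_V N> for tangent V, W\<close>
definition sff :: "'a::euclidean_space set \<Rightarrow> ('a \<Rightarrow> 'a) \<Rightarrow> 'a \<Rightarrow> 'a \<Rightarrow> 'a \<Rightarrow> real" where
  "sff S N x V W = - (W \<bullet> dnormal S N V x)"

definition tproj :: "('a::euclidean_space \<Rightarrow> 'a) \<Rightarrow> 'a \<Rightarrow> 'a \<Rightarrow> 'a" where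
  "tproj N x v = v - (N x \<bullet> v) *\<^sub>R N x"

text \<open>H = trace of h on the tangent space\<close>
definition mean_curv :: "'a::euclidean_space set \<Rightarrow> ('a \<Rightarrow> 'a) \<Rightarrow> 'a \<Rightarrow> real" where
  "mean_curv S N x = (\<Sum>b\<in>Basis. sff S N x (tproj N x b) (tproj N x b))"

definition smooth_map_on :: "(real^'m) set \<Rightarrow> (real^'m \<Rightarrow> real^'n) \<Rightarrow> bool" where
  "smooth_map_on U \<gamma> \<longleftrightarrow> (\<forall>j. smooth_on U (\<lambda>t. \<gamma> t $ j))"

definition gram_det :: "(real^'m \<Rightarrow> real^'n) \<Rightarrow> real^'m \<Rightarrow> real" where
  "gram_det \<gamma> t = det (\<chi> k l. frechet_derivative \<gamma> (at t) (axis k 1) \<bullet> frechet_derivative \<gamma> (at t) (axis l 1))"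

definition local_param :: "(real^'n) set \<Rightarrow> (real^'m) set \<Rightarrow> (real^'m \<Rightarrow> real^'n) \<Rightarrow> bool" where
  "local_param S U \<gamma> \<longleftrightarrow> open U \<and> smooth_map_on U \<gamma> \<and> \<gamma> ` U \<subseteq> S
     \<and> openin (top_of_set S) (\<gamma> ` U)
     \<and> (\<exists>\<gamma>'. homeomorphism U (\<gamma> ` U) \<gamma> \<gamma>')
     \<and> (\<forall>t\<in>U. gram_det \<gamma> t \<noteq> 0)"

definition area_measure :: "'m::finite itself \<Rightarrow> (real^'n) set \<Rightarrow> (real^'n) measure \<Rightarrow> bool" where
  "area_measure _ S \<sigma> \<longleftrightarrow> sets \<sigma> = sets borel \<and> emeasure \<sigma> (UNIV - S) = 0
     \<and> (\<forall>U (\<gamma>::real^'m \<Rightarrow> real^'n). local_param S U \<gamma> \<longrightarrow>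
          (\<forall>A\<in>sets lborel. A \<subseteq> U \<longrightarrow>
             emeasure \<sigma> (\<gamma> ` A) = (\<integral>\<^sup>+ t. indicator A t * ennreal (sqrt (gram_det \<gamma> t)) \<partial>lborel)))"

end

(*
Integrating the weighted Bochner identity
  div (rho (Lf grad f - Hess f grad f)) = ((Lf)^2 - |Hess f|^2 - |grad f|^2 / 2) rho
over Omega leaves the flux of rho (Lf grad f - Hess f grad f) through the boundary. Splitting grad f
into tangential and normal part turns the flux density into the claimed boundary integrand up to the
surface divergence of the tangential field rho f_nu grad u, which integrates to zero.

The divergence theorem is obtained by integrating the partial derivative of F h(phi / eps) over the
whole space, where h falls from 1 to 0 on [-1, 0]. As eps tends to 0, the integral of
F d_b(phi) h'(phi / eps) / eps concentrates on the zero set of phi, and in graph charts its limit is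
identified with an integral against the area measure. Applied to d_b G in direction a
and to d_a G in direction b, it shows that N_a d_b G - N_b d_a G has integral zero over the boundary,
which yields the divergence theorem on the closed surface.
*)

theory Submission
  imports Defs
begin

subsection \<open>Smooth functions\<close>

text \<open>Three obstacles shape the development. The area measure is given only by the chart
  formula in \<open>area_measure\<close>, on Borel sets: graph charts must be produced by an
  implicit function theorem, finiteness must be derived by compactness, and boundary integrands must
  be Borel on the whole space. The operators \<open>tdiff\<close>, \<open>tlap\<close> and
  \<open>sff\<close> rest on the choice in \<open>ext\<close>; on the surface they are identified
  with the choice-free operator \<open>Dt\<close>, since two smooth extensions differ by a function
  vanishing there. And f is smooth only near the closed domain; a cutoff replaces it by a globally
  smooth function that agrees with f near the closure, so that boundary derivatives agree too.

  The layer is differentiated only once, so a C^1 profile suffices. The skew operators give the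
  surface divergence theorem when they are applied to nu_a Y_b and summed over a and b: tangency of
  Y and the unit length of nu leave only the surface divergence of Y. The factor 2 in the formula
  arises because the flux contains one copy of f_nu L u, and integrating -<grad u, grad f_nu> by
  parts yields the other.\<close>

lemma has_derivative_pd:
  "(F has_derivative D) (at x) \<Longrightarrow> pd v F x = D v"
  unfolding pd_def by (metis frechet_derivative_at)

lemma grad_inner_Basis: "b \<in> Basis \<Longrightarrow> grad F x \<bullet> b = pd b F x"
  unfolding grad_def by (simp add: inner_sum_left inner_Basis if_distrib cong: if_cong)

lemma differentiable_has_derivative_grad:
  assumes "F differentiable (at x)"
  shows "(F has_derivative (\<lambda>v. grad F x \<bullet> v)) (at x)"
proof -
  have h: "(F has_derivative frechet_derivative F (at x)) (at x)"
    using assms by (simp add: frechet_derivative_works)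
  interpret linear "frechet_derivative F (at x)"
    using h has_derivative_linear by blast
  have "frechet_derivative F (at x) v = grad F x \<bullet> v" for v
  proof -
    have "frechet_derivative F (at x) v = frechet_derivative F (at x) (\<Sum>b\<in>Basis. (v \<bullet> b) *\<^sub>R b)"
      by (simp add: euclidean_representation)
    also have "\<dots> = (\<Sum>b\<in>Basis. (v \<bullet> b) * frechet_derivative F (at x) b)"
      by (simp add: sum scale)
    also have "\<dots> = grad F x \<bullet> v"
      unfolding grad_def pd_def by (simp add: inner_sum_left inner_sum_right inner_commute mult.commute)
    finally show ?thesis .
  qed
  then have "frechet_derivative F (at x) = (\<lambda>v. grad F x \<bullet> v)" by blast
  with h show ?thesis by simp
qed

lemma pd_grad: "F differentiable (at x) \<Longrightarrow> pd v F x = grad F x \<bullet> v"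
  using differentiable_has_derivative_grad has_derivative_pd by blast

lemma pd_cong_open:
  assumes "open U" "x \<in> U" "\<And>y. y \<in> U \<Longrightarrow> F y = G y"
  shows "pd v F x = pd v G x"
proof (cases "F differentiable (at x)")
  case True
  then have h: "(F has_derivative frechet_derivative F (at x)) (at x)"
    by (simp add: frechet_derivative_works)
  have "(G has_derivative frechet_derivative F (at x)) (at x)"
    by (rule has_derivative_transform_within_open[OF h assms(1,2)]) (use assms in auto)
  then show ?thesis using h has_derivative_pd by metis
next
  \<comment> \<open>Here \<open>frechet_derivative\<close> is a choice from the set of derivatives
    at x; both functions have the same such set, so the chosen values agree as well.\<close>
  case False
  have "(F has_derivative D) (at x) \<longleftrightarrow> (G has_derivative D) (at x)" for D
    using has_derivative_transform_within_open[OF _ assms(1,2)] assms(3) by metis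
  then show ?thesis unfolding pd_def frechet_derivative_def by simp
qed

lemma differentiable_cong_open:
  assumes "open U" "x \<in> U" "\<And>y. y \<in> U \<Longrightarrow> F y = G y" "F differentiable (at x)"
  shows "G differentiable (at x)"
  using assms unfolding differentiable_def
  by (meson has_derivative_transform_within_open)

text \<open>All smoothness proofs go through this coinduction principle, which avoids computing
  higher derivatives.\<close>

lemma smooth_on_coinduct:
  assumes "F \<in> C" "open U"
    and diff: "\<And>F x. F \<in> C \<Longrightarrow> x \<in> U \<Longrightarrow> F differentiable (at x)"
    and closed: "\<And>F b. F \<in> C \<Longrightarrow> b \<in> Basis \<Longrightarrow> \<exists>G\<in>C. \<forall>x\<in>U. pd b F x = G x"
  shows "smooth_on U F"
proof -
  have *: "\<exists>G\<in>C. \<forall>x\<in>U. iter_pd bs F x = G x" if "set bs \<subseteq> Basis" for bs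
    using that
  proof (induction bs)
    case Nil
    then show ?case using assms(1) by auto
  next
    case (Cons b bs)
    then obtain G where G: "G \<in> C" "\<forall>x\<in>U. iter_pd bs F x = G x" by auto
    have "b \<in> Basis" using Cons.prems by simp
    from closed[OF G(1) this] obtain G' where G': "G' \<in> C" "\<forall>x\<in>U. pd b G x = G' x"
      by blast
    have "pd b (iter_pd bs F) x = G' x" if "x \<in> U" for x
      using pd_cong_open[OF assms(2) that, of "iter_pd bs F" G b] G G' that by auto
    with G' show ?case by auto
  qed
  show ?thesis
    unfolding smooth_on_def
  proof (intro allI impI ballI)
    fix bs x assume "set bs \<subseteq> (Basis :: 'a set)" "x \<in> U"
    then obtain G where G: "G \<in> C" "\<forall>x\<in>U. iter_pd bs F x = G x" using * by blast
    show "iter_pd bs F differentiable (at x)"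
      by (rule differentiable_cong_open[OF assms(2) \<open>x \<in> U\<close>, of G])
        (use G \<open>x \<in> U\<close> diff in auto)
  qed
qed

lemma iter_pd_append: "iter_pd (bs @ cs) F = iter_pd bs (iter_pd cs F)"
  by (induction bs) auto

lemma smooth_on_differentiable: "smooth_on U F \<Longrightarrow> x \<in> U \<Longrightarrow> F differentiable (at x)"
  unfolding smooth_on_def by (metis empty_set empty_subsetI iter_pd.simps(1))

lemma smooth_on_pd:
  assumes "smooth_on U F" "b \<in> Basis"
  shows "smooth_on U (pd b F)"
  unfolding smooth_on_def
proof (intro allI impI ballI)
  fix bs x assume *: "set bs \<subseteq> (Basis :: 'a set)" "x \<in> U"
  have "iter_pd (bs @ [b]) F differentiable (at x)"
    using assms * unfolding smooth_on_def by (auto simp del: iter_pd.simps)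
  then show "iter_pd bs (pd b F) differentiable (at x)"
    by (simp add: iter_pd_append)
qed

lemma smooth_on_subset: "smooth_on U F \<Longrightarrow> V \<subseteq> U \<Longrightarrow> smooth_on V F"
  unfolding smooth_on_def by blast

lemma smooth_on_Un: "smooth_on U F \<Longrightarrow> smooth_on V F \<Longrightarrow> smooth_on (U \<union> V) F"
  unfolding smooth_on_def by blast

lemma smooth_on_cong:
  assumes "smooth_on U F" "open U" "\<And>x. x \<in> U \<Longrightarrow> F x = G x"
  shows "smooth_on U G"
proof (rule smooth_on_coinduct[of _ "{G. \<exists>F. smooth_on U F \<and> (\<forall>x\<in>U. F x = G x)}"])
  show "G \<in> {G. \<exists>F. smooth_on U F \<and> (\<forall>x\<in>U. F x = G x)}" using assms by auto
next
  fix F x assume "F \<in> {G. \<exists>F. smooth_on U F \<and> (\<forall>x\<in>U. F x = G x)}" "x \<in> U"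
  then obtain F' where F': "smooth_on U F'" "\<And>x. x \<in> U \<Longrightarrow> F' x = F x" by auto
  show "F differentiable (at x)"
    by (rule differentiable_cong_open[OF assms(2) \<open>x \<in> U\<close> F'(2)])
      (use \<open>x \<in> U\<close> F' smooth_on_differentiable in auto)
next
  fix G b assume *: "G \<in> {G. \<exists>F. smooth_on U F \<and> (\<forall>x\<in>U. F x = G x)}" "b \<in> (Basis :: 'a set)"
  then obtain F where F: "smooth_on U F" "\<forall>x\<in>U. F x = G x" by auto
  show "\<exists>H\<in>{G. \<exists>F. smooth_on U F \<and> (\<forall>x\<in>U. F x = G x)}. \<forall>x\<in>U. pd b G x = H x"
    using F smooth_on_pd[OF F(1) *(2)] pd_cong_open[OF assms(2), of _ F G b]
    by (intro bexI[of _ "pd b F"]) auto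
qed (rule assms)

section \<open>Differentiation rules and closure properties of smooth functions\<close>

lemma pd_const: "pd b (\<lambda>x. c) x = 0"
  by (rule has_derivative_pd[where D="\<lambda>_. 0"]) simp

lemma pd_add: "F differentiable (at x) \<Longrightarrow> G differentiable (at x) \<Longrightarrow>
    pd b (\<lambda>x. F x + G x) x = pd b F x + pd b G x"
  by (rule has_derivative_pd[THEN trans])
    (rule has_derivative_add[OF differentiable_has_derivative_grad differentiable_has_derivative_grad],
     simp_all add: pd_grad)

lemma pd_diff: "F differentiable (at x) \<Longrightarrow> G differentiable (at x) \<Longrightarrow>
    pd b (\<lambda>x. F x - G x) x = pd b F x - pd b G x"
  by (rule has_derivative_pd[THEN trans])
    (rule has_derivative_diff[OF differentiable_has_derivative_grad differentiable_has_derivative_grad],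
     simp_all add: pd_grad)

lemma pd_mult: "F differentiable (at x) \<Longrightarrow> G differentiable (at x) \<Longrightarrow>
    pd b (\<lambda>x. F x * G x) x = F x * pd b G x + pd b F x * G x"
  by (rule has_derivative_pd[THEN trans])
    (rule has_derivative_mult[OF differentiable_has_derivative_grad differentiable_has_derivative_grad],
     simp_all add: pd_grad)

lemma pd_sum:
  assumes "\<And>i. i \<in> I \<Longrightarrow> F i differentiable (at x)"
  shows "pd b (\<lambda>x. \<Sum>i\<in>I. F i x) x = (\<Sum>i\<in>I. pd b (F i) x)"
  by (rule has_derivative_pd[THEN trans])
    (rule has_derivative_sum[OF differentiable_has_derivative_grad], simp_all add: pd_grad assms)

lemma real_differentiable_has_derivative:
  fixes r :: "real \<Rightarrow> real"
  assumes "r differentiable (at y)"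
  shows "(r has_derivative (\<lambda>v. pd 1 r y * v)) (at y)"
  using differentiable_has_derivative_grad[OF assms] grad_inner_Basis[of 1 r y] by simp

lemma has_real_derivative_pd: "(r has_real_derivative d) (at y) \<Longrightarrow> pd 1 r y = d"
  using has_derivative_pd[of r "(*) d" y 1] unfolding has_field_derivative_def by simp

lemma has_derivative_compose_real:
  fixes r :: "real \<Rightarrow> real"
  assumes "r differentiable (at (F x))" "F differentiable (at x)"
  shows "((\<lambda>x. r (F x)) has_derivative (\<lambda>v. pd 1 r (F x) * pd v F x)) (at x)"
  using has_derivative_compose[OF differentiable_has_derivative_grad[OF assms(2)]
      real_differentiable_has_derivative[OF assms(1)]] pd_grad[OF assms(2)] by simp

lemma pd_compose_real:
  fixes r :: "real \<Rightarrow> real"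
  assumes "r differentiable (at (F x))" "F differentiable (at x)"
  shows "pd b (\<lambda>x. r (F x)) x = pd 1 r (F x) * pd b F x"
  using has_derivative_pd[OF has_derivative_compose_real[OF assms]] by simp

text \<open>The invariant set for the coinduction. The derivative of a sum, product or composition
  is again built from sums, products and compositions, so all closure rules follow at once, without
  higher Leibniz or chain formulas.\<close>

inductive_set smooth_alg :: "'a::euclidean_space set \<Rightarrow> ('a \<Rightarrow> real) set" for U where
  base: "smooth_on U F \<Longrightarrow> F \<in> smooth_alg U"
| add: "F \<in> smooth_alg U \<Longrightarrow> G \<in> smooth_alg U \<Longrightarrow> (\<lambda>x. F x + G x) \<in> smooth_alg U"
| mult: "F \<in> smooth_alg U \<Longrightarrow> G \<in> smooth_alg U \<Longrightarrow> (\<lambda>x. F x * G x) \<in> smooth_alg U"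
| comp: "F \<in> smooth_alg U \<Longrightarrow> smooth_on V r \<Longrightarrow> F ` U \<subseteq> V \<Longrightarrow> (\<lambda>x. r (F x)) \<in> smooth_alg U"

lemma smooth_alg_differentiable:
  "F \<in> smooth_alg U \<Longrightarrow> x \<in> U \<Longrightarrow> F differentiable (at x)"
proof (induction rule: smooth_alg.induct)
  case (comp F V r)
  have "r differentiable (at (F x))" using comp smooth_on_differentiable by blast
  with comp show ?case
    using has_derivative_compose_real differentiable_def by blast
qed (auto intro: smooth_on_differentiable)

lemma smooth_alg_pd:
  assumes "F \<in> smooth_alg U" "b \<in> Basis"
  shows "\<exists>G\<in>smooth_alg U. \<forall>x\<in>U. pd b F x = G x"
  using assms(1)
proof (induction rule: smooth_alg.induct)
  case (base F)
  then show ?case using assms(2) smooth_on_pd smooth_alg.base by blast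
next
  case (add F G)
  then obtain F' G' where *: "F' \<in> smooth_alg U" "\<forall>x\<in>U. pd b F x = F' x"
      "G' \<in> smooth_alg U" "\<forall>x\<in>U. pd b G x = G' x" by blast
  have "pd b (\<lambda>x. F x + G x) x = F' x + G' x" if "x \<in> U" for x
    using * that smooth_alg_differentiable[OF add.hyps(1) that]
      smooth_alg_differentiable[OF add.hyps(2) that] by (simp add: pd_add)
  then show ?case
    by (intro bexI[OF _ smooth_alg.add[OF *(1) *(3)]]) blast
next
  case (mult F G)
  then obtain F' G' where *: "F' \<in> smooth_alg U" "\<forall>x\<in>U. pd b F x = F' x"
      "G' \<in> smooth_alg U" "\<forall>x\<in>U. pd b G x = G' x" by blast
  have "(\<lambda>x. F x * G' x + F' x * G x) \<in> smooth_alg U"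
    by (intro smooth_alg.add smooth_alg.mult * mult.hyps)
  moreover have "pd b (\<lambda>x. F x * G x) x = F x * G' x + F' x * G x" if "x \<in> U" for x
    using * that smooth_alg_differentiable[OF mult.hyps(1) that]
      smooth_alg_differentiable[OF mult.hyps(2) that] by (simp add: pd_mult)
  ultimately show ?case by (intro bexI[of _ "\<lambda>x. F x * G' x + F' x * G x"]) simp_all
next
  case (comp F V r)
  then obtain F' where *: "F' \<in> smooth_alg U" "\<forall>x\<in>U. pd b F x = F' x" by blast
  have "smooth_on V (pd 1 r)" using comp by (intro smooth_on_pd) auto
  then have "(\<lambda>x. pd 1 r (F x) * F' x) \<in> smooth_alg U"
    by (intro smooth_alg.mult smooth_alg.comp[of F _ V "pd 1 r"] * comp.hyps)
  moreover have "pd b (\<lambda>x. r (F x)) x = pd 1 r (F x) * F' x" if "x \<in> U" for x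
  proof -
    have "r differentiable (at (F x))" using comp smooth_on_differentiable that by blast
    then show ?thesis using * that comp smooth_alg_differentiable by (subst pd_compose_real) auto
  qed
  ultimately show ?case by (intro bexI[of _ "\<lambda>x. pd 1 r (F x) * F' x"]) simp_all
qed

lemma smooth_alg_smooth: "F \<in> smooth_alg U \<Longrightarrow> open U \<Longrightarrow> smooth_on U F"
  by (rule smooth_on_coinduct[of _ "smooth_alg U"])
    (auto intro: smooth_alg_differentiable smooth_alg_pd)

lemma smooth_on_const: "smooth_on U (\<lambda>x. c)"
  by (rule smooth_on_subset[OF smooth_on_coinduct[of _ "range (\<lambda>c x. c)" UNIV]])
    (auto simp: pd_const)

lemma smooth_on_add: "open U \<Longrightarrow> smooth_on U F \<Longrightarrow> smooth_on U G \<Longrightarrow> smooth_on U (\<lambda>x. F x + G x)"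
  by (rule smooth_alg_smooth[OF smooth_alg.add[OF smooth_alg.base smooth_alg.base]])

lemma smooth_on_mult: "open U \<Longrightarrow> smooth_on U F \<Longrightarrow> smooth_on U G \<Longrightarrow> smooth_on U (\<lambda>x. F x * G x)"
  by (rule smooth_alg_smooth[OF smooth_alg.mult[OF smooth_alg.base smooth_alg.base]])

lemma smooth_on_compose:
  "open U \<Longrightarrow> smooth_on U F \<Longrightarrow> smooth_on V r \<Longrightarrow> F ` U \<subseteq> V \<Longrightarrow> smooth_on U (\<lambda>x. r (F x))"
  by (rule smooth_alg_smooth[OF smooth_alg.comp[OF smooth_alg.base]])

lemma smooth_on_minus: "open U \<Longrightarrow> smooth_on U F \<Longrightarrow> smooth_on U (\<lambda>x. - F x)"
  using smooth_on_mult[OF _ smooth_on_const, of U F "-1"] by simp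

lemma smooth_on_diff: "open U \<Longrightarrow> smooth_on U F \<Longrightarrow> smooth_on U G \<Longrightarrow> smooth_on U (\<lambda>x. F x - G x)"
  using smooth_on_add[OF _ _ smooth_on_minus, of U F G] by simp

lemma smooth_on_sum:
  "open U \<Longrightarrow> (\<And>i. i \<in> I \<Longrightarrow> smooth_on U (F i)) \<Longrightarrow> smooth_on U (\<lambda>x. \<Sum>i\<in>I. F i x)"
  by (induction I rule: infinite_finite_induct) (auto intro: smooth_on_const smooth_on_add)

lemma smooth_on_power: "open U \<Longrightarrow> smooth_on U F \<Longrightarrow> smooth_on U (\<lambda>x. F x ^ n)"
  by (induction n) (auto intro: smooth_on_const smooth_on_mult)

lemma smooth_on_inner: "smooth_on U (\<lambda>x. x \<bullet> a)"
proof -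
  let ?C = "insert (\<lambda>x. x \<bullet> a) (range (\<lambda>c x. c))"
  have "pd b (\<lambda>x. x \<bullet> a) x = b \<bullet> a" for b x :: 'a
    by (rule has_derivative_pd) (auto intro!: derivative_eq_intros)
  then have "smooth_on UNIV (\<lambda>x. x \<bullet> a)"
    by (intro smooth_on_coinduct[of _ ?C]) (auto simp: pd_const)
  then show ?thesis by (rule smooth_on_subset) auto
qed

lemma smooth_on_real_coinduct:
  fixes r :: "real \<Rightarrow> real"
  assumes "r \<in> C" "open U"
    "\<And>r. r \<in> C \<Longrightarrow> \<exists>r'\<in>C. \<forall>x\<in>U. (r has_real_derivative r' x) (at x)"
  shows "smooth_on U r"
proof (rule smooth_on_coinduct[OF assms(1,2)])
  fix r :: "real \<Rightarrow> real" and x assume *: "r \<in> C" "x \<in> U"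
  show "r differentiable (at x)"
    using assms(3)[OF *(1)] *(2) real_differentiable_def by blast
next
  fix r and b :: real assume *: "r \<in> C" "b \<in> Basis"
  then show "\<exists>G\<in>C. \<forall>x\<in>U. pd b r x = G x"
    using assms(3)[OF *(1)] has_real_derivative_pd by fastforce
qed

lemma smooth_on_exp: "smooth_on U (exp :: real \<Rightarrow> real)"
  by (rule smooth_on_subset[OF smooth_on_real_coinduct[of _ "{exp}" UNIV]])
    (auto intro!: derivative_eq_intros)

lemma smooth_on_powr: "smooth_on {0<..} (\<lambda>x::real. x powr a)"
proof (rule smooth_on_real_coinduct[of _ "range (\<lambda>(c,a) x. c * x powr a)"])
  show "(\<lambda>x. x powr a) \<in> range (\<lambda>(c,a) x. c * x powr a)"
    by (rule range_eqI[of _ _ "(1,a)"]) auto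
next
  fix r :: "real \<Rightarrow> real" assume "r \<in> range (\<lambda>(c,a) x. c * x powr a)"
  then obtain c a where r: "r = (\<lambda>x. c * x powr a)" by auto
  have "(\<lambda>x. (c * a) * x powr (a - 1)) \<in> range (\<lambda>(c,a) x. c * x powr a)"
    by (rule range_eqI[of _ _ "(c*a,a-1)"]) auto
  moreover have "\<forall>x\<in>{0<..}. (r has_real_derivative (c * a) * x powr (a - 1)) (at x)"
    unfolding r by (auto intro!: derivative_eq_intros)
  ultimately show "\<exists>r'\<in>range (\<lambda>(c,a) x. c * x powr a). \<forall>x\<in>{0<..}. (r has_real_derivative r' x) (at x)"
    by (intro bexI[of _ "\<lambda>x. (c * a) * x powr (a - 1)"])
qed auto

lemma smooth_on_inverse:
  assumes "open U" "smooth_on U F" "\<And>x. x \<in> U \<Longrightarrow> F x \<noteq> 0"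
  shows "smooth_on U (\<lambda>x. inverse (F x))"
proof -
  \<comment> \<open>\<open>powr\<close> is smooth on positive reals only; writing 1/F as F times the
    inverse of its square admits negative values of F.\<close>
  have "smooth_on U (\<lambda>x. F x * ((F x)\<^sup>2 powr (-1)))"
    using assms
    by (intro smooth_on_mult smooth_on_compose[OF _ smooth_on_power smooth_on_powr]) auto
  then show ?thesis
    by (rule smooth_on_cong) (use assms in \<open>auto simp: powr_minus power2_eq_square field_simps\<close>)
qed

lemma smooth_on_continuous:
  assumes "smooth_on UNIV F" shows "continuous_on A F"
  using assms smooth_on_differentiable
  by (metis UNIV_I continuous_at_imp_continuous_on differentiable_imp_continuous_within)

lemma smooth_on_grad_inner:
  assumes "smooth_on U F" "open U" shows "smooth_on U (\<lambda>x. grad F x \<bullet> v)"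
proof -
  have "smooth_on U (\<lambda>x. \<Sum>b\<in>Basis. pd b F x * (b \<bullet> v))"
    by (intro smooth_on_sum smooth_on_mult smooth_on_const smooth_on_pd assms)
  then show ?thesis unfolding grad_def by (simp add: inner_sum_left)
qed

lemma smooth_on_pd':
  assumes "smooth_on U F" "open U" shows "smooth_on U (pd v F)"
  by (rule smooth_on_cong[OF smooth_on_grad_inner[OF assms, of v] assms(2)])
    (use assms smooth_on_differentiable pd_grad in metis)

lemma continuous_on_grad:
  assumes "smooth_on UNIV F" shows "continuous_on A (grad F)"
  unfolding grad_def
  by (intro continuous_intros smooth_on_continuous smooth_on_pd assms)

section \<open>Derivatives along lines and symmetry of mixed partials\<close>

lemma DERIV_line:
  assumes "F differentiable (at (x + t *\<^sub>R v))"
  shows "((\<lambda>t. F (x + t *\<^sub>R v)) has_real_derivative pd v F (x + t *\<^sub>R v)) (at t)"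
proof -
  have "((\<lambda>t. x + t *\<^sub>R v) has_derivative (\<lambda>h. h *\<^sub>R v)) (at t)"
    by (auto intro!: derivative_eq_intros)
  from has_derivative_compose[OF this differentiable_has_derivative_grad[OF assms]]
  show ?thesis unfolding has_field_derivative_def
    by (simp add: pd_grad[OF assms] mult.commute[of "grad F _ \<bullet> _"] has_derivative_eq_rhs fun_eq_iff)
qed

text \<open>Both mixed partials are limits of the same second difference quotient.\<close>

lemma second_difference_mean_value:
  fixes F :: "'a::euclidean_space \<Rightarrow> real"
  assumes F: "smooth_on UNIV F" and h: "h > 0" and bc: "b \<in> Basis" "c \<in> Basis"
  shows "\<exists>s\<in>{0<..<h}. \<exists>t\<in>{0<..<h}.
    F (x + h *\<^sub>R b + h *\<^sub>R c) - F (x + h *\<^sub>R b) - F (x + h *\<^sub>R c) + F x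
      = h * h * pd b (pd c F) (x + s *\<^sub>R b + t *\<^sub>R c)"
proof -
  have dF: "F differentiable (at y)" "pd c F differentiable (at y)" for y
    using smooth_on_differentiable[OF F] smooth_on_differentiable[OF smooth_on_pd[OF F bc(2)]] by auto
  \<comment> \<open>The mean value theorem is used twice: along c for the increment in direction b,
    then along b for \<open>pd c F\<close>.\<close>
  define g where "g t = F (x + h *\<^sub>R b + t *\<^sub>R c) - F (x + t *\<^sub>R c)" for t
  have "(g has_real_derivative pd c F (x + h *\<^sub>R b + t *\<^sub>R c) - pd c F (x + t *\<^sub>R c)) (at t)" for t
    unfolding g_def by (intro DERIV_diff DERIV_line dF)
  then obtain t where t: "0 < t" "t < h"
    "g h - g 0 = h * (pd c F (x + h *\<^sub>R b + t *\<^sub>R c) - pd c F (x + t *\<^sub>R c))"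
    using MVT2[OF h, of g "\<lambda>t. pd c F (x + h *\<^sub>R b + t *\<^sub>R c) - pd c F (x + t *\<^sub>R c)"] by auto
  have "((\<lambda>s. pd c F ((x + t *\<^sub>R c) + s *\<^sub>R b)) has_real_derivative
      pd b (pd c F) ((x + t *\<^sub>R c) + s *\<^sub>R b)) (at s)" for s
    by (intro DERIV_line dF)
  from MVT2[OF h this] obtain s where s: "0 < s" "s < h"
    "pd c F ((x + t *\<^sub>R c) + h *\<^sub>R b) - pd c F (x + t *\<^sub>R c) = h * pd b (pd c F) ((x + t *\<^sub>R c) + s *\<^sub>R b)"
    by auto
  show ?thesis
    using s t by (intro bexI[of _ s] bexI[of _ t]) (auto simp: g_def algebra_simps)
qed

lemma pd_commute:
  fixes F :: "'a::euclidean_space \<Rightarrow> real"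
  assumes F: "smooth_on UNIV F" and bc: "b \<in> Basis" "c \<in> Basis"
  shows "pd b (pd c F) x = pd c (pd b F) x"
proof (rule ccontr)
  assume ne: "pd b (pd c F) x \<noteq> pd c (pd b F) x"
  define e where "e = \<bar>pd b (pd c F) x - pd c (pd b F) x\<bar> / 2"
  have e: "e > 0" using ne by (simp add: e_def)
  have c1: "isCont (pd b (pd c F)) x" "isCont (pd c (pd b F)) x"
    using smooth_on_continuous[OF smooth_on_pd[OF smooth_on_pd[OF F]], of _ _ UNIV] bc
    by (auto simp: continuous_on_eq_continuous_at)
  obtain d1 where d1: "d1 > 0" "\<And>y. dist y x < d1 \<Longrightarrow> dist (pd b (pd c F) y) (pd b (pd c F) x) < e"
    using c1(1) e unfolding continuous_at_eps_delta by (metis)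
  obtain d2 where d2: "d2 > 0" "\<And>y. dist y x < d2 \<Longrightarrow> dist (pd c (pd b F) y) (pd c (pd b F) x) < e"
    using c1(2) e unfolding continuous_at_eps_delta by (metis)
  \<comment> \<open>The intermediate points lie at distance at most s + t, hence below 2h, from x;
    the factor 1/2 brings this below both radii.\<close>
  define h where "h = min d1 d2 / 2"
  have h: "h > 0" using d1 d2 by (simp add: h_def)
  have near: "dist (x + s *\<^sub>R b' + t *\<^sub>R c') x < min d1 d2"
    if "s \<in> {0<..<h}" "t \<in> {0<..<h}" "b' \<in> Basis" "c' \<in> Basis" for s t b' c'
  proof -
    have "dist (x + s *\<^sub>R b' + t *\<^sub>R c') x = norm (s *\<^sub>R b' + t *\<^sub>R c')"
      by (simp add: dist_norm algebra_simps)
    also have "\<dots> \<le> norm (s *\<^sub>R b') + norm (t *\<^sub>R c')" by (rule norm_triangle_ineq)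
    also have "\<dots> = s + t" using that by simp
    also have "\<dots> < min d1 d2" using that by (simp add: h_def)
    finally show ?thesis .
  qed
  obtain s t where st: "s \<in> {0<..<h}" "t \<in> {0<..<h}"
    "F (x + h *\<^sub>R b + h *\<^sub>R c) - F (x + h *\<^sub>R b) - F (x + h *\<^sub>R c) + F x
      = h * h * pd b (pd c F) (x + s *\<^sub>R b + t *\<^sub>R c)"
    using second_difference_mean_value[OF F h bc] by blast
  obtain s' t' where st': "s' \<in> {0<..<h}" "t' \<in> {0<..<h}"
    "F (x + h *\<^sub>R c + h *\<^sub>R b) - F (x + h *\<^sub>R c) - F (x + h *\<^sub>R b) + F x
      = h * h * pd c (pd b F) (x + s' *\<^sub>R c + t' *\<^sub>R b)"
    using second_difference_mean_value[OF F h bc(2,1)] by blast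
  have "x + h *\<^sub>R c + h *\<^sub>R b = x + h *\<^sub>R b + h *\<^sub>R c" by simp
  then have "F (x + h *\<^sub>R c + h *\<^sub>R b) = F (x + h *\<^sub>R b + h *\<^sub>R c)" by (simp only:)
  then have "h * h * pd b (pd c F) (x + s *\<^sub>R b + t *\<^sub>R c) = h * h * pd c (pd b F) (x + s' *\<^sub>R c + t' *\<^sub>R b)"
    using st(3) st'(3) by linarith
  then have "pd b (pd c F) (x + s *\<^sub>R b + t *\<^sub>R c) = pd c (pd b F) (x + s' *\<^sub>R c + t' *\<^sub>R b)"
    using h by simp
  moreover have "dist (pd b (pd c F) (x + s *\<^sub>R b + t *\<^sub>R c)) (pd b (pd c F) x) < e"
    by (rule d1) (use near[OF st(1,2) bc] in simp)
  moreover have "dist (pd c (pd b F) (x + s' *\<^sub>R c + t' *\<^sub>R b)) (pd c (pd b F) x) < e"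
    by (rule d2) (use near[OF st'(1,2) bc(2,1)] in simp)
  ultimately show False
    unfolding dist_real_def e_def by (simp add: abs_if split: if_splits)
qed

subsection \<open>Cutoffs, layer functions and measurability of gradients\<close>

text \<open>The flat function exp(-1/x) with polynomial factors in 1/x. The polynomial parameter
  makes the family closed under differentiation, so that it can serve as a coinduction
  invariant.\<close>

definition flat_exp :: "real poly \<Rightarrow> real \<Rightarrow> real" where
  "flat_exp p x = (if x > 0 then poly p (1/x) * exp (- (1/x)) else 0)"

lemma poly_div_exp_tendsto_0: "((\<lambda>y::real. poly q y * exp (- y)) \<longlongrightarrow> 0) at_top"
proof -
  have "((\<lambda>y. \<Sum>i\<le>degree q. coeff q i * (y ^ i / exp y)) \<longlongrightarrow> (\<Sum>i\<le>degree q. coeff q i * 0)) at_top"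
    by (intro tendsto_intros tendsto_power_div_exp_0)
  then show ?thesis
    by (simp add: poly_altdef sum_distrib_right exp_minus divide_inverse mult.assoc)
qed

text \<open>Differentiating p(1/x) exp(-1/x) gives (p - p')(1/x) / x^2 times the exponential;
  \<open>monom 1 2\<close> is the factor 1/x^2. At 0 exponential decay beats every
  polynomial.\<close>

lemma flat_exp_has_derivative:
  "(flat_exp p has_real_derivative flat_exp (monom 1 2 * (p - pderiv p)) x) (at x)"
proof -
  consider "x > 0" | "x < 0" | "x = 0" by linarith
  then show ?thesis
  proof cases
    case 1
    have "((\<lambda>x. poly p (1/x) * exp (- (1/x))) has_real_derivative
        flat_exp (monom 1 2 * (p - pderiv p)) x) (at x)"
      using 1 by (auto intro!: derivative_eq_intros DERIV_chain2[OF poly_DERIV]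
          simp: flat_exp_def poly_monom power2_eq_square field_simps)
    then show ?thesis
      by (rule has_field_derivative_transform_within_open[of _ _ _ "{0<..}"])
        (use 1 in \<open>auto simp: flat_exp_def\<close>)
  next
    case 2
    have "((\<lambda>x. 0) has_real_derivative 0) (at x)" by simp
    then have "(flat_exp p has_real_derivative 0) (at x)"
      by (rule has_field_derivative_transform_within_open[of _ _ _ "{..<0}"])
        (use 2 in \<open>auto simp: flat_exp_def\<close>)
    then show ?thesis using 2 by (simp add: flat_exp_def)
  next
    case 3
    \<comment> \<open>With y = 1/h the right difference quotient at 0 is y p(y) exp(-y); the factor
      \<open>[:0,1:]\<close> is the division by h.\<close>
    have "((\<lambda>y. poly (p * [:0,1:]) y * exp (- y)) \<longlongrightarrow> 0) at_top"
      by (rule poly_div_exp_tendsto_0)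
    then have "((\<lambda>h. poly (p * [:0,1:]) (inverse h) * exp (- inverse h)) \<longlongrightarrow> 0) (at_right 0)"
      by (rule filterlim_compose) (rule filterlim_inverse_at_top_right)
    then have "((\<lambda>h. (flat_exp p (0 + h) - flat_exp p 0) / h) \<longlongrightarrow> 0) (at_right 0)"
      by (rule Lim_transform_eventually)
        (auto simp: eventually_at_filter flat_exp_def field_simps)
    moreover have "((\<lambda>h. (flat_exp p (0 + h) - flat_exp p 0) / h) \<longlongrightarrow> 0) (at_left 0)"
      by (rule Lim_transform_eventually[OF tendsto_const])
        (auto simp: eventually_at_filter flat_exp_def)
    ultimately have "((\<lambda>h. (flat_exp p (0 + h) - flat_exp p 0) / h) \<longlongrightarrow> 0) (at 0)"
      by (rule filterlim_split_at[rotated])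
    then show ?thesis using 3 by (simp add: DERIV_def flat_exp_def)
  qed
qed

lemma smooth_flat_exp: "smooth_on UNIV (flat_exp p)"
proof (rule smooth_on_real_coinduct[of _ "range flat_exp"])
  fix r assume "r \<in> range flat_exp"
  then obtain p where "r = flat_exp p" by auto
  then show "\<exists>r'\<in>range flat_exp. \<forall>x\<in>UNIV. (r has_real_derivative r' x) (at x)"
    using flat_exp_has_derivative by blast
qed auto

definition smooth_step :: "real \<Rightarrow> real" where
  "smooth_step t = flat_exp 1 t * inverse (flat_exp 1 t + flat_exp 1 (1 - t))"

lemma flat_exp_1_pos: "t > 0 \<Longrightarrow> flat_exp 1 t > 0" "flat_exp 1 t \<ge> 0" "t \<le> 0 \<Longrightarrow> flat_exp 1 t = 0"
  by (auto simp: flat_exp_def)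

lemma smooth_smooth_step: "smooth_on UNIV smooth_step"
proof -
  have sub: "smooth_on UNIV (\<lambda>t::real. 1 - t)"
    using smooth_on_diff[OF open_UNIV smooth_on_const[of UNIV 1] smooth_on_inner[of UNIV "1::real"]] by simp
  \<comment> \<open>At least one of t and 1 - t is positive, so the denominator of
    \<open>smooth_step\<close> never vanishes.\<close>
  have "flat_exp 1 t + flat_exp 1 (1 - t) \<noteq> 0" for t
    using flat_exp_1_pos(1)[of t] flat_exp_1_pos(2)[of t] flat_exp_1_pos(1)[of "1-t"] flat_exp_1_pos(2)[of "1-t"]
    by (cases "t > 0") auto
  then show ?thesis
    unfolding smooth_step_def
    by (intro smooth_on_mult smooth_on_inverse smooth_on_add smooth_flat_exp
          smooth_on_compose[OF open_UNIV sub smooth_flat_exp]) auto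
qed

lemma smooth_step_simps: "t \<le> 0 \<Longrightarrow> smooth_step t = 0" "t \<ge> 1 \<Longrightarrow> smooth_step t = 1"
  using flat_exp_1_pos(1)[of t] by (auto simp: smooth_step_def flat_exp_1_pos(3))

lemma smooth_on_norm2: "smooth_on UNIV (\<lambda>y. (norm (y - x))\<^sup>2)"
proof -
  have "smooth_on UNIV (\<lambda>y. \<Sum>b\<in>Basis. (y \<bullet> b - x \<bullet> b)\<^sup>2)"
    by (intro smooth_on_sum smooth_on_power smooth_on_diff smooth_on_inner smooth_on_const open_UNIV)
  moreover have "(norm (y - x))\<^sup>2 = (\<Sum>b\<in>Basis. (y \<bullet> b - x \<bullet> b)\<^sup>2)" for y
    unfolding power2_norm_eq_inner
    by (subst euclidean_inner) (simp add: inner_diff_left power2_eq_square)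
  ultimately show ?thesis by simp
qed

text \<open>Finitely many bumps on balls inside W have a sum that is positive on K, hence bounded
  below there by compactness; \<open>smooth_step\<close> of the rescaled sum saturates at 1.
  Reaching 1 on a neighbourhood of K, and not just on K, is what preserves derivatives
  later.\<close>

lemma smooth_cutoff:
  fixes K W :: "'a::euclidean_space set"
  assumes K: "compact K" and W: "open W" "K \<subseteq> W"
  obtains \<zeta> V C where "smooth_on UNIV \<zeta>" "open V" "K \<subseteq> V" "\<And>x. x \<in> V \<Longrightarrow> \<zeta> x = 1"
    "closed C" "C \<subseteq> W" "\<And>x. x \<notin> C \<Longrightarrow> \<zeta> x = 0"
proof (cases "K = {}")
  case True
  then show thesis
    using that[of "\<lambda>_. 0" "{}" "{}"] by (auto intro: smooth_on_const)
next
  case False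
  have "\<forall>x\<in>K. \<exists>r>0. cball x r \<subseteq> W"
    using W open_contains_cball by blast
  then obtain r where r: "\<And>x. x \<in> K \<Longrightarrow> r x > 0" "\<And>x. x \<in> K \<Longrightarrow> cball x (r x) \<subseteq> W"
    by metis
  obtain D where D: "D \<subseteq> K" "finite D" "K \<subseteq> (\<Union>x\<in>D. ball x (r x))"
    by (rule compactE_image[OF K, of K "\<lambda>x. ball x (r x)"]) (use r in auto)
  define \<psi> where "\<psi> y = (\<Sum>x\<in>D. flat_exp 1 ((r x)\<^sup>2 - (norm (y - x))\<^sup>2))" for y
  have s\<psi>: "smooth_on UNIV \<psi>"
    unfolding \<psi>_def
    by (intro smooth_on_sum open_UNIV smooth_on_compose[OF open_UNIV _ smooth_flat_exp] smooth_on_diff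
        smooth_on_const smooth_on_norm2) auto
  have pos: "\<psi> y > 0" if y: "y \<in> K" for y
  proof -
    obtain x where x: "x \<in> D" "y \<in> ball x (r x)" using D y by auto
    then have "(norm (y - x))\<^sup>2 < (r x)\<^sup>2"
      by (intro power_strict_mono) (auto simp: dist_norm norm_minus_commute)
    then show ?thesis
      unfolding \<psi>_def using x D flat_exp_1_pos
      by (intro sum_pos2[of _ x]) auto
  qed
  obtain y0 where y0: "y0 \<in> K" "\<And>y. y \<in> K \<Longrightarrow> \<psi> y0 \<le> \<psi> y"
    using continuous_attains_inf[OF K False smooth_on_continuous[OF s\<psi>]] by blast
  \<comment> \<open>Half of the minimum on K, so that the set where the sum exceeds c is an open
    neighbourhood of K.\<close>
  define c where "c = \<psi> y0 / 2"
  have c: "c > 0" using pos y0 by (simp add: c_def)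
  show thesis
  proof (rule that[of "\<lambda>y. smooth_step (\<psi> y * (1 / c))" "{y. \<psi> y > c}" "\<Union>x\<in>D. cball x (r x)"])
    show "smooth_on UNIV (\<lambda>y. smooth_step (\<psi> y * (1 / c)))"
      by (intro smooth_on_compose[OF open_UNIV _ smooth_smooth_step] smooth_on_mult s\<psi> smooth_on_const) auto
    show "open {y. c < \<psi> y}"
      by (intro open_Collect_less continuous_intros smooth_on_continuous[OF s\<psi>])
    show "K \<subseteq> {y. c < \<psi> y}"
    proof
      fix y assume "y \<in> K"
      then show "y \<in> {y. c < \<psi> y}" using y0(2)[of y] pos[OF y0(1)] by (auto simp: c_def)
    qed
    show "smooth_step (\<psi> x * (1 / c)) = 1" if "x \<in> {y. c < \<psi> y}" for x
      using that c by (intro smooth_step_simps) (auto simp: field_simps)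
    show "closed (\<Union>x\<in>D. cball x (r x))" using D by auto
    show "(\<Union>x\<in>D. cball x (r x)) \<subseteq> W" using D r by blast
    fix y assume y: "y \<notin> (\<Union>x\<in>D. cball x (r x))"
    have "flat_exp 1 ((r x)\<^sup>2 - (norm (y - x))\<^sup>2) = 0" if "x \<in> D" for x
    proof -
      have "r x > 0" using that D r by auto
      moreover have "r x < norm (y - x)" using that y by (auto simp: dist_norm norm_minus_commute)
      ultimately have "(r x)\<^sup>2 \<le> (norm (y - x))\<^sup>2" by (intro power_mono) auto
      then show ?thesis by (intro flat_exp_1_pos) auto
    qed
    then have "\<psi> y = 0" by (simp add: \<psi>_def)
    then show "smooth_step (\<psi> y * (1 / c)) = 0" by (simp add: smooth_step_simps)
  qed
qed

text \<open>The cutoff product is smooth on W and zero on the open complement of C, and these two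
  sets cover the space. Agreement on an open set containing K transfers all derivatives at points of
  K.\<close>

lemma smooth_extension:
  fixes K W :: "'a::euclidean_space set"
  assumes K: "compact K" and W: "open W" "K \<subseteq> W" and f: "smooth_on W f"
  obtains F V where "smooth_on UNIV F" "open V" "K \<subseteq> V" "\<And>x. x \<in> V \<Longrightarrow> F x = f x"
proof -
  obtain \<zeta> V C where *: "smooth_on UNIV \<zeta>" "open V" "K \<subseteq> V" "\<And>x. x \<in> V \<Longrightarrow> \<zeta> x = 1"
    "closed C" "C \<subseteq> W" "\<And>x. x \<notin> C \<Longrightarrow> \<zeta> x = 0"
    using smooth_cutoff[OF K W] by blast
  define F where "F x = (if x \<in> W then \<zeta> x * f x else 0)" for x
  have "smooth_on W F"
    by (rule smooth_on_cong[of W "\<lambda>x. \<zeta> x * f x"])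
      (auto intro!: smooth_on_mult W f smooth_on_subset[OF *(1)] simp: F_def)
  moreover have "smooth_on (- C) F"
    by (rule smooth_on_cong[OF smooth_on_const[of _ 0]]) (use * in \<open>auto simp: F_def\<close>)
  moreover have "W \<union> - C = UNIV" using *(6) by auto
  ultimately have "smooth_on UNIV F" using smooth_on_Un[of W F "- C"] by simp
  moreover have "F x = f x" if "x \<in> V \<inter> W" for x using that * by (auto simp: F_def)
  ultimately show thesis
    using * W by (intro that[of F "V \<inter> W"]) auto
qed

section \<open>Borel measurability of the gradient of an arbitrary function\<close>

lemma norm_le_of_inner_near:
  fixes w x :: "'a::real_inner"
  assumes d: "d > 0" and c: "c \<ge> 0" and le: "\<And>y. dist y x < d \<Longrightarrow> \<bar>w \<bullet> (y - x)\<bar> \<le> c * dist y x"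
  shows "norm w \<le> c"
proof (cases "w = 0")
  case False
  \<comment> \<open>The estimate is tested with y - x = t w, of length d/2.\<close>
  define t where "t = d / (2 * norm w)"
  have t: "t > 0" using d False by (simp add: t_def)
  have "dist (x + t *\<^sub>R w) x < d" using d False by (simp add: dist_norm t_def)
  from le[OF this] have "t * (norm w * norm w) \<le> t * (c * norm w)"
    using t by (simp add: dist_norm abs_mult dot_square_norm power2_eq_square mult_ac)
  then show ?thesis using t False by simp
qed (use c in simp)

text \<open>Nothing is known about \<open>f\<close> away from the closed domain, but the boundary integrands involve its
  gradient on the whole space, and the area measure need not be complete. So measurability of the
  gradient of an arbitrary function is needed: strict differentiability estimates at a point define
  closed sets, and off the set of differentiability the junk value of the derivative is constant.\<close>

definition affine_approx :: "('a::euclidean_space \<Rightarrow> real) \<Rightarrow> real \<Rightarrow> real \<Rightarrow> 'a \<Rightarrow> 'a set" where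
  "affine_approx f e d L = {x. \<forall>y z. dist y x < d \<longrightarrow> dist z x < d \<longrightarrow>
      \<bar>f y - f z - L \<bullet> (y - z)\<bar> \<le> e * (dist y x + dist z x)}"

lemma affine_approxD:
  assumes "x \<in> affine_approx f e d L" "d > 0" "dist y x < d"
  shows "\<bar>f y - f x - L \<bullet> (y - x)\<bar> \<le> e * dist y x"
proof -
  have "\<forall>y z. dist y x < d \<longrightarrow> dist z x < d \<longrightarrow> \<bar>f y - f z - L \<bullet> (y - z)\<bar> \<le> e * (dist y x + dist z x)"
    using assms(1) by (simp add: affine_approx_def)
  from this[rule_format, of y x] show ?thesis using assms(2,3) by simp
qed

text \<open>The base point enters only through distances and never through the value of f there, so
  the estimate passes to limits without continuity of f. This is why \<open>affine_approx\<close>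
  compares two free points y and z.\<close>

lemma closed_affine_approx: "closed (affine_approx f e d L)"
  unfolding closed_sequential_limits
proof (intro allI impI, elim conjE)
  fix X l assume X: "\<forall>n. X n \<in> affine_approx f e d L" and l: "X \<longlonglongrightarrow> l"
  have "\<bar>f y - f z - L \<bullet> (y - z)\<bar> \<le> e * (dist y l + dist z l)" if "dist y l < d" "dist z l < d" for y z
  proof (rule tendsto_le[OF sequentially_bot])
    show "(\<lambda>n. e * (dist y (X n) + dist z (X n))) \<longlonglongrightarrow> e * (dist y l + dist z l)"
      by (intro tendsto_intros l)
    show "(\<lambda>n. \<bar>f y - f z - L \<bullet> (y - z)\<bar>) \<longlonglongrightarrow> \<bar>f y - f z - L \<bullet> (y - z)\<bar>" by simp
    have "\<forall>\<^sub>F n in sequentially. dist y (X n) < d" "\<forall>\<^sub>F n in sequentially. dist z (X n) < d"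
      using that by (auto intro!: order_tendstoD(2)[OF tendsto_dist[OF tendsto_const l]])
    then show "\<forall>\<^sub>F n in sequentially. \<bar>f y - f z - L \<bullet> (y - z)\<bar> \<le> e * (dist y (X n) + dist z (X n))"
      by eventually_elim (use X in \<open>auto simp: affine_approx_def\<close>)
  qed
  then show "l \<in> affine_approx f e d L" by (auto simp: affine_approx_def)
qed

lemma differentiable_estimate:
  assumes "f differentiable (at x)" "e > 0"
  obtains d where "d > 0" "\<And>y. dist y x < d \<Longrightarrow> \<bar>f y - f x - grad f x \<bullet> (y - x)\<bar> \<le> e * dist y x"
  using differentiable_has_derivative_grad[OF assms(1)] assms(2)
  unfolding has_derivative_at_alt dist_norm real_norm_def by blast

text \<open>One half of the error pays for the differentiability estimate, the other for replacing
  the gradient by L. All smaller radii are covered so that a radius from a countable sequence can be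
  picked.\<close>

lemma affine_approx_if_close:
  assumes f: "f differentiable (at x)" and L: "norm (grad f x - L) \<le> e / 2" and e: "e > 0"
  obtains d where "d > 0" "\<And>d'. d' \<le> d \<Longrightarrow> x \<in> affine_approx f e d' L"
proof -
  obtain d where d: "d > 0" "\<And>y. dist y x < d \<Longrightarrow> \<bar>f y - f x - grad f x \<bullet> (y - x)\<bar> \<le> e/2 * dist y x"
    using differentiable_estimate[OF f, of "e/2"] e by auto
  have "\<bar>f y - f z - L \<bullet> (y - z)\<bar> \<le> e * (dist y x + dist z x)" if "dist y x < d" "dist z x < d" for y z
  proof -
    have "\<bar>(grad f x - L) \<bullet> (y - z)\<bar> \<le> norm (grad f x - L) * norm (y - z)"
      by (rule Cauchy_Schwarz_ineq2)
    also have "\<dots> \<le> e / 2 * (dist y x + dist z x)"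
      using L e dist_triangle2[of y z x] by (intro mult_mono) (auto simp: dist_norm)
    finally have 1: "\<bar>(grad f x - L) \<bullet> (y - z)\<bar> \<le> e / 2 * (dist y x + dist z x)" .
    have "f y - f z - L \<bullet> (y - z) = (f y - f x - grad f x \<bullet> (y - x)) - (f z - f x - grad f x \<bullet> (z - x))
        + (grad f x - L) \<bullet> (y - z)"
      by (simp add: inner_diff_left inner_diff_right)
    then have "\<bar>f y - f z - L \<bullet> (y - z)\<bar> \<le> e/2 * dist y x + e/2 * dist z x + e / 2 * (dist y x + dist z x)"
      using d(2)[OF that(1)] d(2)[OF that(2)] 1 by linarith
    then show ?thesis by (simp add: field_simps)
  qed
  then show thesis using d by (intro that[of d]) (auto simp: affine_approx_def)
qed

lemma affine_approx_grad:
  assumes f: "f differentiable (at x)" and x: "x \<in> affine_approx f e d L" and "d > 0" "e > 0"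
  shows "norm (grad f x - L) \<le> e"
proof (rule field_le_epsilon)
  fix e' :: real assume e': "e' > 0"
  obtain d' where d': "d' > 0" "\<And>y. dist y x < d' \<Longrightarrow> \<bar>f y - f x - grad f x \<bullet> (y - x)\<bar> \<le> e' * dist y x"
    using differentiable_estimate[OF f e'] by auto
  show "norm (grad f x - L) \<le> e + e'"
  proof (rule norm_le_of_inner_near[of "min d d'"])
    fix y assume y: "dist y x < min d d'"
    have "\<bar>f y - f x - L \<bullet> (y - x)\<bar> \<le> e * dist y x"
      using affine_approxD[OF x \<open>d > 0\<close>] y by simp
    then show "\<bar>(grad f x - L) \<bullet> (y - x)\<bar> \<le> (e + e') * dist y x"
      using d'(2)[of y] y by (simp add: inner_diff_left distrib_right)
  qed (use assms d' e' in auto)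
qed

text \<open>The slopes may depend on the accuracy, but two of them differ by at most the sum of
  their errors; they form a Cauchy sequence whose limit is the derivative.\<close>

lemma differentiable_if_affine_approx:
  fixes f :: "'a::euclidean_space \<Rightarrow> real"
  assumes "\<And>n. \<exists>d>0. \<exists>L. x \<in> affine_approx f (inverse (real (Suc n))) d L"
  shows "f differentiable (at x)"
proof -
  define e where "e n = inverse (real (Suc n))" for n
  have e0: "e n > 0" for n by (simp add: e_def)
  have elim: "e \<longlonglongrightarrow> 0" unfolding e_def[abs_def] by (rule LIMSEQ_inverse_real_of_nat)
  obtain d L where dL: "\<And>n. d n > 0" "\<And>n. x \<in> affine_approx f (e n) (d n) (L n)"
    using assms unfolding e_def by metis
  have est: "\<bar>f y - f x - L n \<bullet> (y - x)\<bar> \<le> e n * dist y x" if "dist y x < d n" for y n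
    by (rule affine_approxD[OF dL(2,1) that])
  have LL: "norm (L n - L m) \<le> e n + e m" for n m
  proof (rule norm_le_of_inner_near[of "min (d n) (d m)"])
    fix y assume "dist y x < min (d n) (d m)"
    then show "\<bar>(L n - L m) \<bullet> (y - x)\<bar> \<le> (e n + e m) * dist y x"
      using est[of y n] est[of y m] by (simp add: inner_diff_left distrib_right)
  qed (use dL e0[of n] e0[of m] in auto)
  have "Cauchy L"
  proof (rule CauchyI)
    fix \<epsilon> :: real assume "\<epsilon> > 0"
    then obtain N where N: "\<And>n. n \<ge> N \<Longrightarrow> e n < \<epsilon> / 2"
      using order_tendstoD(2)[OF elim, of "\<epsilon>/2"] unfolding eventually_sequentially by auto
    then show "\<exists>M. \<forall>m\<ge>M. \<forall>n\<ge>M. norm (L m - L n) < \<epsilon>"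
      using LL by (intro exI[of _ N]) (smt (verit) field_sum_of_halves)
  qed
  then obtain g where g: "L \<longlonglongrightarrow> g" using Cauchy_convergent convergent_def by blast
  have Lg: "norm (L n - g) \<le> e n" for n
  proof (rule tendsto_le[OF sequentially_bot])
    show "(\<lambda>m. e n + e m) \<longlonglongrightarrow> e n" using tendsto_add[OF tendsto_const elim, of "e n"] by simp
    show "(\<lambda>m. norm (L n - L m)) \<longlonglongrightarrow> norm (L n - g)" by (intro tendsto_intros g)
  qed (use LL in auto)
  have "(f has_derivative (\<lambda>v. g \<bullet> v)) (at x)"
    unfolding has_derivative_at_alt
  proof (intro conjI allI impI)
    fix \<epsilon> :: real assume "\<epsilon> > 0"
    then obtain n where n: "e n < \<epsilon> / 2"
      using order_tendstoD(2)[OF elim, of "\<epsilon>/2"] unfolding eventually_sequentially by auto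
    show "\<exists>d>0. \<forall>y. norm (y - x) < d \<longrightarrow> norm (f y - f x - g \<bullet> (y - x)) \<le> \<epsilon> * norm (y - x)"
    proof (intro exI[of _ "d n"] conjI allI impI dL)
      fix y assume y: "norm (y - x) < d n"
      have "\<bar>(L n - g) \<bullet> (y - x)\<bar> \<le> e n * norm (y - x)"
        using Cauchy_Schwarz_ineq2[of "L n - g" "y - x"] mult_right_mono[OF Lg[of n] norm_ge_zero[of "y - x"]]
        by linarith
      moreover have "\<bar>f y - f x - L n \<bullet> (y - x)\<bar> \<le> e n * norm (y - x)"
        using est[of y n] y by (simp add: dist_norm)
      ultimately have "\<bar>f y - f x - g \<bullet> (y - x)\<bar> \<le> 2 * e n * norm (y - x)"
        unfolding inner_diff_left by linarith
      also have "\<dots> \<le> \<epsilon> * norm (y - x)" using n by (intro mult_right_mono) auto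
      finally show "norm (f y - f x - g \<bullet> (y - x)) \<le> \<epsilon> * norm (y - x)" by simp
    qed
  qed (rule bounded_linear_inner_right)
  then show ?thesis by (auto simp: differentiable_def)
qed

lemma borel_measurable_grad:
  fixes f :: "'a::euclidean_space \<Rightarrow> real"
  shows "grad f \<in> borel_measurable borel"
proof -
  obtain Q :: "'a set" where Q: "countable Q" "\<And>X. open X \<Longrightarrow> X \<noteq> {} \<Longrightarrow> \<exists>d\<in>Q. d \<in> X"
    using countable_dense_setE by blast
  define e where "e n = inverse (real (Suc n))" for n
  have e0: "e n > 0" for n by (simp add: e_def)
  have elim: "e \<longlonglongrightarrow> 0" unfolding e_def[abs_def] by (rule LIMSEQ_inverse_real_of_nat)
  \<comment> \<open>Points where slope L is accurate up to \<open>e n\<close> at some scale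
    \<open>e m\<close>: a countable union of closed sets. With L restricted to the countable set Q,
    the differentiability set D becomes Borel.\<close>
  define B where "B n L = (\<Union>m. affine_approx f (e n) (e m) L)" for n L
  have B[measurable]: "B n L \<in> sets borel" for n L
    unfolding B_def by (intro sets.countable_UN) (auto intro: borel_closed closed_affine_approx)
  have Bs: "range (\<lambda>n. \<Union>L\<in>Q. B n L) \<subseteq> sets borel"
    by (auto intro!: sets.countable_UN' Q B)
  define D where "D = (\<Inter>n. \<Union>L\<in>Q. B n L)"
  have Dm[measurable]: "D \<in> sets borel"
    unfolding D_def by (rule sets.countable_INT[OF Bs]) auto
  have close: "x \<in> B n L" if fL: "f differentiable (at x)" "norm (grad f x - L) \<le> e n / 2" for x n L
  proof -
    obtain d where d: "d > 0" "\<And>d'. d' \<le> d \<Longrightarrow> x \<in> affine_approx f (e n) d' L"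
      using affine_approx_if_close[OF fL e0] by blast
    obtain m where "e m < d"
      using order_tendstoD(2)[OF elim d(1)] unfolding eventually_sequentially by auto
    then show ?thesis using d(2)[of "e m"] by (auto simp: B_def)
  qed
  have near: "\<exists>L\<in>Q. norm (g - L) < e n / 2" for g n
    using Q(2)[of "ball g (e n / 2)"] e0[of n] by (auto simp: dist_norm)
  have D_iff: "x \<in> D \<longleftrightarrow> f differentiable (at x)" for x
  proof
    assume "x \<in> D"
    show "f differentiable (at x)"
    proof (rule differentiable_if_affine_approx)
      fix n
      obtain L m where "x \<in> affine_approx f (e n) (e m) L"
        using \<open>x \<in> D\<close> unfolding D_def B_def by blast
      then show "\<exists>d>0. \<exists>L. x \<in> affine_approx f (inverse (real (Suc n))) d L"
        using e0[of m] unfolding e_def[of n] by blast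
    qed
  next
    assume f: "f differentiable (at x)"
    have "\<exists>L\<in>Q. x \<in> B n L" for n
      using near[of "grad f x" n] close[OF f, of _ n] by (meson less_imp_le)
    then show "x \<in> D" unfolding D_def by blast
  qed
  define c where "c = (\<Sum>b\<in>Basis. (SOME f'::'a \<Rightarrow> real. False) b *\<^sub>R b)"
  have junk: "grad f x = c" if "x \<notin> D" for x
  proof -
    have "(\<lambda>f'. (f has_derivative f') (at x)) = (\<lambda>f'. False)"
      using that D_iff[of x] by (auto simp: differentiable_def)
    then show ?thesis unfolding grad_def pd_def frechet_derivative_def c_def by simp
  qed
  show ?thesis
  proof (rule borel_measurableI)
    fix U :: "'a set" assume U: "open U"
    \<comment> \<open>A slope of Q within \<open>e n / 2\<close> of the gradient puts x into
      \<open>B n L\<close>; conversely, membership of a differentiability point in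
      \<open>B n L\<close> confines the gradient to \<open>cball L (e n)\<close>. So closed balls
      inside U detect whether the gradient lies in U.\<close>
    have "grad f -` U \<inter> space borel = (D \<inter> (\<Union>n. \<Union>L\<in>{L\<in>Q. cball L (e n) \<subseteq> U}. B n L)) \<union> (if c \<in> U then - D else {})"
    proof (intro set_eqI iffI)
      fix x assume x: "x \<in> grad f -` U \<inter> space borel"
      show "x \<in> (D \<inter> (\<Union>n. \<Union>L\<in>{L\<in>Q. cball L (e n) \<subseteq> U}. B n L)) \<union> (if c \<in> U then - D else {})"
      proof (cases "x \<in> D")
        case True
        obtain r where r: "r > 0" "ball (grad f x) r \<subseteq> U" using U x by (auto simp: open_contains_ball)
        obtain n where n: "e n < r / 2"
          using order_tendstoD(2)[OF elim, of "r/2"] r unfolding eventually_sequentially by auto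
        obtain L where L: "L \<in> Q" "norm (grad f x - L) < e n / 2" using near by blast
        have "cball L (e n) \<subseteq> U"
        proof
          fix y assume "y \<in> cball L (e n)"
          then have "dist (grad f x) y < r"
            using dist_triangle[of "grad f x" y L] L n e0[of n] by (auto simp: dist_norm)
          then show "y \<in> U" using r by auto
        qed
        moreover have "x \<in> B n L" using close D_iff True L by auto
        ultimately show ?thesis using True L by auto
      next
        case False
        then show ?thesis using junk x by auto
      qed
    next
      fix x assume x: "x \<in> (D \<inter> (\<Union>n. \<Union>L\<in>{L\<in>Q. cball L (e n) \<subseteq> U}. B n L)) \<union> (if c \<in> U then - D else {})"
      show "x \<in> grad f -` U \<inter> space borel"
      proof (cases "x \<in> D")
        case True
        then obtain n m L where *: "cball L (e n) \<subseteq> U" "x \<in> affine_approx f (e n) (e m) L"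
          using x by (auto simp: B_def split: if_splits)
        then have "norm (grad f x - L) \<le> e n"
          using affine_approx_grad e0 True D_iff by blast
        then show ?thesis using * by (auto simp: dist_norm norm_minus_commute subset_iff)
      next
        case False
        then show ?thesis using x junk by (auto split: if_splits)
      qed
    qed
    moreover have "(\<Union>L\<in>{L\<in>Q. cball L (e n) \<subseteq> U}. B n L) \<in> sets borel" for n
      by (rule sets.countable_UN') (auto intro: countable_subset[OF _ Q(1)] B)
    then have "(\<Union>n. \<Union>L\<in>{L\<in>Q. cball L (e n) \<subseteq> U}. B n L) \<in> sets borel" by blast
    moreover have "(if c \<in> U then - D else {}) \<in> sets borel" using Dm by (auto simp: Compl_eq_Diff_UNIV)
    ultimately show "grad f -` U \<inter> space borel \<in> sets borel" using Dm by auto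
  qed
qed

section \<open>Integrals of partial derivatives over the whole space\<close>

lemma integrable_continuous_bounded_support:
  fixes K :: "'a::euclidean_space \<Rightarrow> real"
  assumes "continuous_on UNIV K" "bounded A" "\<And>x. x \<notin> A \<Longrightarrow> K x = 0"
  shows "integrable lborel K"
proof -
  have "integrable lborel (\<lambda>x. indicator (closure A) x *\<^sub>R K x)"
    by (rule borel_integrable_compact)
      (use assms continuous_on_subset[OF assms(1)] in \<open>auto simp: compact_closure\<close>)
  moreover
  have "indicator (closure A) x *\<^sub>R K x = K x" for x
    using assms(3) closure_subset[of A] by (cases "x \<in> closure A") auto
  then have "(\<lambda>x. indicator (closure A) x *\<^sub>R K x) = K" by blast
  ultimately show ?thesis by simp
qed

text \<open>By translation invariance the integral of every difference quotient vanishes.\<close>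

lemma integral_pd_eq_0:
  fixes K :: "'a::euclidean_space \<Rightarrow> real"
  assumes diff: "\<And>x. K differentiable (at x)" and cont: "continuous_on UNIV (pd v K)"
    and A: "bounded A" "\<And>x. x \<notin> A \<Longrightarrow> K x = 0"
  shows "integral\<^sup>L lborel (pd v K) = 0"
proof -
  have contK: "continuous_on UNIV K"
    using diff by (simp add: continuous_at_imp_continuous_on differentiable_imp_continuous_within)
  have intK: "integrable lborel K"
    by (rule integrable_continuous_bounded_support[OF contK A])
  have pd0: "pd v K x = 0" if "x \<notin> closure A" for x
  proof -
    have "pd v K x = pd v (\<lambda>_. 0) x"
      by (rule pd_cong_open[of "- closure A"]) (use that A closure_subset in auto)
    then show ?thesis by (simp add: pd_const)
  qed
  have "bounded (pd v K ` closure A)"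
    using A by (intro compact_imp_bounded compact_continuous_image continuous_on_subset[OF cont])
      (auto simp: compact_closure)
  then obtain M where M: "\<And>x. x \<in> closure A \<Longrightarrow> \<bar>pd v K x\<bar> \<le> M" "M > 0"
    unfolding bounded_pos by auto
  then have M': "\<bar>pd v K x\<bar> \<le> M" for x using pd0[of x] by (cases "x \<in> closure A") auto
  obtain R where R: "R > 0" "\<And>x. x \<in> A \<Longrightarrow> norm x \<le> R"
    using A unfolding bounded_pos by auto
  \<comment> \<open>The steps \<open>h n\<close> are at most 1, so outside this ball both K and its
    translate vanish; with the mean value bound M this yields an integrable dominating
    function.\<close>
  define B where "B = cball (0::'a) (R + norm v)"
  define h :: "nat \<Rightarrow> real" where "h n = inverse (real (Suc n))" for n
  have h: "h n > 0" "h n \<le> 1" for n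
    by (auto simp: h_def field_simps)
  define s where "s n x = (K (x + h n *\<^sub>R v) - K x) / h n" for n x
  have lim: "(\<lambda>n. s n x) \<longlonglongrightarrow> pd v K x" for x
  proof -
    have "((\<lambda>t. (K (x + t *\<^sub>R v) - K x) / t) \<longlongrightarrow> pd v K x) (at 0)"
      using DERIV_line[of K x 0 v] diff by (simp add: DERIV_def)
    moreover have "filterlim h (at 0) sequentially"
      unfolding filterlim_at using LIMSEQ_inverse_real_of_nat h(1)
      by (auto simp: h_def[abs_def])
    ultimately show ?thesis
      unfolding s_def by (rule filterlim_compose)
  qed
  have bd: "\<bar>s n x\<bar> \<le> M * indicator B x" for n x
  proof (cases "x \<in> B")
    case True
    have "\<exists>t>0. t < h n \<and> K (x + h n *\<^sub>R v) - K (x + 0 *\<^sub>R v) = (h n - 0) * pd v K (x + t *\<^sub>R v)"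
      by (rule MVT2[OF h(1)]) (rule DERIV_line[OF diff])
    then show ?thesis using True M' h(1)[of n] by (auto simp: s_def abs_mult)
  next
    case False
    have "x \<notin> A" using False R norm_ge_zero[of v] by (fastforce simp: B_def)
    moreover have "x + h n *\<^sub>R v \<notin> A"
    proof
      assume "x + h n *\<^sub>R v \<in> A"
      then have "norm (x + h n *\<^sub>R v) \<le> R" by (rule R)
      moreover have "norm x \<le> norm (x + h n *\<^sub>R v) + norm (h n *\<^sub>R v)"
        using norm_triangle_ineq4[of "x + h n *\<^sub>R v" "h n *\<^sub>R v"] by simp
      moreover have "norm (h n *\<^sub>R v) \<le> norm v" using h[of n] by (simp add: mult_left_le_one_le)
      ultimately show False using False by (simp add: B_def)
    qed
    ultimately show ?thesis using False A by (simp add: s_def)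
  qed
  have ints: "integral\<^sup>L lborel (s n) = 0" for n
  proof -
    have "integrable (distr lborel borel ((+) (h n *\<^sub>R v))) K" using intK by (simp add: lborel_distr_plus)
    then have i1: "integrable lborel (\<lambda>x. K (h n *\<^sub>R v + x))"
      by (subst (asm) integrable_distr_eq) (auto intro: borel_measurable_continuous_onI[OF contK])
    have "integral\<^sup>L lborel K = integral\<^sup>L (distr lborel borel ((+) (h n *\<^sub>R v))) K" by (simp add: lborel_distr_plus)
    also have "\<dots> = integral\<^sup>L lborel (\<lambda>x. K (h n *\<^sub>R v + x))"
      by (subst integral_distr) (auto intro: borel_measurable_continuous_onI[OF contK])
    finally show ?thesis
      using i1 intK unfolding s_def by (simp add: add.commute)
  qed
  have "(\<lambda>n. integral\<^sup>L lborel (s n)) \<longlonglongrightarrow> integral\<^sup>L lborel (pd v K)"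
  proof (rule integral_dominated_convergence[where w="\<lambda>x. M * indicator B x"])
    show "pd v K \<in> borel_measurable lborel"
      using borel_measurable_continuous_onI[OF cont] by simp
    show "s n \<in> borel_measurable lborel" for n
    proof -
      have "continuous_on UNIV (s n)"
        unfolding s_def using h(1)[of n]
        by (intro continuous_intros continuous_on_compose2[OF contK]) auto
      then show ?thesis using borel_measurable_continuous_onI by simp
    qed
    show "integrable lborel (\<lambda>x. M * indicator B x)"
      unfolding B_def by (intro integrable_mult_right integrable_real_indicator) (auto simp: emeasure_lborel_cball_finite[unfolded infinity_ennreal_def])
  qed (use lim bd in auto)
  then show ?thesis using ints by (simp add: LIMSEQ_const_iff)
qed

section \<open>The profile of the boundary layer\<close>

lemma DERIV_max_power:
  assumes "n \<ge> 2"
  shows "((\<lambda>x::real. (max 0 x) ^ n) has_real_derivative real n * (max 0 x) ^ (n - 1)) (at x)"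
proof -
  consider "x > 0" | "x < 0" | "x = 0" by linarith
  then show ?thesis
  proof cases
    case 1
    have "((\<lambda>x. x ^ n) has_real_derivative real n * (max 0 x) ^ (n - 1)) (at x)"
      using 1 by (auto intro!: derivative_eq_intros)
    then show ?thesis
      by (rule has_field_derivative_transform_within_open[of _ _ _ "{0<..}"]) (use 1 in auto)
  next
    case 2
    have "((\<lambda>x. 0) has_real_derivative real n * (max 0 x) ^ (n - 1)) (at x)"
      using 2 assms by (auto simp: power_0_left)
    then show ?thesis
      by (rule has_field_derivative_transform_within_open[of _ _ _ "{..<0}"]) (use 2 assms in auto)
  next
    case 3
    have "((\<lambda>h. (max 0 (0 + h) ^ n - max 0 0 ^ n) / h) \<longlongrightarrow> 0) (at (0::real))"
    proof (rule Lim_null_comparison[where g="\<lambda>h. \<bar>h\<bar>"])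
      have "norm ((max 0 (0 + h) ^ n - max 0 0 ^ n) / h) \<le> \<bar>h\<bar>" if "\<bar>h\<bar> < 1" "h \<noteq> 0" for h :: real
      proof -
        have "max 0 h ^ n \<le> max 0 h ^ 2" using that assms by (intro power_decreasing) auto
        also have "\<dots> \<le> \<bar>h\<bar> * \<bar>h\<bar>" by (auto simp: power2_eq_square max_def)
        finally show ?thesis using that assms by (simp add: abs_divide divide_le_eq power_0_left)
      qed
      then show "\<forall>\<^sub>F h in at 0. norm ((max 0 (0 + h) ^ n - max 0 0 ^ n) / h) \<le> \<bar>h\<bar>"
        unfolding eventually_at by (intro exI[of _ 1]) (auto simp: dist_real_def)
      show "((\<lambda>h. \<bar>h\<bar>) \<longlongrightarrow> 0) (at (0::real))" by (auto intro!: tendsto_eq_intros)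
    qed
    then show ?thesis using 3 assms by (simp add: DERIV_def power_0_left)
  qed
qed

definition layer_step :: "real \<Rightarrow> real" where
  "layer_step t = 3 * (max 0 (-t))^2 - 2 * (max 0 (-t))^3 + 3 * (max 0 (-1-t))^2 + 2 * (max 0 (-1-t))^3"

text \<open>Minus the derivative of \<open>layer_step\<close>: the bump 6 s (1 - s) with s = -t on
  [-1,0], of total mass 1.\<close>

definition layer_kernel :: "real \<Rightarrow> real" where
  "layer_kernel t = 6 * max 0 (-t) - 6 * (max 0 (-t))^2 + 6 * max 0 (-1-t) + 6 * (max 0 (-1-t))^2"

lemma DERIV_layer_step: "(layer_step has_real_derivative - layer_kernel t) (at t)"
  unfolding layer_step_def[abs_def] layer_kernel_def
proof -
  have m1: "((\<lambda>t. (max 0 (-t)) ^ n) has_real_derivative (real n * (max 0 (-t)) ^ (n-1)) * (-1)) (at t)"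
    if "n \<ge> 2" for n
    by (rule DERIV_chain2[OF DERIV_max_power[OF that]]) (auto intro!: derivative_eq_intros)
  have m2: "((\<lambda>t. (max 0 (-1-t)) ^ n) has_real_derivative (real n * (max 0 (-1-t)) ^ (n-1)) * (-1)) (at t)"
    if "n \<ge> 2" for n
    by (rule DERIV_chain2[OF DERIV_max_power[OF that]]) (auto intro!: derivative_eq_intros)
  show "((\<lambda>t. 3 * (max 0 (-t))^2 - 2 * (max 0 (-t))^3 + 3 * (max 0 (-1-t))^2 + 2 * (max 0 (-1-t))^3)
    has_real_derivative - (6 * max 0 (-t) - 6 * (max 0 (-t))^2 + 6 * max 0 (-1-t) + 6 * (max 0 (-1-t))^2)) (at t)"
    by (rule DERIV_cong, (rule DERIV_add DERIV_diff DERIV_cmult m1 m2; simp?)+) simp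
qed

lemma continuous_on_layer_kernel: "continuous_on A layer_kernel"
  unfolding layer_kernel_def[abs_def] by (intro continuous_intros)

lemma layer_kernel_eq: "layer_kernel t = (if -1 < t \<and> t < 0 then 6 * (-t) * (1 + t) else 0)"
  unfolding layer_kernel_def by (auto simp: max_def power2_eq_square algebra_simps)

lemma layer_kernel_nonneg: "layer_kernel t \<ge> 0"
  unfolding layer_kernel_eq by (auto intro!: mult_nonpos_nonneg)

lemma layer_step_simps: "t \<ge> 0 \<Longrightarrow> layer_step t = 0" "t \<le> -1 \<Longrightarrow> layer_step t = 1"
  unfolding layer_step_def by (auto simp: max_def power2_eq_square power3_eq_cube algebra_simps)

lemma layer_step_bounds: "0 \<le> layer_step t" "layer_step t \<le> 1"
proof -
  have mono: "layer_step b \<le> layer_step a" if "a \<le> b" for a b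
    by (rule DERIV_nonpos_imp_nonincreasing[OF that])
      (use DERIV_layer_step layer_kernel_nonneg in \<open>meson neg_le_0_iff_le\<close>)
  show "0 \<le> layer_step t" using mono[of t "max t 0"] layer_step_simps(1)[of "max t 0"] by simp
  show "layer_step t \<le> 1" using mono[of "min t (-1)" t] layer_step_simps(2)[of "min t (-1)"] by simp
qed

subsection \<open>Graph charts\<close>

lemma Basis_vec_eq: "(Basis :: (real^'n) set) = range (\<lambda>j. axis j 1)"
  by (auto simp: Basis_vec_def)

lemma inj_axis_1: "inj (\<lambda>j. axis j (1::real))"
  by (auto simp: inj_on_def axis_eq_axis)

lemma prod_Basis_vec:
  fixes f :: "real^'n \<Rightarrow> 'b::comm_monoid_mult"
  shows "(\<Prod>b\<in>Basis. f b) = (\<Prod>j\<in>UNIV. f (axis j 1))"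
  unfolding Basis_vec_eq by (subst prod.reindex[OF inj_axis_1]) simp

text \<open>An orthogonal R taking v to a multiple of a coordinate axis conjugates the matrix to a
  diagonal one with entries 1 except for a single 1 + v . v. Gram matrices of graphs have this
  form.\<close>

lemma det_identity_plus_outer:
  fixes v :: "real^'m"
  shows "det (\<chi> k l. (if k = l then 1 else 0) + v $ k * v $ l) = 1 + v \<bullet> v"
proof -
  define M :: "real^'m^'m" where "M = (\<chi> k l. (if k = l then 1 else 0) + v $ k * v $ l)"
  obtain k0 :: 'm where True by blast
  obtain f :: "real^'m \<Rightarrow> real^'m" where f: "orthogonal_transformation f" "f v = norm v *\<^sub>R axis k0 1"
    using orthogonal_transformation_exists[of v "norm v *\<^sub>R axis k0 1"] by auto
  define R where "R = matrix f"
  have lf: "linear f" using f orthogonal_transformation_linear by blast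
  have R: "orthogonal_matrix R"
    using f orthogonal_transformation_matrix R_def by blast
  have Rv: "R *v v = norm v *\<^sub>R axis k0 1"
    unfolding R_def by (simp add: matrix_works lf f)
  have RT: "R ** transpose R = mat 1" using R by (simp add: orthogonal_matrix_def)
  define D :: "real^'m^'m" where "D = (\<chi> i j. if i = j then (if i = k0 then 1 + v \<bullet> v else 1) else 0)"
  have if_mult: "(if b then 1 else 0) * y = (if b then y else 0)" for b and y :: real by simp
  have Mx: "M *v x = x + (v \<bullet> x) *\<^sub>R v" for x
    unfolding M_def matrix_vector_mult_def vec_eq_iff
    by (simp add: inner_vec_def distrib_right sum.distrib if_mult mult.assoc flip: sum_distrib_left)
  have Dx: "D *v x = x + ((v \<bullet> v) * x $ k0) *\<^sub>R axis k0 1" for x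
  proof -
    have "(D *v x) $ i = (\<Sum>j\<in>UNIV. if i = j then (if i = k0 then 1 + v \<bullet> v else 1) * x $ j else 0)" for i
      unfolding D_def matrix_vector_mult_def vec_lambda_beta by (rule sum.cong) auto
    then have "(D *v x) $ i = (if i = k0 then 1 + v \<bullet> v else 1) * x $ i" for i by simp
    then show ?thesis by (simp add: vec_eq_iff axis_def distrib_right)
  qed
  have "(R ** M ** transpose R) *v x = D *v x" for x
  proof -
    have "v \<bullet> (transpose R *v x) = (x v* R) \<bullet> v"
      unfolding transpose_matrix_vector by (rule inner_commute)
    also have "\<dots> = x \<bullet> (R *v v)" by (rule dot_lmul_matrix)
    also have "\<dots> = norm v * x $ k0" unfolding Rv by (simp add: inner_axis)
    finally have 1: "v \<bullet> (transpose R *v x) = norm v * x $ k0" .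
    have "(R ** M ** transpose R) *v x = R *v (M *v (transpose R *v x))"
      by (simp only: matrix_vector_mul_assoc matrix_mul_assoc)
    also have "\<dots> = R *v (transpose R *v x) + (norm v * x $ k0) *\<^sub>R (R *v v)"
      unfolding Mx 1 by (simp add: matrix_vector_right_distrib matrix_vector_mult_scaleR)
    also have "\<dots> = D *v x"
      unfolding matrix_vector_mul_assoc RT Rv Dx
      by (simp add: power2_norm_eq_inner[symmetric] power2_eq_square mult_ac)
    finally show ?thesis .
  qed
  then have "R ** M ** transpose R = D" by (simp add: matrix_eq)
  then have DM: "det R * det M * det R = det D" by (metis det_mul det_transpose)
  have RR: "det R * det R = 1"
    using det_orthogonal_matrix[OF R] by auto
  have DD: "det D = 1 + v \<bullet> v"
  proof -
    have "det D = (\<Prod>i\<in>UNIV. D $ i $ i)" by (rule det_diagonal) (simp add: D_def)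
    also have "\<dots> = 1 + v \<bullet> v" by (simp add: D_def prod.If_cases)
    finally show ?thesis .
  qed
  have "det M = (det R * det R) * det M" unfolding RR by simp
  also have "\<dots> = det R * det M * det R" by (simp only: mult_ac)
  finally show ?thesis unfolding DM DD unfolding M_def .
qed

text \<open>Coordinates \<open>emb s t\<close> in which the zero set of \<open>\<phi>\<close> is a graph over the hyperplane
  \<open>s = 0\<close>, in a tube around a zero of \<open>\<phi>\<close>.\<close>

locale graph_coords =
  fixes a :: "real^'n" and \<beta> :: "'m::finite \<Rightarrow> 'n" and i0 :: 'n
  assumes a: "a = axis i0 1 \<or> a = - axis i0 1"
    and \<beta>: "inj \<beta>" "range \<beta> = UNIV - {i0}"
begin

definition J :: "real^'m \<Rightarrow> real^'n" where "J t = (\<Sum>k\<in>UNIV. t $ k *\<^sub>R axis (\<beta> k) 1)"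
definition emb :: "real \<Rightarrow> real^'m \<Rightarrow> real^'n" where "emb s t = s *\<^sub>R a + J t"
definition prj :: "real^'n \<Rightarrow> real^'m" where "prj x = (\<chi> k. x $ \<beta> k)"

lemma \<beta>_ne: "\<beta> k \<noteq> i0" using \<beta>(2) by auto

lemma \<beta>_eq: "\<beta> k = \<beta> l \<longleftrightarrow> k = l" using \<beta>(1) by (auto dest: injD)

lemma UNIV_eq: "UNIV = insert i0 (range \<beta>)" using \<beta>(2) by auto

lemma sum_UNIV_split: "(\<Sum>j\<in>UNIV. f j) = f i0 + (\<Sum>k\<in>UNIV. f (\<beta> k))" for f :: "'n \<Rightarrow> real"
  using sum.remove[of UNIV i0 f] sum.reindex[OF \<beta>(1), of f] by (simp add: \<beta>(2))

lemma prod_UNIV_split: "(\<Prod>j\<in>UNIV. f j) = f i0 * (\<Prod>k\<in>UNIV. f (\<beta> k))" for f :: "'n \<Rightarrow> real"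
  using prod.remove[of UNIV i0 f] prod.reindex[OF \<beta>(1), of f] by (simp add: \<beta>(2))

lemma all_split: "(\<forall>j. P j) \<longleftrightarrow> P i0 \<and> (\<forall>k. P (\<beta> k))"
proof -
  have "(\<forall>j. P j) \<longleftrightarrow> (\<forall>j\<in>insert i0 (range \<beta>). P j)" unfolding UNIV_eq[symmetric] by simp
  then show ?thesis by simp
qed

lemma a_nth: "a $ \<beta> k = 0" using a \<beta>_ne by (auto simp: axis_def)

lemma a_a: "a \<bullet> a = 1" using a by (auto simp: inner_axis_axis)

lemma norm_a: "norm a = 1" by (simp add: norm_eq_sqrt_inner a_a)

lemma J_nth: "J t $ \<beta> k = t $ k" "J t $ i0 = 0"
  unfolding J_def by (auto simp: axis_def \<beta>_eq \<beta>_ne \<beta>_ne[symmetric] if_distrib cong: if_cong)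

lemma all_nth: "(\<And>k. x $ \<beta> k = y $ \<beta> k) \<Longrightarrow> x $ i0 = y $ i0 \<Longrightarrow> x = y" for x y :: "real^'n"
proof -
  assume *: "\<And>k. x $ \<beta> k = y $ \<beta> k" "x $ i0 = y $ i0"
  have "x $ i = y $ i" for i
    using UNIV_I[of i] unfolding UNIV_eq using * by auto
  then show ?thesis by (simp add: vec_eq_iff)
qed

lemma linear_J: "linear J"
  unfolding J_def by (rule linearI) (simp_all add: scaleR_add_left sum.distrib scaleR_sum_right)

lemma J_axis: "J (axis k 1) = axis (\<beta> k) 1"
  unfolding J_def by (simp add: axis_def if_distrib[of "\<lambda>x. x *\<^sub>R _"] cong: if_cong)

lemma bounded_linear_J: "bounded_linear J" using linear_J by (simp add: linear_conv_bounded_linear)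

lemma linear_prj: "linear prj"
  unfolding prj_def by (rule linearI) (simp_all add: vec_eq_iff)

lemma bounded_linear_prj: "bounded_linear prj" using linear_prj by (simp add: linear_conv_bounded_linear)

lemma inner_a: "x \<bullet> a = x $ i0 * a $ i0"
  using a by (elim disjE) (simp_all add: inner_axis axis_nth)

lemma a_i0: "a $ i0 * a $ i0 = 1" using a by (auto simp: axis_def)

lemma J_a: "J t \<bullet> a = 0" by (simp add: inner_a J_nth)

lemma emb_inner_a: "emb s t \<bullet> a = s" by (simp add: emb_def inner_add_left J_a a_a)

lemma prj_emb: "prj (emb s t) = t" by (simp add: emb_def prj_def vec_eq_iff a_nth J_nth)

lemma emb_prj: "emb (x \<bullet> a) (prj x) = x"
proof (rule all_nth)
  show "emb (x \<bullet> a) (prj x) $ i0 = x $ i0"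
    using a_i0 by (simp add: emb_def J_nth inner_a mult.assoc)
qed (simp add: emb_def J_nth a_nth prj_def)

lemma inner_decomp: "x \<bullet> y = (x \<bullet> a) * (y \<bullet> a) + prj x \<bullet> prj y" for x y :: "real^'n"
proof -
  have "x \<bullet> y = x $ i0 * y $ i0 + (\<Sum>k\<in>UNIV. x $ \<beta> k * y $ \<beta> k)"
    unfolding inner_vec_def sum_UNIV_split by simp
  also have "x $ i0 * y $ i0 = (x \<bullet> a) * (y \<bullet> a)"
    using a_i0 by (simp add: inner_a mult_ac)
  finally show ?thesis by (simp add: prj_def inner_vec_def)
qed

lemma norm_J: "norm (J t) = norm t"
proof -
  have "prj (J t) = t" by (simp add: prj_def vec_eq_iff J_nth)
  then have "J t \<bullet> J t = t \<bullet> t" using inner_decomp[of "J t" "J t"] by (simp add: J_a)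
  then show ?thesis by (simp add: norm_eq_sqrt_inner)
qed

lemma norm_emb_diff: "norm (emb s t - emb s' t') \<le> \<bar>s - s'\<bar> + norm (t - t')"
proof -
  have "emb s t - emb s' t' = (s - s') *\<^sub>R a + J (t - t')"
    using linear_diff[OF linear_J] by (simp add: emb_def algebra_simps)
  then show ?thesis
    using norm_triangle_ineq[of "(s - s') *\<^sub>R a" "J (t - t')"] by (simp add: norm_J norm_a)
qed

lemma continuous_on_emb[continuous_intros]:
  "continuous_on A f \<Longrightarrow> continuous_on A g \<Longrightarrow> continuous_on A (\<lambda>x. emb (f x) (g x))"
  unfolding emb_def
  by (intro continuous_intros bounded_linear.continuous_on[OF bounded_linear_J])

text \<open>\<open>emb\<close> only permutes coordinates and possibly flips one sign, so boxes go to
  boxes of the same volume. This gives Fubini in the coordinates height s and base t.\<close>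

lemma distr_emb: "distr (lborel \<Otimes>\<^sub>M lborel) borel (\<lambda>(s,t). emb s t) = lborel"
proof (rule lborel_eqI[symmetric])
  have meas: "(\<lambda>(s,t). emb s t) \<in> measurable (lborel \<Otimes>\<^sub>M lborel) borel"
    unfolding lborel_prod measurable_lborel1 case_prod_beta
    by (simp, intro borel_measurable_continuous_onI continuous_intros)
  fix l u :: "real^'n" assume lu: "\<And>b. b \<in> Basis \<Longrightarrow> l \<bullet> b \<le> u \<bullet> b"
  have lu': "l $ j \<le> u $ j" for j using lu[of "axis j 1"] by (simp add: inner_axis axis_in_Basis_iff)
  \<comment> \<open>If a is a negative axis vector, the order of the endpoints is reversed in the
    coordinate s; hence minimum and maximum.\<close>
  define m where "m = min (l \<bullet> a) (u \<bullet> a)"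
  define M where "M = max (l \<bullet> a) (u \<bullet> a)"
  have a_pm: "a $ i0 = 1 \<or> a $ i0 = -1" using a by (auto simp: axis_def)
  have "emb s t \<in> box l u \<longleftrightarrow> m < s \<and> s < M \<and> t \<in> box (prj l) (prj u)" for s t
  proof -
    have "emb s t \<in> box l u \<longleftrightarrow> (l $ i0 < s * a $ i0 \<and> s * a $ i0 < u $ i0) \<and> (\<forall>k. l $ \<beta> k < t $ k \<and> t $ k < u $ \<beta> k)"
      unfolding mem_box_cart
      by (subst all_split) (simp add: emb_def J_nth a_nth)
    also have "(l $ i0 < s * a $ i0 \<and> s * a $ i0 < u $ i0) \<longleftrightarrow> m < s \<and> s < M"
      using a_pm lu'[of i0] unfolding m_def M_def inner_a by auto
    finally show ?thesis by (simp add: mem_box_cart prj_def)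
  qed
  then have pre: "(\<lambda>(s,t). emb s t) -` box l u \<inter> space (lborel \<Otimes>\<^sub>M lborel) = {m<..<M} \<times> box (prj l) (prj u)"
    by (auto simp: space_pair_measure)
  have "emeasure (distr (lborel \<Otimes>\<^sub>M lborel) borel (\<lambda>(s,t). emb s t)) (box l u)
      = emeasure (lborel \<Otimes>\<^sub>M lborel) ({m<..<M} \<times> box (prj l) (prj u))"
    by (subst emeasure_distr[OF meas]) (auto simp: pre)
  also have "\<dots> = emeasure lborel {m<..<M} * emeasure lborel (box (prj l) (prj u))"
    by (rule lborel.emeasure_pair_measure_Times) auto
  also have "emeasure lborel (box (prj l) (prj u)) = ennreal (\<Prod>k\<in>UNIV. u $ \<beta> k - l $ \<beta> k)"
  proof -
    have "emeasure lborel (box (prj l) (prj u)) = ennreal (\<Prod>b\<in>Basis. (prj u - prj l) \<bullet> b)"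
      by (rule emeasure_lborel_box) (auto simp: Basis_vec_eq inner_axis prj_def lu')
    then show ?thesis by (simp add: prod_Basis_vec inner_axis prj_def)
  qed
  also have "emeasure lborel {m<..<M} = ennreal (u $ i0 - l $ i0)"
    using a_pm lu'[of i0] by (subst emeasure_lborel_Ioo) (auto simp: m_def M_def inner_a)
  also have "ennreal (u $ i0 - l $ i0) * ennreal (\<Prod>k\<in>UNIV. u $ \<beta> k - l $ \<beta> k)
      = ennreal ((u $ i0 - l $ i0) * (\<Prod>k\<in>UNIV. u $ \<beta> k - l $ \<beta> k))"
    using lu' by (subst ennreal_mult) (auto intro!: prod_nonneg)
  also have "(u $ i0 - l $ i0) * (\<Prod>k\<in>UNIV. u $ \<beta> k - l $ \<beta> k) = (\<Prod>j\<in>UNIV. u $ j - l $ j)"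
    unfolding prod_UNIV_split ..
  also have "\<dots> = (\<Prod>b\<in>Basis. (u - l) \<bullet> b)"
    by (simp add: prod_Basis_vec inner_axis)
  finally show "emeasure (distr (lborel \<Otimes>\<^sub>M lborel) borel (\<lambda>(s,t). emb s t)) (box l u) = (\<Prod>b\<in>Basis. (u - l) \<bullet> b)" .
qed simp

end

text \<open>A positive slope in direction a and opposite signs at both ends make every segment over
  T meet the zero set exactly once. The uniform bound c also serves later to dominate integrands
  containing the inverse slope.\<close>

locale graph_tube = graph_coords a \<beta> i0
  for a :: "real^'n" and \<beta> :: "'m::finite \<Rightarrow> 'n" and i0 :: 'n +
  fixes \<phi> :: "real^'n \<Rightarrow> real" and s0 \<delta> c :: real and T :: "(real^'m) set"
  assumes smooth_phi: "smooth_on UNIV \<phi>"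
    and \<delta>: "\<delta> > 0" and c: "c > 0" and T: "open T" "bounded T"
    and slope: "\<And>s t. s \<in> {s0-\<delta>..s0+\<delta>} \<Longrightarrow> t \<in> T \<Longrightarrow> c \<le> pd a \<phi> (emb s t)"
    and ends: "\<And>t. t \<in> T \<Longrightarrow> \<phi> (emb (s0-\<delta>) t) < 0" "\<And>t. t \<in> T \<Longrightarrow> 0 < \<phi> (emb (s0+\<delta>) t)"
begin

definition \<eta> :: "real^'m \<Rightarrow> real" where
  "\<eta> t = (SOME s. s \<in> {s0-\<delta><..<s0+\<delta>} \<and> \<phi> (emb s t) = 0)"
definition \<gamma> :: "real^'m \<Rightarrow> real^'n" where "\<gamma> t = emb (\<eta> t) t"
definition tube :: "(real^'n) set" where
  "tube = {x. x \<bullet> a \<in> {s0-\<delta><..<s0+\<delta>} \<and> prj x \<in> T}"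

section \<open>Implicit function theorem in a tube\<close>

lemma diff_phi: "\<phi> differentiable (at x)"
  using smooth_on_differentiable[OF smooth_phi] by simp

lemma cont_phi: "continuous_on A \<phi>" by (rule smooth_on_continuous[OF smooth_phi])

lemma DERIV_phi: "((\<lambda>s. \<phi> (emb s t)) has_real_derivative pd a \<phi> (emb s t)) (at s)"
  using DERIV_line[OF diff_phi, where x="J t" and t=s and v=a] by (simp add: emb_def add.commute)

lemma phi_mono:
  assumes "t \<in> T" "s < s'" "s \<in> {s0-\<delta>..s0+\<delta>}" "s' \<in> {s0-\<delta>..s0+\<delta>}"
  shows "\<phi> (emb s t) < \<phi> (emb s' t)"
proof (rule DERIV_pos_imp_increasing[OF assms(2)])
  fix x assume "s \<le> x" "x \<le> s'"
  then have "c \<le> pd a \<phi> (emb x t)" using assms by (intro slope) auto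
  then show "\<exists>y. ((\<lambda>s. \<phi> (emb s t)) has_real_derivative y) (at x) \<and> 0 < y"
    using DERIV_phi c by (intro exI[of _ "pd a \<phi> (emb x t)"]) auto
qed

lemma eta: assumes "t \<in> T" shows "\<eta> t \<in> {s0-\<delta><..<s0+\<delta>}" "\<phi> (emb (\<eta> t) t) = 0"
proof -
  have "\<exists>s\<ge>s0-\<delta>. s \<le> s0+\<delta> \<and> \<phi> (emb s t) = 0"
  proof (rule IVT')
    show "continuous_on {s0-\<delta>..s0+\<delta>} (\<lambda>s. \<phi> (emb s t))"
      by (intro continuous_on_compose2[OF cont_phi[of UNIV]] continuous_intros) auto
  qed (use ends[OF assms] \<delta> in auto)
  then obtain s where s: "s0-\<delta> \<le> s" "s \<le> s0+\<delta>" "\<phi> (emb s t) = 0" by auto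
  moreover have "s \<noteq> s0-\<delta>" "s \<noteq> s0+\<delta>" using ends[OF assms] s by auto
  ultimately have "\<exists>s. s \<in> {s0-\<delta><..<s0+\<delta>} \<and> \<phi> (emb s t) = 0" by (intro exI[of _ s]) auto
  from someI_ex[OF this] show "\<eta> t \<in> {s0-\<delta><..<s0+\<delta>}" "\<phi> (emb (\<eta> t) t) = 0"
    unfolding \<eta>_def by auto
qed

lemma phi_sign:
  assumes "t \<in> T" "s \<in> {s0-\<delta>..s0+\<delta>}"
  shows "\<phi> (emb s t) < 0 \<longleftrightarrow> s < \<eta> t" "\<phi> (emb s t) > 0 \<longleftrightarrow> \<eta> t < s" "\<phi> (emb s t) = 0 \<longleftrightarrow> s = \<eta> t"
  using phi_mono[OF assms(1), where s=s and s'="\<eta> t"] phi_mono[OF assms(1), where s="\<eta> t" and s'=s] eta[OF assms(1)] assms(2)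
  by (cases s "\<eta> t" rule: linorder_cases; force)+

text \<open>At a fixed height y the sign of \<phi> persists for nearby base points, and by
  \<open>phi_sign\<close> this sign tells on which side of the graph y lies. Heights outside the
  tube need no argument.\<close>

lemma isCont_eta: assumes t: "t \<in> T" shows "isCont \<eta> t"
proof -
  have inT: "\<forall>\<^sub>F t' in at t. t' \<in> T"
    using T(1) t by (auto simp: eventually_at_filter intro!: eventually_mono[OF eventually_nhds_in_open[of T t]])
  have lim: "((\<lambda>t'. \<phi> (emb y t')) \<longlongrightarrow> \<phi> (emb y t)) (at t)" for y
  proof -
    have "continuous_on UNIV (\<lambda>t'. \<phi> (emb y t'))"
      by (intro continuous_on_compose2[OF cont_phi[of UNIV]] continuous_intros) auto
    then show ?thesis by (simp add: continuous_on_eq_continuous_at isCont_def)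
  qed
  have below: "\<forall>\<^sub>F t' in at t. y < \<eta> t'" if y: "y < \<eta> t" for y
  proof (cases "y \<ge> s0 - \<delta>")
    case True
    then have "\<phi> (emb y t) < 0" using y eta[OF t] by (subst phi_sign[OF t]) auto
    from order_tendstoD(2)[OF lim this] inT show ?thesis
      by eventually_elim (use True y eta[OF t] in \<open>auto simp: phi_sign\<close>)
  next
    case False
    from inT show ?thesis by eventually_elim (use False eta in force)
  qed
  have above: "\<forall>\<^sub>F t' in at t. \<eta> t' < y" if y: "\<eta> t < y" for y
  proof (cases "y \<le> s0 + \<delta>")
    case True
    then have "\<phi> (emb y t) > 0" using y eta[OF t] by (subst phi_sign[OF t]) auto
    from order_tendstoD(1)[OF lim this] inT show ?thesis
      by eventually_elim (use True y eta[OF t] in \<open>auto simp: phi_sign\<close>)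
  next
    case False
    from inT show ?thesis by eventually_elim (use False eta in force)
  qed
  from below above show ?thesis
    unfolding isCont_def by (rule order_tendstoI)
qed

lemma continuous_on_gamma: "continuous_on T \<gamma>"
  unfolding \<gamma>_def by (intro continuous_intros continuous_at_imp_continuous_on ballI isCont_eta)

definition slope_at :: "real^'m \<Rightarrow> real" where "slope_at t = grad \<phi> (\<gamma> t) \<bullet> a"
definition \<eta>' :: "real^'m \<Rightarrow> real^'m \<Rightarrow> real" where
  "\<eta>' t w = - (grad \<phi> (\<gamma> t) \<bullet> J w) / slope_at t"

lemma slope_at: assumes "t \<in> T" shows "c \<le> slope_at t" "slope_at t > 0"
proof -
  show "c \<le> slope_at t"
    unfolding slope_at_def \<gamma>_def pd_grad[OF diff_phi, symmetric] using eta[OF assms] assms by (intro slope) auto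
  then show "slope_at t > 0" using c by simp
qed

text \<open>Both graph points are zeros of \<phi>, so its first-order expansion relates the height
  increment h to the base increment w up to an error in both. The part of the error in h is first
  absorbed by the slope, which bounds h by w; the expansion is then solved for h.\<close>

lemma eta_has_derivative:
  assumes t: "t \<in> T" shows "(\<eta> has_derivative \<eta>' t) (at t)"
  unfolding has_derivative_at_alt
proof (intro conjI allI impI)
  have "bounded_linear (\<lambda>w. (- 1 / slope_at t) * (grad \<phi> (\<gamma> t) \<bullet> J w))"
    by (intro bounded_linear_const_mult bounded_linear_compose[OF bounded_linear_inner_right bounded_linear_J])
  then show "bounded_linear (\<eta>' t)" by (simp add: \<eta>'_def[abs_def])
  fix e :: real assume e: "e > 0"
  define A where "A = slope_at t"
  define M where "M = norm (grad \<phi> (\<gamma> t))"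
  have A: "A > 0" using slope_at[OF t] by (simp add: A_def)
  have M: "M \<ge> 0" by (simp add: M_def)
  \<comment> \<open>The bound \<open>A / 2\<close> lets half of the slope term absorb h, giving the
    factor \<open>2 * M / A + 1\<close> between h and w. The second bound turns the remaining error
    into at most e A times the norm of w.\<close>
  define e' where "e' = min (A / 2) (e * A / (2 * M / A + 2))"
  have pos: "2 * M / A + 2 > 0" using A M by (intro add_nonneg_pos) auto
  have e': "e' > 0" using A e pos by (simp add: e'_def)
  have e'_le: "e' \<le> A / 2" "e' \<le> e * A / (2 * M / A + 2)" unfolding e'_def by (rule min.cobounded1, rule min.cobounded2)
  obtain d where d: "d > 0" "\<And>y. dist y (\<gamma> t) < d \<Longrightarrow>
      \<bar>\<phi> y - \<phi> (\<gamma> t) - grad \<phi> (\<gamma> t) \<bullet> (y - \<gamma> t)\<bar> \<le> e' * dist y (\<gamma> t)"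
    using differentiable_estimate[OF diff_phi e'] by blast
  have "isCont \<gamma> t" using continuous_on_gamma t T continuous_on_eq_continuous_at by blast
  then have "\<forall>\<^sub>F t' in nhds t. dist (\<gamma> t') (\<gamma> t) < d"
    using d(1) unfolding eventually_nhds_metric continuous_at_eps_delta by blast
  moreover have "\<forall>\<^sub>F t' in nhds t. t' \<in> T" using T(1) t by (rule eventually_nhds_in_open)
  ultimately have "\<forall>\<^sub>F t' in nhds t. norm (\<eta> t' - \<eta> t - \<eta>' t (t' - t)) \<le> e * norm (t' - t)"
  proof eventually_elim
    case (elim t')
    define h where "h = \<eta> t' - \<eta> t"
    define w where "w = t' - t"
    have diff: "\<gamma> t' - \<gamma> t = h *\<^sub>R a + J w"
      unfolding \<gamma>_def emb_def h_def w_def using linear_diff[OF linear_J] by (simp add: algebra_simps)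
    have z: "\<phi> (\<gamma> t') = 0" "\<phi> (\<gamma> t) = 0" using eta elim t by (auto simp: \<gamma>_def)
    have "dist (\<gamma> t') (\<gamma> t) \<le> \<bar>h\<bar> + norm w"
      unfolding dist_norm \<gamma>_def h_def w_def by (rule norm_emb_diff)
    then have "e' * dist (\<gamma> t') (\<gamma> t) \<le> e' * (\<bar>h\<bar> + norm w)"
      using e' by (intro mult_left_mono) auto
    then have "\<bar>grad \<phi> (\<gamma> t) \<bullet> (\<gamma> t' - \<gamma> t)\<bar> \<le> e' * (\<bar>h\<bar> + norm w)"
      using d(2)[OF elim(1)] z by linarith
    then have 1: "\<bar>h * A + grad \<phi> (\<gamma> t) \<bullet> J w\<bar> \<le> e' * (\<bar>h\<bar> + norm w)"
      unfolding diff by (simp add: inner_add_right A_def slope_at_def)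
    have 2: "\<bar>grad \<phi> (\<gamma> t) \<bullet> J w\<bar> \<le> M * norm w"
      unfolding M_def using Cauchy_Schwarz_ineq2[of "grad \<phi> (\<gamma> t)" "J w"] by (simp add: norm_J)
    have "e' * (\<bar>h\<bar> + norm w) \<le> A / 2 * (\<bar>h\<bar> + norm w)"
      by (intro mult_right_mono e'_le) auto
    then have "\<bar>h * A\<bar> \<le> M * norm w + A / 2 * (\<bar>h\<bar> + norm w)" using 1 2 by linarith
    moreover have "\<bar>h * A\<bar> = A * \<bar>h\<bar>" using A by (simp add: abs_mult)
    moreover have "A / 2 * (\<bar>h\<bar> + norm w) = A * \<bar>h\<bar> / 2 + A * norm w / 2" by (simp add: field_simps)
    moreover have "A * ((2 * M / A + 1) * norm w) = 2 * (M * norm w) + A * norm w"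
      using A by (simp add: field_simps)
    ultimately have "A * \<bar>h\<bar> \<le> A * ((2 * M / A + 1) * norm w)" by linarith
    then have "\<bar>h\<bar> \<le> (2 * M / A + 1) * norm w" using A by simp
    then have "e' * (\<bar>h\<bar> + norm w) \<le> e' * ((2 * M / A + 2) * norm w)"
      using e' by (intro mult_left_mono) (auto simp: distrib_right)
    also have "\<dots> \<le> (e * A / (2 * M / A + 2)) * ((2 * M / A + 2) * norm w)"
      using pos by (intro mult_right_mono e'_le) auto
    also have "\<dots> = e * A * norm w" using pos by simp
    finally have "\<bar>h * A + grad \<phi> (\<gamma> t) \<bullet> J w\<bar> \<le> A * (e * norm w)" using 1 by (simp add: mult_ac)
    moreover have "h * A + grad \<phi> (\<gamma> t) \<bullet> J w = A * (h - \<eta>' t w)"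
      unfolding \<eta>'_def A_def[symmetric] using A by (simp add: field_simps)
    ultimately have "A * \<bar>h - \<eta>' t w\<bar> \<le> A * (e * norm w)" using A by (simp add: abs_mult)
    then show ?case using A by (simp add: h_def w_def)
  qed
  then obtain d' where "d' > 0" "\<And>t'. dist t' t < d' \<Longrightarrow> norm (\<eta> t' - \<eta> t - \<eta>' t (t' - t)) \<le> e * norm (t' - t)"
    unfolding eventually_nhds_metric by blast
  then show "\<exists>d>0. \<forall>y. norm (y - t) < d \<longrightarrow> norm (\<eta> y - \<eta> t - \<eta>' t (y - t)) \<le> e * norm (y - t)"
    by (auto simp: dist_norm)
qed

lemma gamma_has_derivative:
  assumes t: "t \<in> T" shows "(\<gamma> has_derivative (\<lambda>w. emb (\<eta>' t w) w)) (at t)"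
  unfolding \<gamma>_def[abs_def] emb_def[abs_def]
  by (rule has_derivative_add[OF has_derivative_scaleR_left[OF eta_has_derivative[OF t]]
      bounded_linear_imp_has_derivative[OF bounded_linear_J]])

lemma gamma_in: assumes "t \<in> T" shows "\<gamma> t \<in> tube" "\<phi> (\<gamma> t) = 0"
  using eta[OF assms] assms by (auto simp: \<gamma>_def tube_def emb_inner_a prj_emb)

lemma tube_zero: assumes "x \<in> tube" "\<phi> x = 0" shows "x = \<gamma> (prj x)"
proof -
  have "\<phi> (emb (x \<bullet> a) (prj x)) = 0" using assms by (simp add: emb_prj)
  then have "x \<bullet> a = \<eta> (prj x)" using assms by (subst (asm) phi_sign) (auto simp: tube_def)
  then show ?thesis using emb_prj[of x] by (simp add: \<gamma>_def)
qed

lemma gamma_image: "\<gamma> ` T = {x. \<phi> x = 0} \<inter> tube"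
  using gamma_in tube_zero by (force simp: tube_def)

lemma open_tube: "open tube"
proof -
  have "tube = (\<lambda>x. x \<bullet> a) -` {s0-\<delta><..<s0+\<delta>} \<inter> prj -` T" by (auto simp: tube_def)
  moreover have "open ((\<lambda>x. x \<bullet> a) -` {s0-\<delta><..<s0+\<delta>})"
    by (intro open_vimage continuous_intros)
  moreover have "open (prj -` T)"
    by (intro open_vimage T bounded_linear.continuous_on[OF bounded_linear_prj] continuous_intros)
  ultimately show ?thesis by auto
qed

lemma prj_gamma: "prj (\<gamma> t) = t" by (simp add: \<gamma>_def prj_emb)

text \<open>On \<open>T\<close> the functions \<open>G \<circ> \<gamma>\<close>, with \<open>G\<close> smooth where \<open>\<phi>\<close> has nonzero slope,
  are closed under partial derivatives by implicit differentiation; so \<open>\<gamma>\<close> is smooth.\<close>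

lemma smooth_on_comp_gamma:
  assumes G: "smooth_on {x. pd a \<phi> x \<noteq> 0} G"
  shows "smooth_on T (\<lambda>t. G (\<gamma> t))"
proof -
  let ?V = "{x. pd a \<phi> x \<noteq> 0}"
  have V: "open ?V"
    by (intro open_Collect_neq smooth_on_continuous[OF smooth_on_pd'[OF smooth_phi]] continuous_intros) auto
  have inV: "\<gamma> t \<in> ?V" if "t \<in> T" for t
    using slope_at[OF that] by (simp add: slope_at_def pd_grad[OF diff_phi])
  have der: "((\<lambda>t. G (\<gamma> t)) has_derivative (\<lambda>w. grad G (\<gamma> t) \<bullet> emb (\<eta>' t w) w)) (at t)"
    if "smooth_on ?V G" "t \<in> T" for G t
    using has_derivative_compose[OF gamma_has_derivative[OF that(2)]
        differentiable_has_derivative_grad[OF smooth_on_differentiable[OF that(1) inV[OF that(2)]]]] .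
  show ?thesis
  proof (rule smooth_on_coinduct[of _ "{(\<lambda>t. G (\<gamma> t)) | G. smooth_on ?V G}"])
    show "(\<lambda>t. G (\<gamma> t)) \<in> {(\<lambda>t. G (\<gamma> t)) | G. smooth_on ?V G}" using G by blast
    show "open T" by (rule T)
  next
    fix F t assume "F \<in> {(\<lambda>t. G (\<gamma> t)) | G. smooth_on ?V G}" "t \<in> T"
    then show "F differentiable (at t)" using der by (auto simp: differentiable_def)
  next
    fix F and b :: "real^'m" assume "F \<in> {(\<lambda>t. G (\<gamma> t)) | G. smooth_on ?V G}"
    then obtain G where G: "smooth_on ?V G" "F = (\<lambda>t. G (\<gamma> t))" by blast
    \<comment> \<open>The chain rule with the implicit derivative of \<eta> inserted. It is written
      as a function of the surface point alone, so the derivative is again of the form G' composed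
      with \<gamma>.\<close>
    define G' where "G' x = grad G x \<bullet> J b + (- (grad \<phi> x \<bullet> J b) * inverse (pd a \<phi> x)) * (grad G x \<bullet> a)" for x
    have phiV: "smooth_on ?V \<phi>" by (rule smooth_on_subset[OF smooth_phi]) auto
    have "smooth_on ?V G'"
      unfolding G'_def[abs_def]
      by (intro smooth_on_add smooth_on_mult smooth_on_minus smooth_on_inverse smooth_on_grad_inner
          smooth_on_pd' G(1) phiV V) auto
    moreover have "pd b F t = G' (\<gamma> t)" if "t \<in> T" for t
      using has_derivative_pd[OF der[OF G(1) that], of b] unfolding G(2)
      by (simp add: G'_def emb_def \<eta>'_def slope_at_def pd_grad[OF diff_phi] inner_add_right inner_diff_right divide_inverse)
    ultimately show "\<exists>H\<in>{(\<lambda>t. G (\<gamma> t)) | G. smooth_on ?V G}. \<forall>t\<in>T. pd b F t = H t"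
      by (intro bexI[of _ "\<lambda>t. G' (\<gamma> t)"]) auto
  qed
qed

lemma smooth_map_gamma: "smooth_map_on T \<gamma>"
  unfolding smooth_map_on_def
proof
  fix j
  have "smooth_on T (\<lambda>t. \<gamma> t \<bullet> axis j 1)"
    by (rule smooth_on_comp_gamma) (rule smooth_on_inner)
  then show "smooth_on T (\<lambda>t. \<gamma> t $ j)" by (simp add: inner_axis)
qed

text \<open>The columns of the derivative are coordinate vectors plus multiples of a, so the Gram
  matrix is the identity plus an outer product of v, the gradient of \<eta>. Since v is minus the
  projected gradient of \<phi> over the slope, 1 + v . v is the stated quotient.\<close>

lemma gram_det_gamma:
  assumes t: "t \<in> T" shows "gram_det \<gamma> t = (norm (grad \<phi> (\<gamma> t)) / slope_at t)\<^sup>2"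
proof -
  define v :: "real^'m" where "v = (\<chi> k. \<eta>' t (axis k 1))"
  have fd: "frechet_derivative \<gamma> (at t) = (\<lambda>w. emb (\<eta>' t w) w)"
    using frechet_derivative_at[OF gamma_has_derivative[OF t]] by simp
  have "emb (\<eta>' t (axis k 1)) (axis k 1) \<bullet> emb (\<eta>' t (axis l 1)) (axis l 1)
      = (if k = l then 1 else 0) + v $ k * v $ l" for k l
    by (subst inner_decomp) (simp add: emb_inner_a prj_emb inner_axis_axis v_def)
  then have "gram_det \<gamma> t = 1 + v \<bullet> v"
    unfolding gram_det_def fd by (simp add: det_identity_plus_outer)
  moreover have "v = (- 1 / slope_at t) *\<^sub>R prj (grad \<phi> (\<gamma> t))"
  proof -
    have "v $ k = ((- 1 / slope_at t) *\<^sub>R prj (grad \<phi> (\<gamma> t))) $ k" for k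
      by (simp add: v_def \<eta>'_def prj_def inner_axis J_axis)
    then show ?thesis unfolding vec_eq_iff by blast
  qed
  then have "v \<bullet> v = (prj (grad \<phi> (\<gamma> t)) \<bullet> prj (grad \<phi> (\<gamma> t))) / (slope_at t)\<^sup>2"
    by (simp add: power2_eq_square)
  moreover have "(norm (grad \<phi> (\<gamma> t)))\<^sup>2 = (slope_at t)\<^sup>2 + prj (grad \<phi> (\<gamma> t)) \<bullet> prj (grad \<phi> (\<gamma> t))"
    unfolding power2_norm_eq_inner by (subst inner_decomp) (simp add: slope_at_def power2_eq_square)
  ultimately show ?thesis
    using slope_at[OF t] by (simp add: power_divide field_simps)
qed

lemma grad_gamma_pos: assumes "t \<in> T" shows "norm (grad \<phi> (\<gamma> t)) > 0"
  using slope_at[OF assms] by (auto simp: slope_at_def)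

lemma sqrt_gram_det_gamma:
  assumes t: "t \<in> T" shows "sqrt (gram_det \<gamma> t) = norm (grad \<phi> (\<gamma> t)) / slope_at t"
  unfolding gram_det_gamma[OF t] using slope_at[OF t] by (intro real_sqrt_unique) auto

text \<open>Makes the defining property of \<open>area_measure\<close> applicable to the graph. The
  inverse chart is the restriction of the linear map \<open>prj\<close>.\<close>

lemma local_param_gamma: "local_param {x. \<phi> x = 0} T \<gamma>"
  unfolding local_param_def
proof (intro conjI ballI)
  show "\<gamma> ` T \<subseteq> {x. \<phi> x = 0}" using gamma_in by auto
  show "openin (top_of_set {x. \<phi> x = 0}) (\<gamma> ` T)"
    unfolding gamma_image by (rule openin_open_Int) (rule open_tube)
  show "\<exists>\<gamma>'. homeomorphism T (\<gamma> ` T) \<gamma> \<gamma>'"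
    unfolding homeomorphism_def
    by (intro exI[of _ prj] conjI continuous_on_gamma bounded_linear.continuous_on[OF bounded_linear_prj] continuous_intros)
      (auto simp: prj_gamma image_image)
  show "gram_det \<gamma> t \<noteq> 0" if "t \<in> T" for t
    using grad_gamma_pos[OF that] slope_at[OF that] by (simp add: gram_det_gamma that)
qed (rule T smooth_map_gamma)+

text \<open>G vanishes along the chart, so its derivative vanishes on the image of the derivative of
  \<gamma>, and that image contains every v orthogonal to the gradient of \<phi>. This makes
  tangential derivatives independent of the extension.\<close>

lemma pd_tangent_eq_0:
  assumes x: "x \<in> tube" "\<phi> x = 0" and G: "G differentiable (at x)"
    and z: "\<And>y. \<phi> y = 0 \<Longrightarrow> G y = 0" and v: "grad \<phi> x \<bullet> v = 0"
  shows "pd v G x = 0"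
proof -
  define t where "t = prj x"
  have t: "t \<in> T" using x by (simp add: t_def tube_def)
  have xt: "x = \<gamma> t" using tube_zero[OF x] by (simp add: t_def)
  have "((\<lambda>t. G (\<gamma> t)) has_derivative (\<lambda>w. grad G (\<gamma> t) \<bullet> emb (\<eta>' t w) w)) (at t)"
    using has_derivative_compose[OF gamma_has_derivative[OF t] differentiable_has_derivative_grad] G xt by blast
  moreover have "((\<lambda>t. G (\<gamma> t)) has_derivative (\<lambda>w. 0)) (at t)"
    by (rule has_derivative_transform_within_open[of "\<lambda>_. 0" _ _ _ T]) (use t T z gamma_in in auto)
  ultimately have 0: "(\<lambda>w. grad G (\<gamma> t) \<bullet> emb (\<eta>' t w) w) = (\<lambda>w. 0)"
    by (rule has_derivative_unique)
  have "v = emb (v \<bullet> a) (prj v)" by (simp add: emb_prj)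
  \<comment> \<open>Orthogonality to the gradient is exactly the linearised graph equation: the
    height component of v is determined by its base component.\<close>
  moreover have "v \<bullet> a = \<eta>' t (prj v)"
  proof -
    have "grad \<phi> x \<bullet> emb (v \<bullet> a) (prj v) = 0" using v by (simp add: emb_prj)
    then have "(v \<bullet> a) * slope_at t + grad \<phi> x \<bullet> J (prj v) = 0"
      by (simp add: emb_def inner_add_right slope_at_def xt)
    then show ?thesis using slope_at[OF t] by (simp add: \<eta>'_def xt field_simps)
  qed
  ultimately show ?thesis
    using fun_cong[OF 0, of "prj v"] pd_grad[OF G] xt by metis
qed

end

text \<open>A nonzero component of the gradient selects the vertical axis. Continuity keeps the
  slope above half of its value at p on a ball, and the base is shrunk until the end signs found
  over the centre persist.\<close>

lemma ex_graph_tube: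
  fixes \<phi> :: "real^'n \<Rightarrow> real" and p :: "real^'n"
  assumes dim: "CARD('n) = CARD('m::finite) + 1" and \<phi>: "smooth_on UNIV \<phi>"
    and p: "\<phi> p = 0" "grad \<phi> p \<noteq> 0"
  obtains a and \<beta> :: "'m::finite \<Rightarrow> 'n" and i0 s0 \<delta> c T where
    "graph_tube a \<beta> i0 \<phi> s0 \<delta> c T" "p \<in> graph_tube.tube a \<beta> s0 \<delta> T"
proof -
  obtain i0 where i0: "grad \<phi> p $ i0 \<noteq> 0" using p(2) by (auto simp: vec_eq_iff)
  \<comment> \<open>The sign is chosen so that \<phi> increases along a; negative values, hence the
    domain, then lie below the graph.\<close>
  define a :: "real^'n" where "a = (if grad \<phi> p $ i0 > 0 then axis i0 1 else - axis i0 1)"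
  have "card (UNIV - {i0}) = CARD('m)" using dim by (simp add: card_Diff_singleton)
  then obtain \<beta> :: "'m \<Rightarrow> 'n" where \<beta>: "bij_betw \<beta> UNIV (UNIV - {i0})"
    using finite_same_card_bij[of "UNIV :: 'm set" "UNIV - {i0}"] by auto
  interpret graph_coords a \<beta> i0
    by unfold_locales (use \<beta> in \<open>auto simp: a_def bij_betw_def\<close>)
  have diff: "\<phi> differentiable (at x)" for x using smooth_on_differentiable[OF \<phi>] by simp
  have "pd a \<phi> p > 0" using i0 by (auto simp: pd_grad[OF diff] a_def inner_axis)
  define c where "c = pd a \<phi> p / 2"
  have c: "c > 0" using \<open>pd a \<phi> p > 0\<close> by (simp add: c_def)
  have "continuous_on UNIV (pd a \<phi>)" by (rule smooth_on_continuous[OF smooth_on_pd'[OF \<phi>]]) simp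
  then have "open {x. c < pd a \<phi> x}" by (intro open_Collect_less continuous_intros)
  moreover have "p \<in> {x. c < pd a \<phi> x}" using c by (simp add: c_def)
  ultimately obtain r where r: "r > 0" "ball p r \<subseteq> {x. c < pd a \<phi> x}" by (meson open_contains_ball)
  define s0 where "s0 = p \<bullet> a"
  define t0 where "t0 = prj p"
  \<comment> \<open>\<open>norm_emb_diff\<close> adds height and base distance, so each receives
    half of r.\<close>
  define \<delta> where "\<delta> = r / 2"
  have \<delta>: "\<delta> > 0" using r by (simp add: \<delta>_def)
  have pe: "p = emb s0 t0" by (simp add: s0_def t0_def emb_prj)
  have near: "c < pd a \<phi> (emb s t)" if "\<bar>s - s0\<bar> \<le> \<delta>" "norm (t - t0) < r / 2" for s t
  proof -
    have "norm (emb s t - emb s0 t0) < r" using norm_emb_diff[of s t s0 t0] that by (simp add: \<delta>_def)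
    then show ?thesis using r(2) by (auto simp: dist_norm norm_minus_commute pe subset_iff)
  qed
  have der: "((\<lambda>s. \<phi> (emb s t0)) has_real_derivative pd a \<phi> (emb s t0)) (at s)" for s
    using DERIV_line[OF diff, where x="J t0" and t=s and v=a] by (simp add: emb_def add.commute)
  have inc: "\<phi> (emb s t0) < \<phi> (emb s' t0)" if "s < s'" "\<bar>s - s0\<bar> \<le> \<delta>" "\<bar>s' - s0\<bar> \<le> \<delta>" for s s'
  proof (rule DERIV_pos_imp_increasing[OF that(1)])
    fix x assume x: "s \<le> x" "x \<le> s'"
    have "c < pd a \<phi> (emb x t0)" by (rule near) (use x that r in auto)
    then show "\<exists>y. ((\<lambda>s. \<phi> (emb s t0)) has_real_derivative y) (at x) \<and> 0 < y"
      using der c by (intro exI[of _ "pd a \<phi> (emb x t0)"]) auto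
  qed
  define T where "T = ball t0 (r/2) \<inter> {t. \<phi> (emb (s0-\<delta>) t) < 0} \<inter> {t. 0 < \<phi> (emb (s0+\<delta>) t)}"
  have contp: "continuous_on UNIV (\<lambda>t. \<phi> (emb s t))" for s
    by (intro continuous_on_compose2[OF smooth_on_continuous[OF \<phi>, of UNIV]] continuous_intros) auto
  have "open T"
    unfolding T_def by (intro open_Int open_Collect_less contp continuous_intros) auto
  moreover have "bounded T" by (rule bounded_subset[of "ball t0 (r/2)"]) (auto simp: T_def)
  moreover have t0: "t0 \<in> T"
    using inc[of "s0-\<delta>" s0] inc[of s0 "s0+\<delta>"] r \<delta> p(1) by (auto simp: T_def pe)
  ultimately have gt: "graph_tube a \<beta> i0 \<phi> s0 \<delta> c T"
  proof (unfold_locales, goal_cases)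
    case (6 s t)
    then show ?case using near[of s t] by (force simp: T_def dist_norm norm_minus_commute)
  qed (use \<phi> \<delta> c in \<open>auto simp: T_def\<close>)
  then interpret graph_tube a \<beta> i0 \<phi> s0 \<delta> c T .
  have "p \<in> tube" using \<delta> t0 by (auto simp: tube_def pe emb_inner_a prj_emb)
  with gt show thesis by (rule that)
qed

subsection \<open>Integration over a chart\<close>

definition layer_seq :: "nat \<Rightarrow> real \<Rightarrow> real" where
  "layer_seq n v = layer_step (v * real (Suc n))"
text \<open>Minus the derivative of \<open>layer_seq n\<close>: mass 1 on an interval of length
  1/(n+1) ending at 0, an approximate identity that reaches 0 from the negative side. The parameter
  eps is 1/(n+1).\<close>

definition delta_seq :: "nat \<Rightarrow> real \<Rightarrow> real" where
  "delta_seq n v = layer_kernel (v * real (Suc n)) * real (Suc n)"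

lemma DERIV_layer_seq: "(layer_seq n has_real_derivative - delta_seq n v) (at v)"
proof -
  have "((\<lambda>v. layer_step (v * real (Suc n))) has_real_derivative (- layer_kernel (v * real (Suc n))) * real (Suc n)) (at v)"
    by (rule DERIV_chain2[OF DERIV_layer_step]) (auto intro!: derivative_eq_intros)
  then show ?thesis by (simp add: layer_seq_def[abs_def] delta_seq_def)
qed

lemma delta_seq_nonneg: "delta_seq n v \<ge> 0"
  by (simp add: delta_seq_def layer_kernel_nonneg)

lemma delta_seq_eq_0: "v \<ge> 0 \<or> v \<le> - inverse (real (Suc n)) \<Longrightarrow> delta_seq n v = 0"
proof -
  assume v: "v \<ge> 0 \<or> v \<le> - inverse (real (Suc n))"
  have "v * real (Suc n) \<ge> 0 \<or> v * real (Suc n) \<le> -1"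
    using v
  proof
    assume "v \<le> - inverse (real (Suc n))"
    then have "v * real (Suc n) \<le> - inverse (real (Suc n)) * real (Suc n)"
      by (rule mult_right_mono) simp
    then show ?thesis by simp
  qed simp
  then show ?thesis unfolding delta_seq_def layer_kernel_eq by auto
qed

lemma layer_seq_simps:
  "v \<ge> 0 \<Longrightarrow> layer_seq n v = 0" "v \<le> - inverse (real (Suc n)) \<Longrightarrow> layer_seq n v = 1"
  unfolding layer_seq_def by (auto simp: field_simps intro!: layer_step_simps)

lemma layer_seq_bounds: "0 \<le> layer_seq n v" "layer_seq n v \<le> 1"
  by (auto simp: layer_seq_def layer_step_bounds)

lemma continuous_on_delta_seq[continuous_intros]:
  "continuous_on A f \<Longrightarrow> continuous_on A (\<lambda>x. delta_seq n (f x))"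
  unfolding delta_seq_def
  by (intro continuous_intros continuous_on_compose2[OF continuous_on_layer_kernel]) auto

lemma eventually_inverse_Suc_less: "e > 0 \<Longrightarrow> \<forall>\<^sub>F n in sequentially. inverse (real (Suc n)) < e"
  using order_tendstoD(2)[OF LIMSEQ_inverse_real_of_nat] by auto

context graph_tube
begin

text \<open>Outside T the choice in \<eta> gives no control; the value 0 there makes the chart Borel
  on the whole parameter space.\<close>

definition \<gamma>0 :: "real^'m \<Rightarrow> real^'n" where "\<gamma>0 t = (if t \<in> T then \<gamma> t else 0)"

lemma measurable_\<gamma>0[measurable]: "\<gamma>0 \<in> borel_measurable borel"
  unfolding \<gamma>0_def[abs_def]
  by (intro borel_measurable_continuous_on_if continuous_on_gamma continuous_intros) (use T in auto)

lemma T_sets[measurable]: "T \<in> sets borel" using T by auto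

text \<open>The area density, expressed by the gradient rather than by \<open>gram_det\<close> so
  that measurability is immediate; the lemma \<open>dens\<close> identifies the two.\<close>

definition dens :: "real^'m \<Rightarrow> real" where
  "dens t = indicator T t * (norm (grad \<phi> (\<gamma>0 t)) / (grad \<phi> (\<gamma>0 t) \<bullet> a))"

lemma measurable_grad_phi[measurable]: "grad \<phi> \<in> borel_measurable borel"
  by (rule borel_measurable_grad)

lemma measurable_dens[measurable]: "dens \<in> borel_measurable borel"
  unfolding dens_def[abs_def] by measurable

lemma dens: "dens t = indicator T t * sqrt (gram_det \<gamma> t)"
  by (simp add: dens_def \<gamma>0_def sqrt_gram_det_gamma slope_at_def split: split_indicator)

lemma dens_nonneg: "dens t \<ge> 0"
  using slope_at(2)[of t] by (auto simp: dens_def \<gamma>0_def slope_at_def split: split_indicator)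

lemma tube_bounded: "bounded tube"
proof -
  have "tube \<subseteq> (\<lambda>(s,t). emb s t) ` ({s0-\<delta>..s0+\<delta>} \<times> closure T)"
  proof
    fix x assume "x \<in> tube"
    then have "x = emb (x \<bullet> a) (prj x)" "x \<bullet> a \<in> {s0-\<delta>..s0+\<delta>}" "prj x \<in> closure T"
      using closure_subset by (auto simp: tube_def emb_prj)
    then show "x \<in> (\<lambda>(s,t). emb s t) ` ({s0-\<delta>..s0+\<delta>} \<times> closure T)"
      by (intro image_eqI[of _ _ "(x \<bullet> a, prj x)"]) auto
  qed
  moreover have "compact ((\<lambda>(s,t). emb s t) ` ({s0-\<delta>..s0+\<delta>} \<times> closure T))"
    unfolding case_prod_beta
    by (intro compact_continuous_image continuous_intros compact_Times compact_Icc) (use T in \<open>simp add: compact_closure\<close>)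
  ultimately show ?thesis using compact_imp_bounded bounded_subset by blast
qed

text \<open>By the chart formula, \<sigma> restricted to the graph and the image under
  \<open>\<gamma>0\<close> of Lebesgue measure with density \<open>dens\<close> agree on all Borel
  sets. Equality of measures then carries over to signed integrands and to integrability.\<close>

lemma chart_integral:
  assumes area: "area_measure TYPE('m) {x. \<phi> x = 0} \<sigma>"
    and q: "q \<in> borel_measurable borel" "\<And>x. x \<notin> tube \<Longrightarrow> q x = 0"
  shows "integral\<^sup>L \<sigma> q = (\<integral>t. dens t * q (\<gamma>0 t) \<partial>lborel)" (is ?eq)
    and "integrable \<sigma> q \<longleftrightarrow> integrable lborel (\<lambda>t. dens t * q (\<gamma>0 t))" (is ?int)
proof -
  have sets_\<sigma>[measurable_cong]: "sets \<sigma> = sets borel" using area by (simp add: area_measure_def)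
  have chart: "emeasure \<sigma> (\<gamma> ` A) = (\<integral>\<^sup>+ t. indicator A t * ennreal (sqrt (gram_det \<gamma> t)) \<partial>lborel)"
    if "A \<in> sets lborel" "A \<subseteq> T" for A
    using area local_param_gamma that unfolding area_measure_def by blast
  define \<mu> where "\<mu> = distr (density lborel dens) borel \<gamma>0"
  have S: "\<gamma> ` T \<in> sets borel"
    unfolding gamma_image using open_tube continuous_closed_preimage_constant[OF cont_phi[of UNIV] closed_UNIV, of 0]
    by (intro sets.Int) auto
  have "density \<sigma> (\<lambda>x. indicator (\<gamma> ` T) x) = \<mu>"
  proof (rule measure_eqI)
    show "sets (density \<sigma> (\<lambda>x. indicator (\<gamma> ` T) x)) = sets \<mu>" by (simp add: \<mu>_def sets_\<sigma>)
    fix C assume "C \<in> sets (density \<sigma> (\<lambda>x. indicator (\<gamma> ` T) x))"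
    then have C[measurable]: "C \<in> sets borel" by (simp add: sets_\<sigma>)
    define A where "A = T \<inter> \<gamma>0 -` C"
    have A: "A \<in> sets borel"
      unfolding A_def using measurable_sets[OF measurable_\<gamma>0 C] by (intro sets.Int) auto
    have "emeasure (density \<sigma> (\<lambda>x. indicator (\<gamma> ` T) x)) C = emeasure \<sigma> (\<gamma> ` T \<inter> C)"
      using S C by (subst emeasure_density) (auto simp: sets_\<sigma> simp flip: indicator_inter_arith)
    also have "\<gamma> ` T \<inter> C = \<gamma> ` A" by (auto simp: A_def \<gamma>0_def)
    also have "emeasure \<sigma> (\<gamma> ` A) = (\<integral>\<^sup>+ t. indicator A t * ennreal (sqrt (gram_det \<gamma> t)) \<partial>lborel)"
      using A by (intro chart) (auto simp: A_def)
    also have "\<dots> = (\<integral>\<^sup>+ t. ennreal (dens t) * indicator (\<gamma>0 -` C) t \<partial>lborel)"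
      by (intro nn_integral_cong) (auto simp: A_def dens split: split_indicator)
    also have "\<dots> = emeasure (density lborel dens) (\<gamma>0 -` C)"
      using measurable_sets[OF measurable_\<gamma>0 C] by (subst emeasure_density) auto
    also have "\<dots> = emeasure \<mu> C"
      unfolding \<mu>_def by (subst emeasure_distr) auto
    finally show "emeasure (density \<sigma> (\<lambda>x. indicator (\<gamma> ` T) x)) C = emeasure \<mu> C" .
  qed
  then have \<mu>: "density \<sigma> (\<lambda>x. ennreal (indicator (\<gamma> ` T) x)) = \<mu>" by (simp add: ennreal_indicator)
  have q\<sigma>: "q \<in> borel_measurable \<sigma>" using q sets_\<sigma> by (simp cong: measurable_cong_sets)
  have i\<sigma>: "(\<lambda>x. indicator (\<gamma> ` T) x :: real) \<in> borel_measurable \<sigma>" using S sets_\<sigma> by (intro borel_measurable_indicator) simp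
  \<comment> \<open>Inside the tube the zero set is the graph, outside the tube q vanishes, and the
    complement of the zero set is a null set.\<close>
  have AE: "AE x in \<sigma>. indicator (\<gamma> ` T) x *\<^sub>R q x = q x"
  proof (rule AE_I[of _ _ "UNIV - {x. \<phi> x = 0}"])
    show "emeasure \<sigma> (UNIV - {x. \<phi> x = 0}) = 0" using area by (simp add: area_measure_def)
    show "UNIV - {x. \<phi> x = 0} \<in> sets \<sigma>"
      using continuous_closed_preimage_constant[OF cont_phi[of UNIV] closed_UNIV, of 0]
      unfolding sets_\<sigma> by (intro sets.Diff) auto
    show "{x \<in> space \<sigma>. \<not> indicator (\<gamma> ` T) x *\<^sub>R q x = q x} \<subseteq> UNIV - {x. \<phi> x = 0}"
      unfolding gamma_image using q(2) by (auto split: split_indicator)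
  qed
  have "integral\<^sup>L \<sigma> q = integral\<^sup>L \<sigma> (\<lambda>x. indicator (\<gamma> ` T) x *\<^sub>R q x)"
    using AE q\<sigma> i\<sigma> by (intro integral_cong_AE) auto
  also have "\<dots> = integral\<^sup>L \<mu> q"
    unfolding \<mu>[symmetric] by (subst integral_density[OF q\<sigma> i\<sigma>]) auto
  also have "\<dots> = (\<integral>t. q (\<gamma>0 t) \<partial>density lborel dens)"
    unfolding \<mu>_def using q by (subst integral_distr) auto
  also have "\<dots> = (\<integral>t. dens t * q (\<gamma>0 t) \<partial>lborel)"
    using q by (subst integral_density) (auto simp: dens_nonneg)
  finally show ?eq .
  have "integrable \<sigma> q \<longleftrightarrow> integrable \<sigma> (\<lambda>x. indicator (\<gamma> ` T) x *\<^sub>R q x)"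
    using AE q\<sigma> i\<sigma> by (intro integrable_cong_AE) auto
  also have "\<dots> \<longleftrightarrow> integrable \<mu> q"
    unfolding \<mu>[symmetric] by (subst integrable_density[OF q\<sigma> i\<sigma>]) auto
  also have "\<dots> \<longleftrightarrow> integrable (density lborel dens) (\<lambda>t. q (\<gamma>0 t))"
    unfolding \<mu>_def using q by (subst integrable_distr_eq) auto
  also have "\<dots> \<longleftrightarrow> integrable lborel (\<lambda>t. dens t * q (\<gamma>0 t))"
    using q by (subst integrable_density) (auto simp: dens_nonneg)
  finally show ?int .
qed

lemma integrable_T: "integrable lborel (\<lambda>t. C * indicator T t :: real)"
  using emeasure_bounded_finite[OF T(2)] T_sets
  by (intro integrable_mult_right integrable_real_indicator) auto

text \<open>Over the bounded base the density is at most M / c: the gradient is bounded on the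
  compact closure of the tube and the slope is at least c.\<close>

lemma emeasure_tube_finite:
  assumes area: "area_measure TYPE('m) {x. \<phi> x = 0} \<sigma>"
  shows "emeasure \<sigma> tube < \<infinity>"
proof -
  have sets_\<sigma>: "sets \<sigma> = sets borel" using area by (simp add: area_measure_def)
  have "bounded (grad \<phi> ` closure tube)"
    by (intro compact_imp_bounded compact_continuous_image continuous_on_grad[OF smooth_phi])
      (simp add: compact_closure tube_bounded)
  then obtain M where M: "M > 0" "\<And>x. x \<in> closure tube \<Longrightarrow> norm (grad \<phi> x) \<le> M"
    unfolding bounded_pos by auto
  have "integrable lborel (\<lambda>t. dens t * indicator tube (\<gamma>0 t))"
  proof (rule Bochner_Integration.integrable_bound[OF integrable_T[of "M / c"]])
    have [measurable]: "tube \<in> sets borel" using open_tube by simp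
    show "(\<lambda>t. dens t * indicator tube (\<gamma>0 t)) \<in> borel_measurable lborel"
      by measurable
    have "norm (dens t * indicator tube (\<gamma>0 t)) \<le> norm (M / c * indicator T t)" for t
    proof (cases "t \<in> T")
      case True
      have "norm (grad \<phi> (\<gamma> t)) \<le> M" using M(2) gamma_in[OF True] closure_subset by blast
      then have "norm (grad \<phi> (\<gamma> t)) / slope_at t \<le> M / c"
        using slope_at[OF True] c M by (intro frac_le) auto
      then show ?thesis using True gamma_in[OF True] slope_at[OF True] M c
        by (simp add: dens_def \<gamma>0_def slope_at_def)
    qed (simp add: dens_def)
    then show "AE t in lborel. norm (dens t * indicator tube (\<gamma>0 t)) \<le> norm (M / c * indicator T t)" by simp
  qed
  then have "integrable \<sigma> (indicator tube :: _ \<Rightarrow> real)"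
    using open_tube by (subst chart_integral(2)[OF area]) auto
  then show ?thesis
    using open_tube sets_\<sigma> by (subst (asm) integrable_indicator_iff) (auto simp: less_top)
qed

text \<open>Multiplying and dividing by the slope P makes the kernel an exact derivative
  \<open>D n\<close> of mass at most 1 along the segment. Thus the integral is an average of r = q /
  P, bounded by M / c, and it tends to the value of r at the height \<eta> t where the mass
  concentrates.\<close>

lemma layer_limit_inner:
  assumes q: "continuous_on UNIV q" "\<And>x. x \<notin> tube \<Longrightarrow> q x = 0" and t: "t \<in> T"
  shows "(\<lambda>n. \<integral>s. q (emb s t) * delta_seq n (\<phi> (emb s t)) \<partial>lborel) \<longlonglongrightarrow> q (\<gamma> t) / slope_at t" (is ?lim)
    and "(\<And>x. \<bar>q x\<bar> \<le> M) \<Longrightarrow> \<bar>\<integral>s. q (emb s t) * delta_seq n (\<phi> (emb s t)) \<partial>lborel\<bar> \<le> M / c"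
proof -
  define I where "I = {s0-\<delta>..s0+\<delta>}"
  define P where "P s = pd a \<phi> (emb s t)" for s
  define r where "r s = q (emb s t) / P s" for s
  define D where "D n s = delta_seq n (\<phi> (emb s t)) * P s" for n s
  have P: "P s \<ge> c" if "s \<in> I" for s using slope[of s t] that t by (simp add: P_def I_def)
  have P0: "P s > 0" if "s \<in> I" for s using P[OF that] c by simp
  have contP: "continuous_on A P" for A
    unfolding P_def
    by (intro continuous_on_compose2[OF smooth_on_continuous[OF smooth_on_pd'[OF smooth_phi], of UNIV]] continuous_intros) auto
  have contphi: "continuous_on A (\<lambda>s. \<phi> (emb s t))" for A
    by (intro continuous_on_compose2[OF cont_phi[of UNIV]] continuous_intros) auto
  have contq: "continuous_on A (\<lambda>s. q (emb s t))" for A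
    by (intro continuous_on_compose2[OF q(1)] continuous_intros) auto
  have contD: "continuous_on A (D n)" for A n
    unfolding D_def by (intro continuous_intros contP contphi)
  have contr: "continuous_on I r"
    unfolding r_def using P0 by (intro continuous_intros contP contq) force
  have D0: "D n s \<ge> 0" if "s \<in> I" for n s
    using P0[OF that] delta_seq_nonneg by (simp add: D_def)
  have FTC: "has_bochner_integral lborel (\<lambda>s. D n s * indicator I s) (layer_seq n (\<phi> (emb (s0-\<delta>) t)))" for n
  proof -
    have der: "((\<lambda>s. - layer_seq n (\<phi> (emb s t))) has_real_derivative D n s) (at s)" for s
      unfolding D_def P_def
      using DERIV_minus[OF DERIV_chain2[OF DERIV_layer_seq DERIV_phi]] by simp
    have "has_bochner_integral lborel (\<lambda>s. D n s * indicator {s0-\<delta>..s0+\<delta>} s)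
        (- layer_seq n (\<phi> (emb (s0+\<delta>) t)) - - layer_seq n (\<phi> (emb (s0-\<delta>) t)))"
      by (rule has_bochner_integral_FTC_Icc_real)
        (use der \<delta> contD[of UNIV n] in \<open>auto simp: continuous_on_eq_continuous_at\<close>)
    then show ?thesis using ends[OF t] by (simp add: I_def layer_seq_simps)
  qed
  have eqI: "(\<integral>s. q (emb s t) * delta_seq n (\<phi> (emb s t)) \<partial>lborel) = (\<integral>s. r s * (D n s * indicator I s) \<partial>lborel)" for n
  proof (rule Bochner_Integration.integral_cong)
    fix s show "q (emb s t) * delta_seq n (\<phi> (emb s t)) = r s * (D n s * indicator I s)"
    proof (cases "s \<in> I")
      case True
      then show ?thesis using P0[OF True] by (simp add: r_def D_def)
    next
      case False
      then have "emb s t \<notin> tube" by (auto simp: tube_def emb_inner_a I_def)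
      then show ?thesis using False q(2) by simp
    qed
  qed simp
  have intr: "integrable lborel (\<lambda>s. r s * (D n s * indicator I s))" for n
  proof -
    have "compact I" by (simp add: I_def)
    then have "integrable lborel (\<lambda>s. indicator I s *\<^sub>R (r s * D n s))"
      by (rule borel_integrable_compact) (intro continuous_intros contr contD)
    then show ?thesis by (simp add: mult_ac)
  qed
  {
    assume M: "\<And>x. \<bar>q x\<bar> \<le> M"
    have M0: "M \<ge> 0" using M[of 0] by linarith
    have rM: "\<bar>r s\<bar> \<le> M / c" if "s \<in> I" for s
      using M[of "emb s t"] P[OF that] c M0 unfolding r_def abs_divide by (intro frac_le) auto
    have "\<bar>\<integral>s. r s * (D n s * indicator I s) \<partial>lborel\<bar> \<le> (\<integral>s. M / c * (D n s * indicator I s) \<partial>lborel)"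
    proof (rule integral_abs_bound_integral)
      show "integrable lborel (\<lambda>s. M / c * (D n s * indicator I s))"
        using FTC by (intro integrable_mult_right) (auto simp: has_bochner_integral_iff)
      fix s show "\<bar>r s * (D n s * indicator I s)\<bar> \<le> M / c * (D n s * indicator I s)"
        using mult_right_mono[OF rM[of s] D0[of s n]] D0[of s n] by (auto simp: abs_mult split: split_indicator)
    qed (rule intr)
    also have "\<dots> = M / c * layer_seq n (\<phi> (emb (s0-\<delta>) t))"
      using FTC by (simp add: has_bochner_integral_iff)
    also have "\<dots> \<le> M / c * 1" using M0 c layer_seq_bounds by (intro mult_left_mono) auto
    finally show "\<bar>\<integral>s. q (emb s t) * delta_seq n (\<phi> (emb s t)) \<partial>lborel\<bar> \<le> M / c"
      unfolding eqI by simp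
  }
  have etaI: "\<eta> t \<in> I" using eta[OF t] by (simp add: I_def)
  have rlim: "r (\<eta> t) = q (\<gamma> t) / slope_at t"
    by (simp add: r_def P_def slope_at_def \<gamma>_def pd_grad[OF diff_phi])
  show ?lim
    unfolding eqI rlim[symmetric]
  proof (rule LIMSEQ_I)
    fix e :: real assume e: "e > 0"
    obtain d where d: "d > 0" "\<And>s. s \<in> I \<Longrightarrow> dist s (\<eta> t) < d \<Longrightarrow> dist (r s) (r (\<eta> t)) < e / 2"
      using contr etaI e unfolding continuous_on_iff by (meson half_gt_zero)
    \<comment> \<open>A height within d/2 below the graph, clipped to the tube. Once 1/(n+1) is
      smaller than \<open>- \<phi> (emb s1 t)\<close>, the kernel lives between s1 and \<eta> t,
      where r varies by less than e/2.\<close>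
    define s1 where "s1 = max (s0-\<delta>) (\<eta> t - d / 2)"
    have s1: "s1 \<in> I" "s1 < \<eta> t" using eta[OF t] d(1) by (auto simp: s1_def I_def)
    have \<kappa>: "\<phi> (emb s1 t) < 0" using phi_sign(1)[OF t, of s1] s1 by (simp add: I_def)
    obtain N where N: "\<And>n. n \<ge> N \<Longrightarrow> inverse (real (Suc n)) < - \<phi> (emb s1 t)"
      using eventually_inverse_Suc_less[of "- \<phi> (emb s1 t)"] \<kappa> unfolding eventually_sequentially by auto
    show "\<exists>no. \<forall>n\<ge>no. norm ((\<integral>s. r s * (D n s * indicator I s) \<partial>lborel) - r (\<eta> t)) < e"
    proof (intro exI[of _ N] allI impI)
      fix n assume n: "n \<ge> N"
      have "\<phi> (emb (s0-\<delta>) t) \<le> \<phi> (emb s1 t)"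
        using phi_mono[OF t, of "s0-\<delta>" s1] s1 \<delta> by (cases "s1 = s0-\<delta>") (auto simp: I_def)
      then have one: "layer_seq n (\<phi> (emb (s0-\<delta>) t)) = 1"
        using N[OF n] by (intro layer_seq_simps) auto
      have int1: "integrable lborel (\<lambda>s. D n s * indicator I s)" "(\<integral>s. D n s * indicator I s \<partial>lborel) = 1"
        using FTC[of n] one by (auto simp: has_bochner_integral_iff)
      have "(\<integral>s. r s * (D n s * indicator I s) \<partial>lborel) - r (\<eta> t)
          = (\<integral>s. r s * (D n s * indicator I s) \<partial>lborel) - (\<integral>s. r (\<eta> t) * (D n s * indicator I s) \<partial>lborel)"
        using int1 by simp
      also have "\<dots> = (\<integral>s. (r s - r (\<eta> t)) * (D n s * indicator I s) \<partial>lborel)"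
        using intr[of n] int1(1)
        by (subst Bochner_Integration.integral_diff[symmetric]) (auto simp: left_diff_distrib)
      also have "\<bar>\<dots>\<bar> \<le> (\<integral>s. e / 2 * (D n s * indicator I s) \<partial>lborel)"
      proof (rule integral_abs_bound_integral)
        show "integrable lborel (\<lambda>s. (r s - r (\<eta> t)) * (D n s * indicator I s))"
          unfolding left_diff_distrib by (intro Bochner_Integration.integrable_diff intr integrable_mult_right int1)
        show "integrable lborel (\<lambda>s. e / 2 * (D n s * indicator I s))"
          by (intro integrable_mult_right int1)
        fix s show "\<bar>(r s - r (\<eta> t)) * (D n s * indicator I s)\<bar> \<le> e / 2 * (D n s * indicator I s)"
        proof (cases "s \<in> I \<and> D n s \<noteq> 0")
          case True
          then have "\<phi> (emb s t) < 0" "- inverse (real (Suc n)) < \<phi> (emb s t)"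
            using delta_seq_eq_0[of "\<phi> (emb s t)" n] by (auto simp: D_def not_le[symmetric])
          then have "s < \<eta> t" "\<phi> (emb s1 t) < \<phi> (emb s t)"
            using phi_sign(1)[OF t, of s] True N[OF n] by (auto simp: I_def)
          moreover have "s1 < s"
            using phi_mono[OF t, of s s1] \<open>\<phi> (emb s1 t) < \<phi> (emb s t)\<close> s1 True
            by (cases s s1 rule: linorder_cases) (auto simp: I_def)
          ultimately have "dist s (\<eta> t) < d" using d(1) by (auto simp: s1_def dist_real_def)
          then have "\<bar>r s - r (\<eta> t)\<bar> \<le> e / 2" using d(2) True by (force simp: dist_real_def)
          then show ?thesis using True D0[of s n] by (auto simp: abs_mult intro!: mult_right_mono)
        qed auto
      qed
      also have "\<dots> = e / 2" using int1 by simp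
      finally show "norm ((\<integral>s. r s * (D n s * indicator I s) \<partial>lborel) - r (\<eta> t)) < e" using e by simp
    qed
  qed
qed

text \<open>Fubini in tube coordinates reduces to the one-dimensional limit, and its uniform bound
  allows dominated convergence over T. The limit q / slope is \<open>dens\<close> times q over the
  norm of the gradient, because the area density contains that norm.\<close>

lemma layer_limit_tube:
  assumes area: "area_measure TYPE('m) {x. \<phi> x = 0} \<sigma>"
    and q: "continuous_on UNIV q" "\<And>x. x \<notin> tube \<Longrightarrow> q x = 0"
  shows "(\<lambda>n. \<integral>x. q x * delta_seq n (\<phi> x) \<partial>lborel) \<longlonglongrightarrow> (\<integral>x. q x / norm (grad \<phi> x) \<partial>\<sigma>)"
proof -
  define I where "I n t = (\<integral>s. q (emb s t) * delta_seq n (\<phi> (emb s t)) \<partial>lborel)" for n t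
  have "bounded (q ` closure tube)"
    by (intro compact_imp_bounded compact_continuous_image continuous_on_subset[OF q(1)])
      (simp_all add: compact_closure tube_bounded)
  then obtain M where M0: "M > 0" "\<And>x. x \<in> closure tube \<Longrightarrow> \<bar>q x\<bar> \<le> M"
    unfolding bounded_pos by auto
  then have M: "\<bar>q x\<bar> \<le> M" for x
    using q(2)[of x] closure_subset[of tube] by (cases "x \<in> tube") auto
  have contF: "continuous_on UNIV (\<lambda>x. q x * delta_seq n (\<phi> x))" for n
    by (intro continuous_intros q cont_phi)
  have intF: "integrable lborel (\<lambda>x. q x * delta_seq n (\<phi> x))" for n
    by (rule integrable_continuous_bounded_support[OF contF tube_bounded]) (simp add: q)
  have meas: "(\<lambda>(s,t). emb s t) \<in> measurable (lborel \<Otimes>\<^sub>M lborel) borel"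
    unfolding lborel_prod case_prod_beta
    by (simp, intro borel_measurable_continuous_onI continuous_intros)
  have Fm: "(\<lambda>x. q x * delta_seq n (\<phi> x)) \<in> borel_measurable borel" for n
    by (rule borel_measurable_continuous_onI[OF contF])
  have int2: "integrable (lborel \<Otimes>\<^sub>M lborel) (\<lambda>(s,t). q (emb s t) * delta_seq n (\<phi> (emb s t)))" for n
  proof -
    have "integrable (distr (lborel \<Otimes>\<^sub>M lborel) borel (\<lambda>(s,t). emb s t)) (\<lambda>x. q x * delta_seq n (\<phi> x))"
      unfolding distr_emb by (rule intF)
    then show ?thesis by (subst (asm) integrable_distr_eq[OF meas Fm]) (simp add: case_prod_unfold)
  qed
  have eq: "(\<integral>x. q x * delta_seq n (\<phi> x) \<partial>lborel) = (\<integral>t. I n t \<partial>lborel)" for n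
  proof -
    have "(\<integral>x. q x * delta_seq n (\<phi> x) \<partial>lborel)
        = (\<integral>x. q x * delta_seq n (\<phi> x) \<partial>distr (lborel \<Otimes>\<^sub>M lborel) borel (\<lambda>(s,t). emb s t))"
      unfolding distr_emb ..
    also have "\<dots> = (\<integral>p. (case p of (s,t) \<Rightarrow> q (emb s t) * delta_seq n (\<phi> (emb s t))) \<partial>(lborel \<Otimes>\<^sub>M lborel))"
      by (subst integral_distr[OF meas Fm]) (simp add: case_prod_unfold)
    also have "\<dots> = (\<integral>t. I n t \<partial>lborel)"
      unfolding I_def by (rule lborel_pair.integral_snd[OF int2, symmetric])
    finally show ?thesis .
  qed
  have I0: "I n t = 0" if "t \<notin> T" for n t
  proof -
    have "emb s t \<notin> tube" for s using that by (simp add: tube_def prj_emb)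
    then show ?thesis using q(2) by (simp add: I_def)
  qed
  define L where "L t = dens t * (q (\<gamma>0 t) / norm (grad \<phi> (\<gamma>0 t)))" for t
  have qm[measurable]: "q \<in> borel_measurable borel" by (rule borel_measurable_continuous_onI[OF q(1)])
  have "(\<lambda>n. \<integral>t. I n t \<partial>lborel) \<longlonglongrightarrow> (\<integral>t. L t \<partial>lborel)"
  proof (rule integral_dominated_convergence[where w="\<lambda>t. M / c * indicator T t"])
    show "L \<in> borel_measurable lborel" unfolding L_def by measurable
    show "I n \<in> borel_measurable lborel" for n
      unfolding I_def[abs_def] using lborel_pair.integrable_snd[OF int2] by blast
    show "integrable lborel (\<lambda>t. M / c * indicator T t)" by (rule integrable_T)
    have "(\<lambda>n. I n t) \<longlonglongrightarrow> L t" for t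
    proof (cases "t \<in> T")
      case True
      then have "L t = q (\<gamma> t) / slope_at t"
        using grad_gamma_pos[OF True] by (simp add: L_def dens_def \<gamma>0_def slope_at_def)
      then show ?thesis using layer_limit_inner(1)[OF q True] by (simp add: I_def)
    next
      case False
      then show ?thesis by (simp add: I0 L_def dens_def)
    qed
    then show "AE t in lborel. (\<lambda>n. I n t) \<longlonglongrightarrow> L t" by simp
    have "norm (I n t) \<le> M / c * indicator T t" for n t
      using layer_limit_inner(2)[OF q _ M, of t n] I0[of t n] by (cases "t \<in> T") (auto simp: I_def)
    then show "AE t in lborel. norm (I n t) \<le> M / c * indicator T t" for n by simp
  qed
  moreover have "(\<integral>x. q x / norm (grad \<phi> x) \<partial>\<sigma>) = (\<integral>t. L t \<partial>lborel)"
    unfolding L_def by (rule chart_integral(1)[OF area]) (use q in auto)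
  ultimately show ?thesis unfolding eq by simp
qed

end

subsection \<open>The divergence theorem\<close>

locale regular_sublevel =
  fixes \<phi> :: "'a::euclidean_space \<Rightarrow> real"
  assumes smooth_phi: "smooth_on UNIV \<phi>"
    and bdd: "bounded {x. \<phi> x < 0}" and reg: "\<And>x. \<phi> x = 0 \<Longrightarrow> grad \<phi> x \<noteq> 0"
begin

definition D where "D = {x. \<phi> x < 0}"
definition S where "S = {x. \<phi> x = 0}"

lemma diff_phi: "\<phi> differentiable (at x)"
  using smooth_on_differentiable[OF smooth_phi] by simp

lemma cont_phi: "continuous_on A \<phi>" by (rule smooth_on_continuous[OF smooth_phi])

lemma open_D: "open D"
  unfolding D_def by (intro open_Collect_less cont_phi continuous_intros)

lemma closed_S: "closed S"
  unfolding S_def by (intro closed_Collect_eq cont_phi continuous_intros)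

text \<open>Moving from a zero against the gradient leads into the domain.\<close>

lemma S_subset_closure_D: "S \<subseteq> closure D"
proof
  fix x assume "x \<in> S"
  then have x: "\<phi> x = 0" by (simp add: S_def)
  define g where "g t = \<phi> (x + t *\<^sub>R grad \<phi> x)" for t
  have "(g has_real_derivative grad \<phi> x \<bullet> grad \<phi> x) (at 0)"
    unfolding g_def using DERIV_line[of \<phi> x 0 "grad \<phi> x"] diff_phi by (simp add: pd_grad)
  moreover have "grad \<phi> x \<bullet> grad \<phi> x > 0" using reg[OF x] by simp
  ultimately obtain d where d: "d > 0" "\<And>h. 0 < h \<Longrightarrow> h < d \<Longrightarrow> g (0 - h) < g 0"
    using DERIV_pos_inc_left[of g _ 0] by blast
  show "x \<in> closure D"
    unfolding closure_approachable
  proof (intro allI impI)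
    fix e :: real assume e: "e > 0"
    have n: "norm (grad \<phi> x) > 0" using reg[OF x] by simp
    define h where "h = min (d / 2) (e / (2 * norm (grad \<phi> x)))"
    have h: "0 < h" "h < d" using d n e by (auto simp: h_def)
    have "h * norm (grad \<phi> x) \<le> e / (2 * norm (grad \<phi> x)) * norm (grad \<phi> x)"
      using n by (intro mult_right_mono) (auto simp: h_def)
    also have "\<dots> < e" using n e by simp
    finally have "dist (x + (- h) *\<^sub>R grad \<phi> x) x < e" using h by (simp add: dist_norm)
    moreover have "x + (- h) *\<^sub>R grad \<phi> x \<in> D" using d(2)[OF h] x by (simp add: D_def g_def)
    ultimately show "\<exists>y\<in>D. dist y x < e" by blast
  qed
qed

lemma closure_D: "closure D = {x. \<phi> x \<le> 0}"
proof
  show "closure D \<subseteq> {x. \<phi> x \<le> 0}"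
    by (intro closure_minimal closed_Collect_le cont_phi continuous_intros) (auto simp: D_def)
  show "{x. \<phi> x \<le> 0} \<subseteq> closure D"
    using S_subset_closure_D closure_subset[of D] by (auto simp: S_def D_def le_less)
qed

lemma frontier_D: "frontier D = S"
  unfolding frontier_def closure_D interior_open[OF open_D] by (auto simp: S_def D_def)

lemma compact_closure_D: "compact (closure D)"
  using bdd by (simp add: compact_closure D_def)

lemma compact_S: "compact S"
  using compact_closure_D closed_S S_subset_closure_D by (metis compact_Int_closed inf.absorb_iff2)

end

locale level_domain = regular_sublevel \<phi>
  for \<phi> :: "real^'n \<Rightarrow> real" +
  fixes \<sigma> :: "(real^'n) measure" and ty :: "'m::finite itself"
  assumes dim: "CARD('n) = CARD('m) + 1"
    and area: "area_measure TYPE('m) {x. \<phi> x = 0} \<sigma>"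
begin

section \<open>From charts to the whole boundary\<close>

lemma sets_\<sigma>: "sets \<sigma> = sets borel" using area by (simp add: area_measure_def)

lemma space_\<sigma>: "space \<sigma> = UNIV" using sets_eq_imp_space_eq[OF sets_\<sigma>] by simp

lemma borel_\<sigma>: "f \<in> borel_measurable \<sigma> \<longleftrightarrow> f \<in> borel_measurable borel"
  using sets_\<sigma> by (simp cong: measurable_cong_sets)

lemma AE_S: "AE x in \<sigma>. x \<in> S"
  using area closed_S by (intro AE_I[of _ _ "UNIV - S"]) (auto simp: S_def area_measure_def sets_\<sigma> space_\<sigma> simp flip: Compl_eq_Diff_UNIV)

text \<open>Records what later arguments use of a tube without its coordinates. Axis, base and
  heights vary from point to point, while a property of open sets alone can be used with a finite
  cover.\<close>

definition good_chart :: "(real^'n) set \<Rightarrow> bool" where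
  "good_chart U \<longleftrightarrow> open U \<and> bounded U \<and> emeasure \<sigma> U < \<infinity> \<and>
    (\<forall>q. continuous_on UNIV q \<longrightarrow> (\<forall>x. x \<notin> U \<longrightarrow> q x = 0) \<longrightarrow>
      (\<lambda>n. \<integral>x. q x * delta_seq n (\<phi> x) \<partial>lborel) \<longlonglongrightarrow> (\<integral>x. q x / norm (grad \<phi> x) \<partial>\<sigma>)) \<and>
    (\<forall>x G v. x \<in> U \<longrightarrow> x \<in> S \<longrightarrow> G differentiable (at x) \<longrightarrow> (\<forall>y\<in>S. G y = 0) \<longrightarrow>
      grad \<phi> x \<bullet> v = 0 \<longrightarrow> pd v G x = 0)"

lemma good_chart_limit:
  assumes "good_chart U" "continuous_on UNIV q" "\<And>x. x \<notin> U \<Longrightarrow> q x = 0"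
  shows "(\<lambda>n. \<integral>x. q x * delta_seq n (\<phi> x) \<partial>lborel) \<longlonglongrightarrow> (\<integral>x. q x / norm (grad \<phi> x) \<partial>\<sigma>)"
  using assms unfolding good_chart_def by blast

lemma ex_good_chart: assumes "x \<in> S" shows "\<exists>U. x \<in> U \<and> good_chart U"
proof -
  have x: "\<phi> x = 0" using assms by (simp add: S_def)
  obtain a and \<beta> :: "'m \<Rightarrow> 'n" and i0 s0 \<delta> c T where
    gt: "graph_tube a \<beta> i0 \<phi> s0 \<delta> c T" and xt: "x \<in> graph_tube.tube a \<beta> s0 \<delta> T"
    using ex_graph_tube[OF dim smooth_phi x reg[OF x]] by blast
  interpret graph_tube a \<beta> i0 \<phi> s0 \<delta> c T by (rule gt)
  have "good_chart tube"
    unfolding good_chart_def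
    using open_tube tube_bounded emeasure_tube_finite[OF area] layer_limit_tube[OF area] pd_tangent_eq_0
    by (auto simp: S_def)
  with xt show ?thesis by blast
qed

lemma pd_tangent_eq_0:
  assumes "x \<in> S" "G differentiable (at x)" "\<And>y. y \<in> S \<Longrightarrow> G y = 0" "grad \<phi> x \<bullet> v = 0"
  shows "pd v G x = 0"
  using ex_good_chart[OF assms(1)] assms unfolding good_chart_def by blast

lemma finite_good_cover:
  obtains \<U> where "finite \<U>" "\<And>U. U \<in> \<U> \<Longrightarrow> good_chart U" "S \<subseteq> \<Union>\<U>"
proof -
  obtain \<U> where "\<U> \<subseteq> {U. good_chart U}" "finite \<U>" "S \<subseteq> \<Union>\<U>"
  proof (rule compactE[OF compact_S, of "{U. good_chart U}"])
    show "S \<subseteq> \<Union>{U. good_chart U}" using ex_good_chart by blast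
    show "open U" if "U \<in> {U. good_chart U}" for U using that by (simp add: good_chart_def)
  qed
  then show thesis using that by blast
qed

text \<open>Finitely many charts of finite area cover the compact surface, and \<sigma> charges
  nothing else.\<close>

lemma emeasure_\<sigma>_finite: "emeasure \<sigma> (space \<sigma>) < \<infinity>"
proof -
  obtain \<U> where \<U>: "finite \<U>" "\<And>U. U \<in> \<U> \<Longrightarrow> good_chart U" "S \<subseteq> \<Union>\<U>"
    using finite_good_cover by blast
  have U: "U \<in> sets \<sigma>" if "U \<in> \<U>" for U using \<U>(2)[OF that] by (auto simp: good_chart_def sets_\<sigma>)
  have "emeasure \<sigma> (space \<sigma>) = emeasure \<sigma> (\<Union>\<U>)"
  proof (rule emeasure_eq_AE)
    show "AE x in \<sigma>. (x \<in> space \<sigma>) = (x \<in> \<Union>\<U>)"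
      using AE_S by eventually_elim (use \<U> space_\<sigma> in auto)
  qed (use U \<U> in auto)
  also have "\<dots> \<le> (\<Sum>U\<in>\<U>. emeasure \<sigma> U)"
    using emeasure_subadditive_finite[of \<U> "\<lambda>U. U" \<sigma>] U \<U> by auto
  also have "\<dots> < \<infinity>" using \<U> by (auto simp: good_chart_def ennreal_sum_less_top)
  finally show ?thesis .
qed

lemma integrable_\<sigma>:
  fixes q :: "real^'n \<Rightarrow> real"
  assumes "q \<in> borel_measurable borel" "\<And>x. x \<in> S \<Longrightarrow> \<bar>q x\<bar> \<le> M"
  shows "integrable \<sigma> q"
proof -
  interpret finite_measure \<sigma> using emeasure_\<sigma>_finite by (intro finite_measureI) auto
  show ?thesis
    by (rule integrable_const_bound[of _ M])
      (use AE_S assms in \<open>auto simp: borel_\<sigma> elim!: eventually_mono\<close>)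
qed

text \<open>Adapted to boundary integrands with uncontrolled values off S: boundedness is read off a
  continuous function that agrees on the compact S, while measurability is asked of q
  itself.\<close>

lemma integrable_\<sigma>_continuous:
  fixes q :: "real^'n \<Rightarrow> real"
  assumes "q \<in> borel_measurable borel" "continuous_on UNIV q'" "\<And>x. x \<in> S \<Longrightarrow> q x = q' x"
  shows "integrable \<sigma> q"
proof -
  have "bounded (q' ` S)"
    by (intro compact_imp_bounded compact_continuous_image compact_S continuous_on_subset[OF assms(2)]) auto
  then obtain M where "\<And>x. x \<in> S \<Longrightarrow> \<bar>q' x\<bar> \<le> M" unfolding bounded_iff by auto
  then show ?thesis using assms by (intro integrable_\<sigma>[of q M]) auto
qed

lemma measurable_grad_phi[measurable]: "grad \<phi> \<in> borel_measurable borel"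
  by (rule borel_measurable_grad)

text \<open>On the compact part of the closed domain outside V, \<phi> is bounded away from 0 by
  some -e; the kernel sees only values between -1/(n+1) and 0.\<close>

lemma delta_support:
  assumes V: "open V" "S \<subseteq> V"
  shows "\<forall>\<^sub>F n in sequentially. \<forall>x. x \<notin> V \<longrightarrow> delta_seq n (\<phi> x) = 0"
proof -
  define K where "K = closure D - V"
  have K: "compact K" unfolding K_def by (intro compact_diff compact_closure_D V)
  have neg: "\<phi> x < 0" if "x \<in> K" for x using that V closure_D by (force simp: K_def S_def le_less)
  obtain e where e: "e > 0" "\<And>x. x \<in> K \<Longrightarrow> \<phi> x \<le> - e"
  proof (cases "K = {}")
    case True
    then show ?thesis using that[of 1] by simp
  next
    case False
    obtain x0 where "x0 \<in> K" "\<And>x. x \<in> K \<Longrightarrow> \<phi> x \<le> \<phi> x0"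
      using continuous_attains_sup[OF K False cont_phi] by blast
    then show ?thesis using that[of "- \<phi> x0"] neg by auto
  qed
  from eventually_inverse_Suc_less[OF e(1)] show ?thesis
  proof eventually_elim
    case (elim n)
    show ?case
    proof (intro allI impI)
      fix x assume "x \<notin> V"
      then have "\<phi> x \<ge> 0 \<or> x \<in> K" using closure_D by (auto simp: K_def)
      then show "delta_seq n (\<phi> x) = 0" using e(2)[of x] elim by (intro delta_seq_eq_0) auto
    qed
  qed
qed

lemma integrable_delta:
  assumes "continuous_on UNIV q" shows "integrable lborel (\<lambda>x. q x * delta_seq n (\<phi> x))"
  by (rule integrable_continuous_bounded_support[of _ D])
    (use bdd in \<open>auto intro!: continuous_intros assms cont_phi delta_seq_eq_0 simp: D_def\<close>)

text \<open>A partition of unity made of distances to the complements of the charts splits G.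
  Continuous weights suffice, because the chart limit asks only for continuous integrands.\<close>

lemma layer_limit:
  assumes G: "continuous_on UNIV G"
  shows "(\<lambda>n. \<integral>x. G x * delta_seq n (\<phi> x) \<partial>lborel) \<longlonglongrightarrow> (\<integral>x. G x / norm (grad \<phi> x) \<partial>\<sigma>)"
proof -
  obtain \<U> where \<U>: "finite \<U>" "\<And>U. U \<in> \<U> \<Longrightarrow> good_chart U" "S \<subseteq> \<Union>\<U>"
    using finite_good_cover by blast
  define w where "w U x = infdist x (- U)" for U and x :: "real^'n"
  have ne: "- U \<noteq> {}" if "U \<in> \<U>" for U
    using \<U>(2)[OF that] not_bounded_UNIV unfolding good_chart_def
    by (metis Compl_UNIV_eq double_complement)
  have w_pos: "w U x > 0" if "x \<in> U" "U \<in> \<U>" for U x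
    using in_closed_iff_infdist_zero[of "- U" x] ne[OF that(2)] \<U>(2)[OF that(2)] that infdist_nonneg[of x "- U"]
    by (auto simp: w_def good_chart_def less_le)
  have w_0: "w U x = 0" if "x \<notin> U" for U x using that by (simp add: w_def)
  define W where "W x = (\<Sum>U\<in>\<U>. w U x)" for x
  have contw: "continuous_on A (w U)" for U A unfolding w_def by (intro continuous_intros)
  have contW: "continuous_on A W" for A unfolding W_def by (intro continuous_intros contw)
  have W_pos: "W x > 0" if "x \<in> S" for x
  proof -
    obtain U where "U \<in> \<U>" "x \<in> U" using \<U>(3) \<open>x \<in> S\<close> by blast
    then show ?thesis unfolding W_def using \<U>(1) w_pos
      by (intro sum_pos2[of _ U]) (auto simp: w_def infdist_nonneg)
  qed
  obtain m where m: "m > 0" "\<And>x. x \<in> S \<Longrightarrow> W x > m"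
  proof (cases "S = {}")
    case True
    then show ?thesis using that[of 1] by simp
  next
    case False
    obtain x0 where "x0 \<in> S" "\<And>x. x \<in> S \<Longrightarrow> W x0 \<le> W x"
      using continuous_attains_inf[OF compact_S False contW] by blast
    then show ?thesis using that[of "W x0 / 2"] W_pos[of x0] by force
  qed
  \<comment> \<open>\<open>max m (W x)\<close> keeps the denominator positive on the whole space.
    The weights add up to 1 only where W exceeds m, but that is a neighbourhood of S and eventually
    contains the layer.\<close>
  define p where "p U x = w U x / max m (W x)" for U x
  have max0: "max m (W x) \<noteq> 0" for x using m(1) by (simp add: max_def)
  have contp: "continuous_on UNIV (\<lambda>x. p U x * G x)" for U
    unfolding p_def using max0 by (intro continuous_intros contw contW G) auto
  have sum_p: "(\<Sum>U\<in>\<U>. p U x) = 1" if "W x > m" for x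
    using that m(1) by (simp add: p_def W_def sum_divide_distrib[symmetric] max_def)
  have "(\<lambda>n. \<Sum>U\<in>\<U>. \<integral>x. (p U x * G x) * delta_seq n (\<phi> x) \<partial>lborel)
      \<longlonglongrightarrow> (\<Sum>U\<in>\<U>. \<integral>x. (p U x * G x) / norm (grad \<phi> x) \<partial>\<sigma>)"
  proof (rule tendsto_sum)
    fix U assume U: "U \<in> \<U>"
    show "(\<lambda>n. \<integral>x. (p U x * G x) * delta_seq n (\<phi> x) \<partial>lborel)
      \<longlonglongrightarrow> (\<integral>x. (p U x * G x) / norm (grad \<phi> x) \<partial>\<sigma>)"
      by (rule good_chart_limit[OF \<U>(2)[OF U] contp]) (simp add: p_def w_0)
  qed
  moreover have "(\<Sum>U\<in>\<U>. \<integral>x. (p U x * G x) / norm (grad \<phi> x) \<partial>\<sigma>) = (\<integral>x. G x / norm (grad \<phi> x) \<partial>\<sigma>)"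
  proof -
    have [measurable]: "(\<lambda>x. p U x * G x) \<in> borel_measurable borel" for U
      by (rule borel_measurable_continuous_onI[OF contp])
    have [measurable]: "G \<in> borel_measurable borel" by (rule borel_measurable_continuous_onI[OF G])
    have int: "integrable \<sigma> (\<lambda>x. (p U x * G x) / norm (grad \<phi> x))" for U
    proof -
      have "continuous_on S (\<lambda>x. (p U x * G x) / norm (grad \<phi> x))"
        by (intro continuous_intros continuous_on_subset[OF contp] continuous_on_grad smooth_phi)
          (use reg in \<open>auto simp: S_def\<close>)
      then have "bounded ((\<lambda>x. (p U x * G x) / norm (grad \<phi> x)) ` S)"
        by (intro compact_imp_bounded compact_continuous_image compact_S)
      then obtain M where "\<And>x. x \<in> S \<Longrightarrow> \<bar>(p U x * G x) / norm (grad \<phi> x)\<bar> \<le> M"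
        unfolding bounded_iff by auto
      then show ?thesis by (intro integrable_\<sigma>[of _ M]) measurable
    qed
    have "(\<Sum>U\<in>\<U>. \<integral>x. (p U x * G x) / norm (grad \<phi> x) \<partial>\<sigma>)
        = (\<integral>x. (\<Sum>U\<in>\<U>. (p U x * G x) / norm (grad \<phi> x)) \<partial>\<sigma>)"
      by (rule Bochner_Integration.integral_sum[symmetric]) (rule int)
    also have "\<dots> = (\<integral>x. G x / norm (grad \<phi> x) \<partial>\<sigma>)"
    proof (rule integral_cong_AE)
      show "AE x in \<sigma>. (\<Sum>U\<in>\<U>. (p U x * G x) / norm (grad \<phi> x)) = G x / norm (grad \<phi> x)"
        using AE_S
      proof eventually_elim
        case (elim x)
        show ?case
          using sum_p[OF m(2)[OF elim]] by (simp flip: sum_divide_distrib sum_distrib_right)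
      qed
    qed (unfold borel_\<sigma>, measurable)
    finally show ?thesis .
  qed
  moreover have "\<forall>\<^sub>F n in sequentially. (\<Sum>U\<in>\<U>. \<integral>x. (p U x * G x) * delta_seq n (\<phi> x) \<partial>lborel)
      = (\<integral>x. G x * delta_seq n (\<phi> x) \<partial>lborel)"
  proof -
    have "open {x. m < W x}" by (intro open_Collect_less contW continuous_intros)
    moreover have "S \<subseteq> {x. m < W x}" using m by auto
    ultimately have "\<forall>\<^sub>F n in sequentially. \<forall>x. x \<notin> {x. m < W x} \<longrightarrow> delta_seq n (\<phi> x) = 0"
      by (rule delta_support)
    then show ?thesis
    proof eventually_elim
      case (elim n)
      have "(\<Sum>U\<in>\<U>. \<integral>x. (p U x * G x) * delta_seq n (\<phi> x) \<partial>lborel)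
          = (\<integral>x. (\<Sum>U\<in>\<U>. (p U x * G x) * delta_seq n (\<phi> x)) \<partial>lborel)"
        by (rule Bochner_Integration.integral_sum[symmetric]) (rule integrable_delta[OF contp])
      also have "\<dots> = (\<integral>x. G x * delta_seq n (\<phi> x) \<partial>lborel)"
      proof (rule Bochner_Integration.integral_cong[OF refl])
        fix x show "(\<Sum>U\<in>\<U>. (p U x * G x) * delta_seq n (\<phi> x)) = G x * delta_seq n (\<phi> x)"
          using elim sum_p[of x] by (cases "m < W x") (auto simp flip: sum_distrib_right)
      qed
      finally show ?case .
    qed
  qed
  ultimately show ?thesis by (simp add: Lim_transform_eventually)
qed

theorem divergence_theorem:
  assumes F: "smooth_on UNIV F" and b: "b \<in> Basis"
  shows "(LINT x:D|lborel. pd b F x) = (\<integral>x. F x * (outer_normal \<phi> x \<bullet> b) \<partial>\<sigma>)"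
proof -
  have dF: "F differentiable (at x)" for x using smooth_on_differentiable[OF F] by simp
  have contF: "continuous_on UNIV F" "continuous_on UNIV (pd b F)" "continuous_on UNIV (pd b \<phi>)"
    using smooth_on_continuous smooth_on_pd F smooth_phi b by blast+
  have layer_diff: "(\<lambda>x. layer_seq n (\<phi> x)) differentiable (at x)"
    and pd_layer: "pd b (\<lambda>x. layer_seq n (\<phi> x)) x = - delta_seq n (\<phi> x) * pd b \<phi> x" for n x
  proof -
    have d: "layer_seq n differentiable (at (\<phi> x))"
      using DERIV_layer_seq real_differentiable_def by blast
    show "(\<lambda>x. layer_seq n (\<phi> x)) differentiable (at x)"
      using has_derivative_compose_real[where F=\<phi>, OF d diff_phi] by (auto simp: differentiable_def)
    show "pd b (\<lambda>x. layer_seq n (\<phi> x)) x = - delta_seq n (\<phi> x) * pd b \<phi> x"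
      using pd_compose_real[where F=\<phi>, OF d diff_phi] has_real_derivative_pd[OF DERIV_layer_seq] by simp
  qed
  have contl: "continuous_on UNIV (\<lambda>x. layer_seq n (\<phi> x))" for n
    using layer_diff by (simp add: continuous_at_imp_continuous_on differentiable_imp_continuous_within)
  define K where "K n x = F x * layer_seq n (\<phi> x)" for n x
  have pdK: "pd b (K n) x = pd b F x * layer_seq n (\<phi> x) - (F x * pd b \<phi> x) * delta_seq n (\<phi> x)" for n x
    unfolding K_def by (subst pd_mult[OF dF layer_diff]) (simp add: pd_layer)
  have pdK': "pd b (K n) = (\<lambda>x. pd b F x * layer_seq n (\<phi> x) - (F x * pd b \<phi> x) * delta_seq n (\<phi> x))" for n
    using pdK by blast
  have 0: "integral\<^sup>L lborel (pd b (K n)) = 0" for n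
  proof (rule integral_pd_eq_0[of _ _ D])
    show "K n differentiable (at x)" for x unfolding K_def by (intro differentiable_mult dF layer_diff)
    show "continuous_on UNIV (pd b (K n))" unfolding pdK' by (intro continuous_intros contF contl cont_phi)
    show "bounded D" using bdd by (simp add: D_def)
    show "K n x = 0" if "x \<notin> D" for x using that by (simp add: K_def D_def layer_seq_simps)
  qed
  have int1: "integrable lborel (\<lambda>x. pd b F x * layer_seq n (\<phi> x))" for n
    by (rule integrable_continuous_bounded_support[of _ D])
      (use bdd in \<open>auto intro!: continuous_intros contF contl simp: D_def layer_seq_simps\<close>)
  have int2: "integrable lborel (\<lambda>x. (F x * pd b \<phi> x) * delta_seq n (\<phi> x))" for n
    by (intro integrable_delta continuous_intros contF)
  \<comment> \<open>The product rule for \<open>K n\<close> under a vanishing total integral. On the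
    left the layer tends to the indicator of D; on the right it concentrates on S.\<close>
  have eq: "(\<integral>x. pd b F x * layer_seq n (\<phi> x) \<partial>lborel) = (\<integral>x. (F x * pd b \<phi> x) * delta_seq n (\<phi> x) \<partial>lborel)" for n
    using 0[of n] int1[of n] int2[of n] unfolding pdK' by simp
  have "(\<lambda>n. \<integral>x. pd b F x * layer_seq n (\<phi> x) \<partial>lborel) \<longlonglongrightarrow> (\<integral>x. indicator D x *\<^sub>R pd b F x \<partial>lborel)"
  proof (rule integral_dominated_convergence[where w="\<lambda>x. norm (indicator (closure D) x *\<^sub>R pd b F x)"])
    have [measurable]: "pd b F \<in> borel_measurable borel" "D \<in> sets borel"
      using borel_measurable_continuous_onI[OF contF(2)] open_D by auto
    show "(\<lambda>x. indicator D x *\<^sub>R pd b F x) \<in> borel_measurable lborel" by measurable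
    show "(\<lambda>x. pd b F x * layer_seq n (\<phi> x)) \<in> borel_measurable lborel" for n using int1 by blast
    show "integrable lborel (\<lambda>x. norm (indicator (closure D) x *\<^sub>R pd b F x))"
      by (intro integrable_norm borel_integrable_compact compact_closure_D continuous_on_subset[OF contF(2)]) auto
    have "(\<lambda>n. pd b F x * layer_seq n (\<phi> x)) \<longlonglongrightarrow> indicator D x *\<^sub>R pd b F x" for x
    proof (cases "x \<in> D")
      case True
      then have "\<forall>\<^sub>F n in sequentially. inverse (real (Suc n)) < - \<phi> x"
        by (intro eventually_inverse_Suc_less) (simp add: D_def)
      then have "\<forall>\<^sub>F n in sequentially. pd b F x * layer_seq n (\<phi> x) = indicator D x *\<^sub>R pd b F x"
        by eventually_elim (use True in \<open>simp add: layer_seq_simps\<close>)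
      then show ?thesis by (rule tendsto_eventually)
    next
      case False
      then show ?thesis by (simp add: D_def layer_seq_simps)
    qed
    then show "AE x in lborel. (\<lambda>n. pd b F x * layer_seq n (\<phi> x)) \<longlonglongrightarrow> indicator D x *\<^sub>R pd b F x" by simp
    have "norm (pd b F x * layer_seq n (\<phi> x)) \<le> norm (indicator (closure D) x *\<^sub>R pd b F x)" for n x
    proof (cases "x \<in> closure D")
      case True
      then show ?thesis using layer_seq_bounds[of n "\<phi> x"] by (simp add: abs_mult mult_left_le)
    next
      case False
      then show ?thesis by (simp add: closure_D layer_seq_simps)
    qed
    then show "AE x in lborel. norm (pd b F x * layer_seq n (\<phi> x)) \<le> norm (indicator (closure D) x *\<^sub>R pd b F x)" for n
      by simp
  qed
  moreover have "(\<lambda>n. \<integral>x. pd b F x * layer_seq n (\<phi> x) \<partial>lborel) \<longlonglongrightarrow> (\<integral>x. (F x * pd b \<phi> x) / norm (grad \<phi> x) \<partial>\<sigma>)"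
    unfolding eq by (intro layer_limit continuous_intros contF)
  ultimately have "(LINT x:D|lborel. pd b F x) = (\<integral>x. (F x * pd b \<phi> x) / norm (grad \<phi> x) \<partial>\<sigma>)"
    unfolding set_lebesgue_integral_def by (rule LIMSEQ_unique)
  then show ?thesis
    using b by (simp add: outer_normal_def grad_inner_Basis divide_inverse mult_ac)
qed

end

subsection \<open>Weighted Bochner identity\<close>

lemmas smooth_intros = smooth_on_add[OF open_UNIV] smooth_on_diff[OF open_UNIV] smooth_on_mult[OF open_UNIV]
  smooth_on_sum[OF open_UNIV] smooth_on_const smooth_on_inner smooth_on_pd smooth_on_minus[OF open_UNIV]

lemma smooth_on_UNIV_differentiable: "smooth_on UNIV F \<Longrightarrow> F differentiable (at x)"
  by (rule smooth_on_differentiable) auto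

lemma smooth_on_gauss: "smooth_on UNIV gauss"
proof -
  have "smooth_on UNIV (\<lambda>x::'a. exp ((norm (x - 0))\<^sup>2 * (-1/4)))"
    by (rule smooth_on_compose[OF open_UNIV _ smooth_on_exp[of UNIV]])
      (intro smooth_intros smooth_on_norm2, simp)
  then show ?thesis by (simp add: gauss_def[abs_def])
qed

lemma pd_gauss: "pd b gauss x = - (1/2) * (x \<bullet> b) * gauss x"
proof (rule has_derivative_pd[THEN trans])
  have "((\<lambda>x. exp ((x \<bullet> x) * (-1/4))) has_derivative
     (\<lambda>h. exp ((x \<bullet> x) * (-1/4)) * ((x \<bullet> h + h \<bullet> x) * (-1/4)))) (at x)"
    by (auto intro!: derivative_eq_intros)
  then show "(gauss has_derivative (\<lambda>h. exp ((x \<bullet> x) * (-1/4)) * ((x \<bullet> h + h \<bullet> x) * (-1/4)))) (at x)"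
    by (simp add: gauss_def[abs_def] power2_norm_eq_inner)
qed (simp add: gauss_def power2_norm_eq_inner inner_commute)

lemma pd_inner: "pd b (\<lambda>x. x \<bullet> a) x = b \<bullet> a"
  by (rule has_derivative_pd) (auto intro!: derivative_eq_intros)

text \<open>Differentiating the weight contributes -x/2, which completes the trace of the Hessian to
  \<open>drift_lap f\<close> and cancels the terms pairing x with Hessian and gradient. Third
  derivatives cancel by symmetry, and differentiating the coefficient x inside the drift leaves half
  of the squared gradient.\<close>

lemma weighted_bochner:
  fixes f :: "'a::euclidean_space \<Rightarrow> real"
  assumes f: "smooth_on UNIV f"
  defines "F \<equiv> \<lambda>b x. gauss x * (drift_lap f x * pd b f x - (\<Sum>c\<in>Basis. pd c f x * pd b (pd c f) x))"
  shows "b \<in> Basis \<Longrightarrow> smooth_on UNIV (F b)"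
    and "(\<Sum>b\<in>Basis. pd b (F b) x) = ((drift_lap f x)\<^sup>2 - hess_norm2 f x - (1/2) * (norm (grad f x))\<^sup>2) * gauss x"
proof -
  define L where "L x = (\<Sum>b\<in>Basis. pd b (pd b f) x) - (1/2) * (\<Sum>b\<in>Basis. (x \<bullet> b) * pd b f x)" for x
  have drift: "drift_lap f = L"
  proof
    fix x
    have "x \<bullet> grad f x = (\<Sum>b\<in>Basis. (x \<bullet> b) * pd b f x)"
      by (subst euclidean_inner) (simp add: grad_inner_Basis)
    then show "drift_lap f x = L x" by (simp add: drift_lap_def lap_def L_def)
  qed
  have sL: "smooth_on UNIV L" unfolding L_def by (intro smooth_intros f)
  have s1: "smooth_on UNIV (pd b f)" if "b \<in> Basis" for b using that by (intro smooth_intros f)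

  note d = smooth_on_UNIV_differentiable
  have com: "pd b (pd c f) = pd c (pd b f)" if "b \<in> Basis" "c \<in> Basis" for b c
    using pd_commute[OF f that] by auto
  define V where "V b x = L x * pd b f x - (\<Sum>c\<in>Basis. pd c f x * pd b (pd c f) x)" for b x
  have sV: "smooth_on UNIV (V b)" if "b \<in> Basis" for b
    unfolding V_def by (intro smooth_intros sL f that)
  have FV: "F b = (\<lambda>x. gauss x * V b x)" for b unfolding F_def V_def drift ..
  show "smooth_on UNIV (F b)" if "b \<in> Basis" for b
    unfolding FV by (intro smooth_intros smooth_on_gauss sV that)
  define x1 where "x1 b = x \<bullet> b" for b
  define f1 where "f1 b = pd b f x" for b
  define f2 where "f2 b c = pd b (pd c f) x" for b c
  define f3 where "f3 b c = pd b (pd c (pd c f)) x" for b c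
  have sym: "f2 b c = f2 c b" if "b \<in> Basis" "c \<in> Basis" for b c using com that by (simp add: f2_def)
  have pdL: "pd b L x = (\<Sum>c\<in>Basis. f3 b c) - (1/2) * (f1 b + (\<Sum>c\<in>Basis. x1 c * f2 b c))" if b: "b \<in> Basis" for b
  proof -
    have "pd b L x = pd b (\<lambda>x. \<Sum>b\<in>Basis. pd b (pd b f) x) x
        - pd b (\<lambda>x. (1/2) * (\<Sum>b\<in>Basis. (x \<bullet> b) * pd b f x)) x"
      unfolding L_def by (intro pd_diff d smooth_intros f)
    also have "pd b (\<lambda>x. \<Sum>b\<in>Basis. pd b (pd b f) x) x = (\<Sum>c\<in>Basis. f3 b c)"
      unfolding f3_def by (intro pd_sum d smooth_intros f)
    also have "pd b (\<lambda>x. (1/2) * (\<Sum>b\<in>Basis. (x \<bullet> b) * pd b f x)) x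
        = (1/2) * pd b (\<lambda>x. \<Sum>b\<in>Basis. (x \<bullet> b) * pd b f x) x + pd b (\<lambda>x. 1/2) x * (\<Sum>b\<in>Basis. (x \<bullet> b) * pd b f x)"
      by (intro pd_mult d smooth_intros f)
    also have "pd b (\<lambda>x. \<Sum>b\<in>Basis. (x \<bullet> b) * pd b f x) x = (\<Sum>c\<in>Basis. pd b (\<lambda>x. (x \<bullet> c) * pd c f x) x)"
      by (intro pd_sum d smooth_intros f)
    also have "\<dots> = (\<Sum>c\<in>Basis. (if b = c then f1 c else 0) + x1 c * f2 b c)"
    proof (intro sum.cong refl)
      fix c :: 'a assume c: "c \<in> Basis"
      have "pd b (\<lambda>x. (x \<bullet> c) * pd c f x) x = (x \<bullet> c) * pd b (pd c f) x + pd b (\<lambda>x. x \<bullet> c) x * pd c f x"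
        by (intro pd_mult d smooth_intros f c)
      then show "pd b (\<lambda>x. (x \<bullet> c) * pd c f x) x = (if b = c then f1 c else 0) + x1 c * f2 b c"
        using b c by (simp add: pd_inner inner_Basis x1_def f1_def f2_def)
    qed
    also have "\<dots> = f1 b + (\<Sum>c\<in>Basis. x1 c * f2 b c)" using b by (simp add: sum.distrib)
    finally show ?thesis by (simp add: pd_const)
  qed
  have pdV: "pd b (V b) x = L x * f2 b b + pd b L x * f1 b - (\<Sum>c\<in>Basis. f1 c * f3 c b + f2 b c * f2 b c)"
    if b: "b \<in> Basis" for b
  proof -
    have "pd b (V b) x = pd b (\<lambda>x. L x * pd b f x) x - pd b (\<lambda>x. \<Sum>c\<in>Basis. pd c f x * pd b (pd c f) x) x"
      unfolding V_def by (intro pd_diff d smooth_intros sL f b)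
    also have "pd b (\<lambda>x. L x * pd b f x) x = L x * f2 b b + pd b L x * f1 b"
      unfolding f2_def f1_def by (intro pd_mult d smooth_intros sL f b)
    also have "pd b (\<lambda>x. \<Sum>c\<in>Basis. pd c f x * pd b (pd c f) x) x
        = (\<Sum>c\<in>Basis. pd b (\<lambda>x. pd c f x * pd b (pd c f) x) x)"
      by (intro pd_sum d smooth_intros f b)
    also have "\<dots> = (\<Sum>c\<in>Basis. f1 c * f3 c b + f2 b c * f2 b c)"
    proof (intro sum.cong refl)
      fix c :: 'a assume c: "c \<in> Basis"
      have "pd b (\<lambda>x. pd c f x * pd b (pd c f) x) x
          = pd c f x * pd b (pd b (pd c f)) x + pd b (pd c f) x * pd b (pd c f) x"
        by (intro pd_mult d smooth_intros f b c)
      \<comment> \<open>Moving c outermost exhibits this term as a derivative of the Laplacian,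
        which is what cancels against the gradient of L.\<close>
      moreover have "pd b (pd b (pd c f)) x = pd c (pd b (pd b f)) x"
        using com[OF b c] pd_commute[OF s1[OF b] b c, of x] by simp
      ultimately show "pd b (\<lambda>x. pd c f x * pd b (pd c f) x) x = f1 c * f3 c b + f2 b c * f2 b c"
        by (simp add: f1_def f2_def f3_def)
    qed
    finally show ?thesis .
  qed
  have pdF: "pd b (F b) x = gauss x * (pd b (V b) x - (1/2) * x1 b * V b x)" if b: "b \<in> Basis" for b
  proof -
    have "pd b (F b) x = gauss x * pd b (V b) x + pd b gauss x * V b x"
      unfolding FV by (intro pd_mult d smooth_on_gauss sV b)
    then show ?thesis by (simp add: pd_gauss x1_def algebra_simps)
  qed
  have Lx: "L x = (\<Sum>b\<in>Basis. f2 b b) - (1/2) * (\<Sum>b\<in>Basis. x1 b * f1 b)"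
    by (simp add: L_def f2_def f1_def x1_def)
  have Vx: "V b x = L x * f1 b - (\<Sum>c\<in>Basis. f1 c * f2 b c)" for b
    by (simp add: V_def f2_def f1_def)
  have third: "(\<Sum>b\<in>Basis. \<Sum>c\<in>Basis. f3 b c * f1 b) = (\<Sum>b\<in>Basis. \<Sum>c\<in>Basis. f1 c * f3 c b)"
    by (subst sum.swap) (simp add: mult.commute)
  have second: "(\<Sum>b\<in>Basis. \<Sum>c\<in>Basis. x1 c * f2 b c * f1 b) = (\<Sum>b\<in>Basis. \<Sum>c\<in>Basis. x1 b * (f1 c * f2 b c))"
    by (subst sum.swap) (intro sum.cong refl, simp add: sym mult_ac)
  have "(\<Sum>b\<in>Basis. pd b (F b) x) = gauss x * (\<Sum>b\<in>Basis. pd b (V b) x - (1/2) * x1 b * V b x)"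
    by (simp add: sum_distrib_left pdF)
  also have "(\<Sum>b\<in>Basis. pd b (V b) x - (1/2) * x1 b * V b x)
      = (\<Sum>b\<in>Basis. L x * f2 b b + (\<Sum>c\<in>Basis. f3 b c * f1 b) - (1/2) * (f1 b)\<^sup>2
          - (1/2) * (\<Sum>c\<in>Basis. x1 c * f2 b c * f1 b)
          - (\<Sum>c\<in>Basis. f1 c * f3 c b) - (\<Sum>c\<in>Basis. (f2 b c)\<^sup>2)
          - (1/2) * (L x * (x1 b * f1 b)) + (1/2) * (\<Sum>c\<in>Basis. x1 b * (f1 c * f2 b c)))"
  proof (intro sum.cong refl)
    fix b :: 'a assume b: "b \<in> Basis"
    have e1: "(\<Sum>c\<in>Basis. f3 b c) * f1 b = (\<Sum>c\<in>Basis. f3 b c * f1 b)" by (rule sum_distrib_right)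
    have e2: "(\<Sum>c\<in>Basis. x1 c * f2 b c) * f1 b = (\<Sum>c\<in>Basis. x1 c * f2 b c * f1 b)" by (rule sum_distrib_right)
    have e3: "x1 b * (\<Sum>c\<in>Basis. f1 c * f2 b c) = (\<Sum>c\<in>Basis. x1 b * (f1 c * f2 b c))" by (rule sum_distrib_left)
    show "pd b (V b) x - (1/2) * x1 b * V b x = L x * f2 b b + (\<Sum>c\<in>Basis. f3 b c * f1 b) - (1/2) * (f1 b)\<^sup>2
          - (1/2) * (\<Sum>c\<in>Basis. x1 c * f2 b c * f1 b)
          - (\<Sum>c\<in>Basis. f1 c * f3 c b) - (\<Sum>c\<in>Basis. (f2 b c)\<^sup>2)
          - (1/2) * (L x * (x1 b * f1 b)) + (1/2) * (\<Sum>c\<in>Basis. x1 b * (f1 c * f2 b c))"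
      unfolding pdV[OF b] pdL[OF b] Vx e1[symmetric] e2[symmetric] e3[symmetric] sum.distrib power2_eq_square
      by (simp add: algebra_simps)
  qed
  also have "\<dots> = L x * ((\<Sum>b\<in>Basis. f2 b b) - (1/2) * (\<Sum>b\<in>Basis. x1 b * f1 b))
      - (\<Sum>b\<in>Basis. \<Sum>c\<in>Basis. (f2 b c)\<^sup>2) - (1/2) * (\<Sum>b\<in>Basis. (f1 b)\<^sup>2)"
    unfolding sum.distrib sum_subtractf sum_distrib_left[symmetric] third second
    by (simp add: algebra_simps)
  also have "\<dots> = (L x)\<^sup>2 - hess_norm2 f x - (1/2) * (norm (grad f x))\<^sup>2"
  proof -
    have "(norm (grad f x))\<^sup>2 = (\<Sum>b\<in>Basis. (f1 b)\<^sup>2)"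
      unfolding power2_norm_eq_inner f1_def
      by (subst euclidean_inner) (simp add: grad_inner_Basis power2_eq_square)
    moreover have "hess_norm2 f x = (\<Sum>b\<in>Basis. \<Sum>c\<in>Basis. (f2 b c)\<^sup>2)"
      by (simp add: hess_norm2_def f2_def)
    ultimately show ?thesis unfolding Lx[symmetric] by (simp only: power2_eq_square)
  qed
  finally show "(\<Sum>b\<in>Basis. pd b (F b) x) = ((drift_lap f x)\<^sup>2 - hess_norm2 f x - (1/2) * (norm (grad f x))\<^sup>2) * gauss x"
    unfolding drift by (simp add: mult.commute)
qed

text \<open>The pointwise algebra on the boundary: \<open>n\<close> is the unit normal, \<open>dn a b\<close> the derivative of
  its component \<open>b\<close> in direction \<open>a\<close>, \<open>f1\<close> and \<open>f2\<close> are the first and second derivatives of \<open>f\<close>.\<close>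

lemma boundary_algebra:
  fixes n f1 x1 :: "'i \<Rightarrow> real" and f2 dn :: "'i \<Rightarrow> 'i \<Rightarrow> real"
  assumes n1: "(\<Sum>b\<in>I. n b * n b) = 1" and sym: "\<And>b c. b \<in> I \<Longrightarrow> c \<in> I \<Longrightarrow> f2 b c = f2 c b"
  defines "fn \<equiv> \<Sum>b\<in>I. n b * f1 b"
  defines "u \<equiv> \<lambda>b. f1 b - n b * fn"
  defines "dfn \<equiv> \<lambda>a. \<Sum>c\<in>I. n c * f2 a c + dn a c * f1 c"
  defines "du \<equiv> \<lambda>a b. f2 a b - (n b * dfn a + dn a b * fn)"
  defines "H \<equiv> - (\<Sum>b\<in>I. dn b b - n b * (\<Sum>a\<in>I. n a * dn a b))"
  defines "\<tau> \<equiv> \<Sum>b\<in>I. du b b - n b * (\<Sum>a\<in>I. n a * du a b)"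
  assumes tn: "(\<Sum>b\<in>I. u b * (\<Sum>a\<in>I. n a * dn b a)) = 0"
  shows "((\<Sum>b\<in>I. f2 b b) - (1/2) * (\<Sum>b\<in>I. x1 b * f1 b)) * fn - (\<Sum>b\<in>I. \<Sum>c\<in>I. f1 c * f2 b c * n b)
     = fn * (\<tau> - (1/2) * (\<Sum>b\<in>I. x1 b * u b)) - fn\<^sup>2 * ((1/2) * (\<Sum>b\<in>I. x1 b * n b) + H)
       - (\<Sum>b\<in>I. u b * dfn b) + (\<Sum>b\<in>I. \<Sum>c\<in>I. u b * u c * dn c b)"
    (is "?lhs = ?rhs")
proof -
  define fnn where "fnn = (\<Sum>b\<in>I. \<Sum>a\<in>I. n b * (n a * f2 a b))"
  have f1u: "f1 b = u b + n b * fn" for b by (simp add: u_def)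
  \<comment> \<open>The ambient Laplacian is the surface Laplacian plus the second normal derivative
    minus H times f_nu. The sign of H reflects that it is minus the divergence of the
    normal.\<close>
  have \<tau>: "\<tau> = (\<Sum>b\<in>I. f2 b b) - fnn + H * fn"
  proof -
    have "\<tau> = (\<Sum>b\<in>I. f2 b b - n b * dfn b - dn b b * fn - (\<Sum>a\<in>I. n b * (n a * f2 a b))
        + n b * n b * (\<Sum>a\<in>I. n a * dfn a) + n b * (\<Sum>a\<in>I. n a * dn a b) * fn)"
      unfolding \<tau>_def
    proof (intro sum.cong refl)
      fix b
      have "(\<Sum>a\<in>I. n a * du a b) = (\<Sum>a\<in>I. n a * f2 a b) - n b * (\<Sum>a\<in>I. n a * dfn a) - (\<Sum>a\<in>I. n a * dn a b) * fn"
        by (simp add: du_def right_diff_distrib distrib_left sum_subtractf sum.distrib sum_distrib_left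
            sum_distrib_right mult_ac)
      then have "n b * (\<Sum>a\<in>I. n a * du a b) = n b * (\<Sum>a\<in>I. n a * f2 a b) - n b * n b * (\<Sum>a\<in>I. n a * dfn a)
          - n b * (\<Sum>a\<in>I. n a * dn a b) * fn" by (simp add: right_diff_distrib mult.assoc)
      then show "du b b - n b * (\<Sum>a\<in>I. n a * du a b) = f2 b b - n b * dfn b - dn b b * fn - (\<Sum>a\<in>I. n b * (n a * f2 a b))
        + n b * n b * (\<Sum>a\<in>I. n a * dfn a) + n b * (\<Sum>a\<in>I. n a * dn a b) * fn"
        by (simp add: du_def sum_distrib_left)
    qed
    also have "\<dots> = (\<Sum>b\<in>I. f2 b b) - (\<Sum>b\<in>I. n b * dfn b) - (\<Sum>b\<in>I. dn b b) * fn - fnn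
        + (\<Sum>b\<in>I. n b * n b) * (\<Sum>a\<in>I. n a * dfn a) + (\<Sum>b\<in>I. n b * (\<Sum>a\<in>I. n a * dn a b)) * fn"
      by (simp add: sum.distrib sum_subtractf sum_distrib_right fnn_def)
    also have "\<dots> = (\<Sum>b\<in>I. f2 b b) - fnn + H * fn"
      unfolding n1 H_def by (simp add: sum_subtractf algebra_simps)
    finally show ?thesis .
  qed
  define A where "A = (\<Sum>b\<in>I. \<Sum>c\<in>I. u b * n c * f2 b c)"
  \<comment> \<open>Along u, the derivative of f_nu splits into the mixed Hessian term A and a term
    where the normal is differentiated. The normal component of the gradient drops out of the latter
    by \<open>tn\<close>.\<close>
  have udfn: "(\<Sum>b\<in>I. u b * dfn b) = (\<Sum>b\<in>I. \<Sum>c\<in>I. u b * u c * dn c b) + A"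
  proof -
    have "u b * dfn b = (\<Sum>c\<in>I. u b * n c * f2 b c) + (\<Sum>c\<in>I. u b * dn b c * u c) + fn * (u b * (\<Sum>c\<in>I. n c * dn b c))" for b
      by (simp add: dfn_def f1u distrib_left sum.distrib sum_distrib_left mult_ac)
    then have "(\<Sum>b\<in>I. u b * dfn b) = A + (\<Sum>b\<in>I. \<Sum>c\<in>I. u b * dn b c * u c)
        + fn * (\<Sum>b\<in>I. u b * (\<Sum>c\<in>I. n c * dn b c))"
      by (simp only: sum.distrib sum_distrib_left A_def)
    moreover have "(\<Sum>b\<in>I. \<Sum>c\<in>I. u b * dn b c * u c) = (\<Sum>b\<in>I. \<Sum>c\<in>I. u b * u c * dn c b)"
      by (subst sum.swap) (simp add: mult_ac)
    ultimately show ?thesis using tn by simp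
  qed
  have fA: "(\<Sum>b\<in>I. \<Sum>c\<in>I. f1 c * f2 b c * n b) = A + fn * fnn"
  proof -
    have "(\<Sum>b\<in>I. \<Sum>c\<in>I. f1 c * f2 b c * n b) = (\<Sum>c\<in>I. \<Sum>b\<in>I. f1 c * f2 b c * n b)"
      by (rule sum.swap)
    also have "\<dots> = (\<Sum>c\<in>I. \<Sum>b\<in>I. u c * n b * f2 c b + fn * (n c * (n b * f2 b c)))"
      by (intro sum.cong refl) (simp add: f1u sym algebra_simps)
    also have "\<dots> = A + fn * fnn"
      unfolding sum.distrib sum_distrib_left[symmetric] A_def fnn_def ..
    finally show ?thesis .
  qed
  have xs: "(\<Sum>b\<in>I. x1 b * f1 b) = (\<Sum>b\<in>I. x1 b * u b) + fn * (\<Sum>b\<in>I. x1 b * n b)"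
    by (simp add: f1u distrib_left sum.distrib sum_distrib_left mult_ac)
  show ?thesis
    unfolding \<tau> udfn fA xs by (simp add: algebra_simps power2_eq_square)
qed

subsection \<open>Surface calculus\<close>

context level_domain
begin

abbreviation N where "N \<equiv> outer_normal \<phi>"

text \<open>The unit normal extends smoothly to the whole space without any cutoff, because
  \<open>\<phi>\<close> and its gradient have no common zero.\<close>

definition nu :: "real^'n \<Rightarrow> real^'n \<Rightarrow> real" where
  "nu b x = pd b \<phi> x * ((\<Sum>c\<in>Basis. (pd c \<phi> x)\<^sup>2) + (\<phi> x)\<^sup>2) powr (-1/2)"

lemma grad_norm2: "(\<Sum>c\<in>Basis. (pd c \<phi> x)\<^sup>2) = (norm (grad \<phi> x))\<^sup>2"
  unfolding power2_norm_eq_inner by (subst euclidean_inner) (simp add: grad_inner_Basis power2_eq_square)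

lemma smooth_nu: "b \<in> Basis \<Longrightarrow> smooth_on UNIV (nu b)"
proof -
  assume b: "b \<in> Basis"
  have "(norm (grad \<phi> x))\<^sup>2 + (\<phi> x)\<^sup>2 > 0" for x
    using reg[of x] by (cases "\<phi> x = 0") (auto intro: add_nonneg_pos)
  then show ?thesis
    unfolding nu_def
    by (intro smooth_intros smooth_phi b smooth_on_compose[OF open_UNIV _ smooth_on_powr] smooth_on_power open_UNIV)
      (auto simp: grad_norm2)
qed

lemma N_unit: "x \<in> S \<Longrightarrow> N x \<bullet> N x = 1"
  using reg[of x] by (simp add: S_def outer_normal_def dot_square_norm power2_eq_square)

lemma grad_phi_eq: "x \<in> S \<Longrightarrow> grad \<phi> x = norm (grad \<phi> x) *\<^sub>R N x"
  using reg[of x] by (simp add: S_def outer_normal_def)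

lemma nu_eq: "x \<in> S \<Longrightarrow> b \<in> Basis \<Longrightarrow> nu b x = N x \<bullet> b"
  using reg[of x]
  by (simp add: nu_def S_def outer_normal_def grad_norm2 grad_inner_Basis powr_minus powr_half_sqrt mult.commute)

lemma sum_nu_nu: assumes "x \<in> S" shows "(\<Sum>b\<in>Basis. nu b x * nu b x) = 1"
  using N_unit[OF assms] nu_eq[OF assms] by (subst (asm) euclidean_inner) simp

text \<open>The tangential derivative with the global smooth \<open>nu\<close> in place of the
  normal. The result is again smooth on the whole space, so the operator can be iterated and
  integrated without choosing extensions.\<close>

definition Dt :: "real^'n \<Rightarrow> (real^'n \<Rightarrow> real) \<Rightarrow> real^'n \<Rightarrow> real" where
  "Dt b G x = pd b G x - nu b x * (\<Sum>a\<in>Basis. nu a x * pd a G x)"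

lemma smooth_Dt: "smooth_on UNIV G \<Longrightarrow> b \<in> Basis \<Longrightarrow> smooth_on UNIV (Dt b G)"
  unfolding Dt_def by (intro smooth_intros smooth_nu)

lemma Dt_eq_pd:
  assumes x: "x \<in> S" and b: "b \<in> Basis" and G: "G differentiable (at x)"
  shows "Dt b G x = pd (b - (N x \<bullet> b) *\<^sub>R N x) G x"
proof -
  have "(\<Sum>a\<in>Basis. nu a x * pd a G x) = N x \<bullet> grad G x"
    by (subst euclidean_inner) (simp add: grad_inner_Basis nu_eq[OF x])
  then show ?thesis
    unfolding Dt_def pd_grad[OF G] nu_eq[OF x b]
    by (simp add: inner_diff_right inner_commute)
qed

text \<open>The projection of b is orthogonal to the gradient of \<phi>, which is parallel to the
  normal. Used with k = 0 for differences of extensions and with k = 1 for the squared length of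
  \<open>nu\<close>.\<close>

lemma Dt_const_eq_0:
  assumes x: "x \<in> S" and b: "b \<in> Basis" and G: "G differentiable (at x)" and z: "\<And>y. y \<in> S \<Longrightarrow> G y = k"
  shows "Dt b G x = 0"
proof -
  have dk: "(\<lambda>y. G y - k) differentiable (at x)" by (intro differentiable_diff G differentiable_const)
  have "pd (b - (N x \<bullet> b) *\<^sub>R N x) (\<lambda>y. G y - k) x = 0"
  proof (rule pd_tangent_eq_0[OF x dk])
    show "grad \<phi> x \<bullet> (b - (N x \<bullet> b) *\<^sub>R N x) = 0"
      using N_unit[OF x] by (subst grad_phi_eq[OF x]) (simp add: inner_diff_right)
  qed (simp add: z)
  then show ?thesis
    unfolding Dt_eq_pd[OF x b G] using pd_diff[OF G differentiable_const[of k]] by (simp add: pd_const)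
qed

lemma Dt_diff:
  assumes "F differentiable (at x)" "G differentiable (at x)"
  shows "Dt b (\<lambda>x. F x - G x) x = Dt b F x - Dt b G x"
  unfolding Dt_def pd_diff[OF assms] by (simp add: right_diff_distrib sum_subtractf)

lemma Dt_mult:
  assumes "F differentiable (at x)" "G differentiable (at x)"
  shows "Dt b (\<lambda>x. F x * G x) x = F x * Dt b G x + G x * Dt b F x"
proof -
  have "(\<Sum>a\<in>Basis. nu a x * pd a (\<lambda>x. F x * G x) x)
      = F x * (\<Sum>a\<in>Basis. nu a x * pd a G x) + G x * (\<Sum>a\<in>Basis. nu a x * pd a F x)"
    unfolding pd_mult[OF assms] by (simp add: distrib_left sum.distrib sum_distrib_left mult_ac)
  then show ?thesis unfolding Dt_def pd_mult[OF assms] by (simp add: algebra_simps)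
qed

lemma ext_eq:
  assumes "smooth_on UNIV G" "\<And>y. y \<in> S \<Longrightarrow> G y = w y"
  shows "smooth_on UNIV (ext S w)" "\<And>y. y \<in> S \<Longrightarrow> ext S w y = w y"
proof -
  have "\<exists>W. smooth_on UNIV W \<and> (\<forall>y\<in>S. W y = w y)" using assms by blast
  from someI_ex[OF this] show "smooth_on UNIV (ext S w)" "\<And>y. y \<in> S \<Longrightarrow> ext S w y = w y"
    unfolding ext_def by blast+
qed

text \<open>The choice inside \<open>ext\<close> is immaterial: the chosen extension and G differ by
  a smooth function vanishing on S, whose tangential derivatives vanish there. All choice-based
  boundary operators are reduced to \<open>Dt\<close> through this.\<close>

lemma tdiff_eq:
  assumes x: "x \<in> S" and b: "b \<in> Basis" and G: "smooth_on UNIV G" "\<And>y. y \<in> S \<Longrightarrow> G y = w y"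
  shows "tdiff S N b w x = Dt b G x"
proof -
  note E = ext_eq[OF G]
  have dE: "ext S w differentiable (at x)" and dG: "G differentiable (at x)"
    using smooth_on_UNIV_differentiable E(1) G(1) by auto
  have "Dt b (\<lambda>y. ext S w y - G y) x = 0"
    by (rule Dt_const_eq_0[OF x b, of _ 0]) (use dE dG E(2) G(2) in auto)
  then have "Dt b (ext S w) x = Dt b G x" using Dt_diff[OF dE dG] by simp
  moreover have "tdiff S N b w x = Dt b (ext S w) x"
    unfolding tdiff_def Dt_eq_pd[OF x b dE] pd_grad[OF dE]
    by (simp add: inner_diff_right inner_commute)
  ultimately show ?thesis by simp
qed

lemma measurable_N[measurable]: "N \<in> borel_measurable borel"
  unfolding outer_normal_def[abs_def] by measurable

text \<open>Holds for every w, even one without smooth extension, where \<open>ext\<close> is an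
  unspecified function, because gradients of arbitrary functions are Borel.\<close>

lemma measurable_tdiff: "b \<in> Basis \<Longrightarrow> tdiff S N b w \<in> borel_measurable borel"
proof -
  assume b: "b \<in> Basis"
  have [measurable]: "grad (ext S w) \<in> borel_measurable borel" by (rule borel_measurable_grad)
  show ?thesis unfolding tdiff_def[abs_def] grad_inner_Basis[OF b, symmetric] by measurable
qed

text \<open>Both terms are fluxes of second derivatives of \<open>G\<close>, which agree by symmetry. These skew operators
  are tangential, and every tangential derivative is a combination of them.\<close>

lemma integral_skew_eq_0:
  assumes G: "smooth_on UNIV G" and ab: "a \<in> Basis" "b \<in> Basis"
  shows "(\<integral>x. nu a x * pd b G x - nu b x * pd a G x \<partial>\<sigma>) = 0"
proof -
  have c: "(\<lambda>x. nu a x * pd b G x) \<in> borel_measurable borel" "integrable \<sigma> (\<lambda>x. nu a x * pd b G x)"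
    if "a \<in> Basis" "b \<in> Basis" for a b
  proof -
    have c: "continuous_on UNIV (\<lambda>x. nu a x * pd b G x)"
      by (intro smooth_on_continuous smooth_intros smooth_nu G that)
    then show m: "(\<lambda>x. nu a x * pd b G x) \<in> borel_measurable borel" by (rule borel_measurable_continuous_onI)
    show "integrable \<sigma> (\<lambda>x. nu a x * pd b G x)" by (rule integrable_\<sigma>_continuous[OF m c refl])
  qed
  have e: "(\<integral>x. nu a x * pd b G x \<partial>\<sigma>) = (LINT x:D|lborel. pd a (pd b G) x)"
    if ab: "a \<in> Basis" "b \<in> Basis" for a b
  proof -
    have [measurable]: "pd b G \<in> borel_measurable borel"
      by (intro borel_measurable_continuous_onI smooth_on_continuous smooth_intros G ab)
    have "(\<integral>x. nu a x * pd b G x \<partial>\<sigma>) = (\<integral>x. pd b G x * (N x \<bullet> a) \<partial>\<sigma>)"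
    proof (rule integral_cong_AE)
      show "AE x in \<sigma>. nu a x * pd b G x = pd b G x * (N x \<bullet> a)"
        using AE_S by eventually_elim (simp add: nu_eq ab)
    qed (unfold borel_\<sigma>, use c ab in auto)
    then show ?thesis using divergence_theorem[of "pd b G" a] ab by (simp add: smooth_on_pd G)
  qed
  have "(\<integral>x. nu a x * pd b G x - nu b x * pd a G x \<partial>\<sigma>)
      = (\<integral>x. nu a x * pd b G x \<partial>\<sigma>) - (\<integral>x. nu b x * pd a G x \<partial>\<sigma>)"
    using c(2) ab by (intro Bochner_Integration.integral_diff)
  also have "\<dots> = 0"
  proof -
    have "pd a (pd b G) = pd b (pd a G)" using pd_commute[OF G ab] by auto
    then show ?thesis unfolding e[OF ab] e[OF ab(2,1)] by simp
  qed
  finally show ?thesis .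
qed

text \<open>The normal correction in \<open>Dt b\<close> is proportional to \<open>nu b\<close> and
  disappears on contraction with a tangential t.\<close>

lemma tangential_sum_Dt:
  assumes t: "(\<Sum>b\<in>Basis. nu b x * t b) = 0"
  shows "(\<Sum>b\<in>Basis. t b * Dt b G x) = (\<Sum>b\<in>Basis. t b * pd b G x)"
proof -
  have "(\<Sum>b\<in>Basis. t b * Dt b G x)
      = (\<Sum>b\<in>Basis. t b * pd b G x) - (\<Sum>b\<in>Basis. nu b x * t b) * (\<Sum>a\<in>Basis. nu a x * pd a G x)"
    unfolding Dt_def by (simp add: right_diff_distrib sum_subtractf sum_distrib_right mult_ac)
  then show ?thesis using t by simp
qed

text \<open>The squared length of \<open>nu\<close> equals 1 only on S, so only its tangential
  derivatives are known to vanish; hence the contraction with a tangential t.\<close>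

lemma tangential_sum_dnu:
  assumes x: "x \<in> S" and t: "(\<Sum>b\<in>Basis. nu b x * t b) = 0"
  shows "(\<Sum>b\<in>Basis. t b * (\<Sum>a\<in>Basis. nu a x * pd b (nu a) x)) = 0"
proof -
  define Z where "Z y = (\<Sum>a\<in>Basis. nu a y * nu a y)" for y
  have sZ: "smooth_on UNIV Z" unfolding Z_def by (intro smooth_intros smooth_nu)
  have "pd b Z x = 2 * (\<Sum>a\<in>Basis. nu a x * pd b (nu a) x)" for b
  proof -
    have "pd b Z x = (\<Sum>a\<in>Basis. pd b (\<lambda>y. nu a y * nu a y) x)"
      unfolding Z_def by (intro pd_sum smooth_on_UNIV_differentiable smooth_intros smooth_nu)
    also have "\<dots> = (\<Sum>a\<in>Basis. 2 * (nu a x * pd b (nu a) x))"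
    proof (intro sum.cong refl)
      fix a :: "real^'n" assume "a \<in> Basis"
      then have "nu a differentiable (at x)" using smooth_on_UNIV_differentiable smooth_nu by blast
      then show "pd b (\<lambda>y. nu a y * nu a y) x = 2 * (nu a x * pd b (nu a) x)" by (simp add: pd_mult)
    qed
    finally show ?thesis by (simp add: sum_distrib_left)
  qed
  moreover have "Dt b Z x = 0" if "b \<in> Basis" for b
    by (rule Dt_const_eq_0[OF x that smooth_on_UNIV_differentiable[OF sZ], of 1]) (simp add: Z_def sum_nu_nu)
  ultimately have "(\<Sum>b\<in>Basis. t b * (2 * (\<Sum>a\<in>Basis. nu a x * pd b (nu a) x))) = 0"
    using tangential_sum_Dt[OF t, of Z] by simp
  moreover have "(\<Sum>b\<in>Basis. t b * (2 * (\<Sum>a\<in>Basis. nu a x * pd b (nu a) x)))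
      = 2 * (\<Sum>b\<in>Basis. t b * (\<Sum>a\<in>Basis. nu a x * pd b (nu a) x))"
    by (simp add: sum_distrib_left mult_ac)
  ultimately show ?thesis by simp
qed

text \<open>The skew operators are applied to nu_a Y_b and summed over a and b. Terms
  differentiating Y add up to its surface divergence because \<open>nu\<close> has length 1. Of
  those differentiating \<open>nu\<close>, one vanishes by unit length along Y, the other by
  tangency of Y. Each summand has integral zero.\<close>

lemma surface_divergence:
  assumes Y: "\<And>b. b \<in> Basis \<Longrightarrow> smooth_on UNIV (Y b)"
    and t: "\<And>x. x \<in> S \<Longrightarrow> (\<Sum>b\<in>Basis. nu b x * Y b x) = 0"
  shows "(\<integral>x. (\<Sum>b\<in>Basis. Dt b (Y b) x) \<partial>\<sigma>) = 0"
proof -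
  define P where "P a b x = nu a x * pd b (\<lambda>x. nu a x * Y b x) x - nu b x * pd a (\<lambda>x. nu a x * Y b x) x" for a b x
  have sP: "smooth_on UNIV (P a b)" if "a \<in> Basis" "b \<in> Basis" for a b
    unfolding P_def by (intro smooth_intros smooth_nu Y that)
  have mP: "P a b \<in> borel_measurable borel" if "a \<in> Basis" "b \<in> Basis" for a b
    by (intro borel_measurable_continuous_onI smooth_on_continuous sP that)
  have iP: "integrable \<sigma> (P a b)" if "a \<in> Basis" "b \<in> Basis" for a b
    by (rule integrable_\<sigma>_continuous[OF mP[OF that] smooth_on_continuous[OF sP[OF that]] refl])
  have pt: "(\<Sum>a\<in>Basis. \<Sum>b\<in>Basis. P a b x) = (\<Sum>b\<in>Basis. Dt b (Y b) x)" if x: "x \<in> S" for x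
  proof -
    have P: "P a b x = nu a x * nu a x * pd b (Y b) x - nu b x * (nu a x * pd a (Y b) x)
        + Y b x * (nu a x * pd b (nu a) x) - (nu b x * Y b x) * pd a (nu a) x"
      if "a \<in> Basis" "b \<in> Basis" for a b
    proof -
      have d: "nu a differentiable (at x)" "Y b differentiable (at x)"
        using that smooth_on_UNIV_differentiable smooth_nu Y by blast+
      show ?thesis unfolding P_def pd_mult[OF d] by (simp add: algebra_simps)
    qed
    have "(\<Sum>a\<in>Basis. \<Sum>b\<in>Basis. P a b x) = (\<Sum>b\<in>Basis. \<Sum>a\<in>Basis. P a b x)" by (rule sum.swap)
    also have "\<dots> = (\<Sum>b\<in>Basis. \<Sum>a\<in>Basis. nu a x * nu a x * pd b (Y b) x - nu b x * (nu a x * pd a (Y b) x)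
        + Y b x * (nu a x * pd b (nu a) x) - (nu b x * Y b x) * pd a (nu a) x)"
      by (intro sum.cong refl P)
    also have "\<dots> = (\<Sum>b\<in>Basis. (\<Sum>a\<in>Basis. nu a x * nu a x) * pd b (Y b) x - nu b x * (\<Sum>a\<in>Basis. nu a x * pd a (Y b) x))
        + (\<Sum>b\<in>Basis. Y b x * (\<Sum>a\<in>Basis. nu a x * pd b (nu a) x))
        - (\<Sum>b\<in>Basis. nu b x * Y b x) * (\<Sum>a\<in>Basis. pd a (nu a) x)"
      unfolding sum_product by (simp only: sum.distrib sum_subtractf sum_distrib_left sum_distrib_right)
    also have "\<dots> = (\<Sum>b\<in>Basis. Dt b (Y b) x)"
      using tangential_sum_dnu[OF x t[OF x]] t[OF x] by (simp add: sum_nu_nu[OF x] Dt_def)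
    finally show ?thesis .
  qed
  have "(\<integral>x. (\<Sum>b\<in>Basis. Dt b (Y b) x) \<partial>\<sigma>) = (\<integral>x. (\<Sum>a\<in>Basis. \<Sum>b\<in>Basis. P a b x) \<partial>\<sigma>)"
  proof (rule integral_cong_AE)
    show "AE x in \<sigma>. (\<Sum>b\<in>Basis. Dt b (Y b) x) = (\<Sum>a\<in>Basis. \<Sum>b\<in>Basis. P a b x)"
      using AE_S by eventually_elim (simp add: pt)
    show "(\<lambda>x. \<Sum>b\<in>Basis. Dt b (Y b) x) \<in> borel_measurable \<sigma>"
      unfolding borel_\<sigma> by (intro borel_measurable_continuous_onI smooth_on_continuous smooth_intros smooth_Dt Y)
    show "(\<lambda>x. \<Sum>a\<in>Basis. \<Sum>b\<in>Basis. P a b x) \<in> borel_measurable \<sigma>"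
      unfolding borel_\<sigma> by (intro borel_measurable_continuous_onI smooth_on_continuous smooth_intros sP)
  qed
  also have "\<dots> = (\<Sum>a\<in>Basis. \<Sum>b\<in>Basis. \<integral>x. P a b x \<partial>\<sigma>)"
    by (subst Bochner_Integration.integral_sum) (auto intro!: Bochner_Integration.integrable_sum iP sum.cong Bochner_Integration.integral_sum)
  also have "\<dots> = 0"
    unfolding P_def by (intro sum.neutral ballI integral_skew_eq_0 smooth_intros smooth_nu Y)
  finally show ?thesis .
qed

lemma integral_\<sigma>_cong:
  assumes "I \<in> borel_measurable borel" "smooth_on UNIV J" "\<And>x. x \<in> S \<Longrightarrow> I x = J x"
  shows "(\<integral>x. I x \<partial>\<sigma>) = (\<integral>x. J x \<partial>\<sigma>)" "integrable \<sigma> J"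
proof -
  have J: "J \<in> borel_measurable borel"
    by (intro borel_measurable_continuous_onI smooth_on_continuous assms)
  show "integrable \<sigma> J" by (rule integrable_\<sigma>_continuous[OF J smooth_on_continuous[OF assms(2)] refl])
  show "(\<integral>x. I x \<partial>\<sigma>) = (\<integral>x. J x \<partial>\<sigma>)"
  proof (rule integral_cong_AE)
    show "AE x in \<sigma>. I x = J x" using AE_S by eventually_elim (rule assms)
  qed (use assms(1) J in \<open>simp_all add: borel_\<sigma>\<close>)
qed

section \<open>Second fundamental form and mean curvature\<close>

lemma tgrad_inner: "b \<in> Basis \<Longrightarrow> tgrad S N w x \<bullet> b = tdiff S N b w x"
  unfolding tgrad_def by (simp add: inner_sum_left inner_Basis if_distrib cong: if_cong)

lemma sff_eq:
  assumes x: "x \<in> S"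
  shows "sff S N x V W = - (\<Sum>b\<in>Basis. \<Sum>c\<in>Basis. (W \<bullet> b) * (V \<bullet> c) * Dt c (nu b) x)"
proof -
  have "tdiff S N c (\<lambda>y. N y \<bullet> b) x = Dt c (nu b) x" if "c \<in> Basis" "b \<in> Basis" for b c
    using that by (intro tdiff_eq x smooth_nu) (auto simp: nu_eq)
  then show ?thesis
    unfolding sff_def dnormal_def
    by (simp add: inner_sum_right sum_distrib_left mult_ac)
qed

text \<open>The trace runs over projections of the ambient basis. Since \<open>Dt\<close> in the
  normal direction is zero, projecting the direction of differentiation changes nothing, and the
  correction from the other slot contracts to zero for the same reason.\<close>

lemma mean_curv_eq:
  assumes x: "x \<in> S"
  shows "mean_curv S N x = - (\<Sum>b\<in>Basis. Dt b (nu b) x)"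
proof -
  define M where "M b c = Dt c (nu b) x" for b c
  define n where "n b = N x \<bullet> b" for b
  have n1: "(\<Sum>c\<in>Basis. n c * n c) = 1"
    using N_unit[OF x] unfolding n_def by (subst (asm) euclidean_inner) simp
  \<comment> \<open>The normal sits in the direction of differentiation here, so this uses only its
    unit length at x and no derivative of that length.\<close>
  have Mn: "(\<Sum>c\<in>Basis. n c * M b c) = 0" for b
  proof -
    have "(\<Sum>c\<in>Basis. n c * M b c) = (\<Sum>c\<in>Basis. n c * pd c (nu b) x) - (\<Sum>c\<in>Basis. n c * n c) * (\<Sum>a\<in>Basis. n a * pd a (nu b) x)"
      unfolding M_def Dt_def by (simp add: nu_eq[OF x] n_def right_diff_distrib sum_subtractf sum_distrib_right mult_ac)
    then show ?thesis using n1 by simp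
  qed
  have proj: "(\<Sum>c\<in>Basis. ((i - n i *\<^sub>R N x) \<bullet> c) * M b c) = M b i" if i: "i \<in> Basis" for i b
  proof -
    have "(\<Sum>c\<in>Basis. ((i - n i *\<^sub>R N x) \<bullet> c) * M b c) = (\<Sum>c\<in>Basis. (i \<bullet> c) * M b c) - n i * (\<Sum>c\<in>Basis. n c * M b c)"
      by (simp add: inner_diff_left algebra_simps sum_subtractf sum_distrib_left n_def)
    also have "(\<Sum>c\<in>Basis. (i \<bullet> c) * M b c) = M b i"
      using i by (simp add: inner_Basis if_distrib[of "\<lambda>z. z * _"] cong: if_cong)
    finally show ?thesis using Mn by simp
  qed
  have "mean_curv S N x = (\<Sum>i\<in>Basis. - (\<Sum>b\<in>Basis. ((i - n i *\<^sub>R N x) \<bullet> b) * (\<Sum>c\<in>Basis. ((i - n i *\<^sub>R N x) \<bullet> c) * M b c)))"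
    unfolding mean_curv_def sff_eq[OF x] tproj_def M_def n_def by (simp add: sum_distrib_left mult.assoc)
  also have "\<dots> = (\<Sum>i\<in>Basis. - (\<Sum>b\<in>Basis. ((i - n i *\<^sub>R N x) \<bullet> b) * M b i))"
    by (intro sum.cong refl) (simp add: proj)
  also have "\<dots> = (\<Sum>i\<in>Basis. - M i i + (\<Sum>b\<in>Basis. n b * (n i * M b i)))"
  proof (intro sum.cong refl)
    fix i :: "real^'n" assume i: "i \<in> Basis"
    have "(\<Sum>b\<in>Basis. ((i - n i *\<^sub>R N x) \<bullet> b) * M b i) = (\<Sum>b\<in>Basis. (i \<bullet> b) * M b i) - (\<Sum>b\<in>Basis. n b * (n i * M b i))"
      by (simp add: inner_diff_left algebra_simps sum_subtractf n_def)
    also have "(\<Sum>b\<in>Basis. (i \<bullet> b) * M b i) = M i i"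
      using i by (simp add: inner_Basis if_distrib[of "\<lambda>z. z * _"] cong: if_cong)
    finally show "- (\<Sum>b\<in>Basis. ((i - n i *\<^sub>R N x) \<bullet> b) * M b i) = - M i i + (\<Sum>b\<in>Basis. n b * (n i * M b i))" by simp
  qed
  also have "\<dots> = - (\<Sum>i\<in>Basis. M i i) + (\<Sum>i\<in>Basis. \<Sum>b\<in>Basis. n b * (n i * M b i))"
    by (simp add: sum.distrib sum_negf sum_subtractf)
  also have "(\<Sum>i\<in>Basis. \<Sum>b\<in>Basis. n b * (n i * M b i)) = (\<Sum>b\<in>Basis. n b * (\<Sum>i\<in>Basis. n i * M b i))"
    by (subst sum.swap) (simp add: sum_distrib_left)
  finally show ?thesis using Mn by (simp add: M_def)
qed

end

subsection \<open>Reilly formula\<close>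

context level_domain
begin

lemma set_integrable_D:
  assumes "continuous_on UNIV q" shows "set_integrable lborel D (q :: _ \<Rightarrow> real)"
proof -
  have "set_integrable lborel (closure D) q"
    unfolding set_integrable_def
    by (rule borel_integrable_compact[OF compact_closure_D continuous_on_subset[OF assms]]) simp
  then show ?thesis
    by (rule set_integrable_subset) (use open_D closure_subset in auto)
qed

lemma measurable_gauss[measurable]: "gauss \<in> borel_measurable borel"
  by (intro borel_measurable_continuous_onI smooth_on_continuous smooth_on_gauss)

lemma measurable_tgrad[measurable]: "tgrad S N v \<in> borel_measurable borel"
proof -
  note measurable_tdiff[measurable]
  show ?thesis unfolding tgrad_def[abs_def] by measurable
qed

lemma measurable_drift_tlap[measurable]: "drift_tlap S N v \<in> borel_measurable borel"
proof -
  note measurable_tdiff[measurable]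
  show ?thesis unfolding drift_tlap_def[abs_def] tlap_def by measurable
qed

lemma measurable_sff[measurable]:
  assumes [measurable]: "V \<in> borel_measurable borel" "W \<in> borel_measurable borel"
  shows "(\<lambda>x. sff S N x (V x) (W x)) \<in> borel_measurable borel"
proof -
  note measurable_tdiff[measurable]
  show ?thesis unfolding sff_def dnormal_def by measurable
qed

lemma measurable_mean_curv[measurable]: "mean_curv S N \<in> borel_measurable borel"
  unfolding mean_curv_def[abs_def] tproj_def by measurable

theorem reilly_smooth:
  assumes f: "smooth_on UNIV f" and u: "\<And>x. x \<in> S \<Longrightarrow> f x = u x"
  shows "(LINT x:D|lborel. (drift_lap f x)\<^sup>2 * gauss x)
       = (LINT x:D|lborel. hess_norm2 f x * gauss x)
         + (1/2) * (LINT x:D|lborel. (norm (grad f x))\<^sup>2 * gauss x)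
         + 2 * (LINT x|\<sigma>. (grad f x \<bullet> N x) * drift_tlap S N u x * gauss x)
         - (LINT x|\<sigma>. sff S N x (tgrad S N u x) (tgrad S N u x) * gauss x)
         - (LINT x|\<sigma>. (grad f x \<bullet> N x)\<^sup>2 * ((x \<bullet> N x) / 2 + mean_curv S N x) * gauss x)"
    (is "?L = ?A + 1/2 * ?B + 2 * ?I1 - ?I2 - ?I3")
proof -
  note d = smooth_on_UNIV_differentiable
  define fn where "fn x = (\<Sum>a\<in>Basis. nu a x * pd a f x)" for x
  define w where "w b = Dt b f" for b
  have w: "w b x = pd b f x - nu b x * fn x" for b x by (simp add: w_def Dt_def fn_def)
  define \<tau> where "\<tau> x = (\<Sum>b\<in>Basis. Dt b (w b) x)" for x
  define xw where "xw x = (\<Sum>b\<in>Basis. (x \<bullet> b) * w b x)" for x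
  define h where "h x = (\<Sum>b\<in>Basis. \<Sum>c\<in>Basis. w b x * w c x * Dt c (nu b) x)" for x
  define H where "H x = - (\<Sum>b\<in>Basis. Dt b (nu b) x)" for x
  define xn where "xn x = (\<Sum>b\<in>Basis. (x \<bullet> b) * nu b x)" for x
  have sfn: "smooth_on UNIV fn" unfolding fn_def by (intro smooth_intros smooth_nu f)
  have sw: "smooth_on UNIV (w b)" if "b \<in> Basis" for b unfolding w_def by (intro smooth_Dt f that)
  have s\<tau>: "smooth_on UNIV \<tau>" unfolding \<tau>_def by (intro smooth_intros smooth_Dt sw)
  have sxw: "smooth_on UNIV xw" unfolding xw_def by (intro smooth_intros sw)
  have sh: "smooth_on UNIV h" unfolding h_def by (intro smooth_intros smooth_Dt sw smooth_nu)
  have sH: "smooth_on UNIV H" unfolding H_def by (intro smooth_intros smooth_Dt smooth_nu)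
  have sxn: "smooth_on UNIV xn" unfolding xn_def by (intro smooth_intros smooth_nu)
  have tang: "(\<Sum>b\<in>Basis. nu b x * w b x) = 0" if "x \<in> S" for x
  proof -
    have "(\<Sum>b\<in>Basis. nu b x * w b x) = fn x - (\<Sum>b\<in>Basis. nu b x * nu b x) * fn x"
      by (simp add: w right_diff_distrib sum_subtractf sum_distrib_right mult.assoc fn_def)
    then show ?thesis by (simp add: sum_nu_nu[OF that])
  qed
  have td: "tdiff S N b u x = w b x" if "x \<in> S" "b \<in> Basis" for x b
    unfolding w_def by (rule tdiff_eq[OF that f u])
  have gN: "grad f x \<bullet> N x = fn x" if "x \<in> S" for x
    by (subst euclidean_inner) (simp add: fn_def grad_inner_Basis nu_eq[OF that] mult.commute)
  have xN: "x \<bullet> N x = xn x" if "x \<in> S" for x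
    by (subst euclidean_inner) (simp add: xn_def nu_eq[OF that])
  have xT: "x \<bullet> tgrad S N u x = xw x" if "x \<in> S" for x
    by (subst euclidean_inner) (simp add: xw_def tgrad_inner td that)
  have tl: "tlap S N u x = \<tau> x" if "x \<in> S" for x
    unfolding tlap_def \<tau>_def by (intro sum.cong refl tdiff_eq that sw td[symmetric])
  have II: "sff S N x (tgrad S N u x) (tgrad S N u x) = - h x" if "x \<in> S" for x
    unfolding sff_eq[OF that] h_def by (simp add: tgrad_inner td that)
  have [measurable]: "grad f \<in> borel_measurable borel" by (rule borel_measurable_grad)

  have m1: "(\<lambda>x. (grad f x \<bullet> N x) * drift_tlap S N u x * gauss x) \<in> borel_measurable borel"
    by measurable
  have m2: "(\<lambda>x. sff S N x (tgrad S N u x) (tgrad S N u x) * gauss x) \<in> borel_measurable borel"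
    by measurable
  have m3: "(\<lambda>x. (grad f x \<bullet> N x)\<^sup>2 * ((x \<bullet> N x) / 2 + mean_curv S N x) * gauss x) \<in> borel_measurable borel"
    by measurable
  \<comment> \<open>Globally smooth representatives of the three boundary integrands. They agree
    with the integrands on S and supply integrability.\<close>
  define j1 where "j1 x = fn x * (\<tau> x - (1/2) * xw x) * gauss x" for x
  define j2 where "j2 x = - h x * gauss x" for x
  define j3 where "j3 x = fn x * fn x * ((1/2) * xn x + H x) * gauss x" for x
  have s1: "smooth_on UNIV j1" unfolding j1_def by (intro smooth_intros sfn s\<tau> sxw smooth_on_gauss)
  have s2: "smooth_on UNIV j2" unfolding j2_def by (intro smooth_intros sh smooth_on_gauss)
  have s3: "smooth_on UNIV j3" unfolding j3_def by (intro smooth_intros sfn sxn sH smooth_on_gauss)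
  have 1: "?I1 = (\<integral>x. j1 x \<partial>\<sigma>)" "integrable \<sigma> j1"
    using integral_\<sigma>_cong[OF m1 s1] by (auto simp: j1_def gN tl xT drift_tlap_def)
  have 2: "?I2 = (\<integral>x. j2 x \<partial>\<sigma>)" "integrable \<sigma> j2"
    using integral_\<sigma>_cong[OF m2 s2] by (auto simp: j2_def II)
  have 3: "?I3 = (\<integral>x. j3 x \<partial>\<sigma>)" "integrable \<sigma> j3"
    using integral_\<sigma>_cong[OF m3 s3]
    by (auto simp: j3_def gN xN mean_curv_eq H_def power2_eq_square)
  \<comment> \<open>The tangential field to be integrated away; on S, w holds the components of grad
    u.\<close>
  define Y where "Y b x = (gauss x * fn x) * w b x" for b x
  have sY: "smooth_on UNIV (Y b)" if "b \<in> Basis" for b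
    unfolding Y_def by (intro smooth_intros sfn sw smooth_on_gauss that)
  define q where "q x = (\<Sum>b\<in>Basis. Dt b (Y b) x)" for x
  have sq: "smooth_on UNIV q" unfolding q_def by (intro smooth_intros smooth_Dt sY)
  have q: "(\<integral>x. q x \<partial>\<sigma>) = 0" "integrable \<sigma> q"
  proof -
    show "(\<integral>x. q x \<partial>\<sigma>) = 0"
      unfolding q_def
    proof (rule surface_divergence[OF sY])
      fix x assume "x \<in> S"
      have "(\<Sum>b\<in>Basis. nu b x * Y b x) = gauss x * fn x * (\<Sum>b\<in>Basis. nu b x * w b x)"
        by (simp add: Y_def sum_distrib_left mult_ac)
      then show "(\<Sum>b\<in>Basis. nu b x * Y b x) = 0" using tang[OF \<open>x \<in> S\<close>] by simp
    qed
    show "integrable \<sigma> q"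
      by (rule integral_\<sigma>_cong(2)[OF _ sq refl]) (intro borel_measurable_continuous_onI smooth_on_continuous sq)
  qed
  define F where "F b x = gauss x * (drift_lap f x * pd b f x - (\<Sum>c\<in>Basis. pd c f x * pd b (pd c f) x))" for b x
  have sF: "smooth_on UNIV (F b)" if "b \<in> Basis" for b
    unfolding F_def by (rule weighted_bochner(1)[OF f that])
  have divF: "(\<Sum>b\<in>Basis. pd b (F b) x)
      = ((drift_lap f x)\<^sup>2 - hess_norm2 f x - (1/2) * (norm (grad f x))\<^sup>2) * gauss x" for x
    unfolding F_def by (rule weighted_bochner(2)[OF f])
  \<comment> \<open>The flux contains one j1 and, up to the weight, minus the derivative of f_nu
    along grad u. The divergence q of Y equals j1 plus the weighted derivative of f_nu along grad u,
    so trading that term for j1 - q produces the factor 2.\<close>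
  have flux: "(\<Sum>b\<in>Basis. F b x * (N x \<bullet> b)) = 2 * j1 x - j2 x - j3 x - q x" if x: "x \<in> S" for x
  proof -
    define dfn where "dfn a = (\<Sum>c\<in>Basis. nu c x * pd a (pd c f) x + pd a (nu c) x * pd c f x)" for a
    define du where "du a b = pd a (pd b f) x - (nu b x * dfn a + pd a (nu b) x * fn x)" for a b
    have dnu: "nu b differentiable (at x)" "pd b f differentiable (at x)" if "b \<in> Basis" for b
      using that by (auto intro!: d smooth_nu smooth_on_pd f)
    have pfn: "pd a fn x = dfn a" for a
    proof -
      have "pd a fn x = (\<Sum>c\<in>Basis. pd a (\<lambda>x. nu c x * pd c f x) x)"
        unfolding fn_def by (intro pd_sum d smooth_intros smooth_nu f)
      then show ?thesis unfolding dfn_def using dnu by (simp add: pd_mult)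
    qed
    have pw: "pd a (w b) x = du a b" if b: "b \<in> Basis" for a b
    proof -
      have "pd a (w b) x = pd a (\<lambda>x. pd b f x - nu b x * fn x) x" unfolding w[abs_def] ..
      also have "\<dots> = pd a (pd b f) x - pd a (\<lambda>x. nu b x * fn x) x"
        by (intro pd_diff d smooth_intros smooth_nu sfn f b)
      also have "pd a (\<lambda>x. nu b x * fn x) x = nu b x * dfn a + pd a (nu b) x * fn x"
        using pd_mult[OF dnu(1)[OF b] d[OF sfn]] by (simp add: pfn)
      finally show ?thesis by (simp add: du_def)
    qed
    have \<tau>x: "\<tau> x = (\<Sum>b\<in>Basis. du b b - nu b x * (\<Sum>a\<in>Basis. nu a x * du a b))"
      unfolding \<tau>_def Dt_def by (simp add: pw)
    have hx: "h x = (\<Sum>b\<in>Basis. \<Sum>c\<in>Basis. w b x * w c x * pd c (nu b) x)"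
    proof -
      have "h x = (\<Sum>b\<in>Basis. w b x * (\<Sum>c\<in>Basis. w c x * Dt c (nu b) x))"
        unfolding h_def by (simp add: sum_distrib_left mult_ac)
      also have "\<dots> = (\<Sum>b\<in>Basis. w b x * (\<Sum>c\<in>Basis. w c x * pd c (nu b) x))"
        using tangential_sum_Dt[OF tang[OF x]] by simp
      finally show ?thesis by (simp add: sum_distrib_left mult_ac)
    qed
    have sym: "pd b (pd c f) x = pd c (pd b f) x" if "b \<in> Basis" "c \<in> Basis" for b c
      by (rule pd_commute[OF f that])
    have alg: "((\<Sum>b\<in>Basis. pd b (pd b f) x) - (1/2) * (\<Sum>b\<in>Basis. (x \<bullet> b) * pd b f x)) * fn x
          - (\<Sum>b\<in>Basis. \<Sum>c\<in>Basis. pd c f x * pd b (pd c f) x * nu b x)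
        = fn x * (\<tau> x - (1/2) * xw x) - (fn x)\<^sup>2 * ((1/2) * xn x + H x)
          - (\<Sum>b\<in>Basis. w b x * dfn b) + h x"
      using boundary_algebra[OF sum_nu_nu[OF x] sym, where ?f1.0="\<lambda>b. pd b f x"
          and dn="\<lambda>a b. pd a (nu b) x" and ?x1.0="\<lambda>b. x \<bullet> b"]
        tangential_sum_dnu[OF x tang[OF x]]
      unfolding \<tau>x hx H_def xw_def xn_def du_def dfn_def w Dt_def fn_def by simp
    have drift: "drift_lap f x = (\<Sum>b\<in>Basis. pd b (pd b f) x) - (1/2) * (\<Sum>b\<in>Basis. (x \<bullet> b) * pd b f x)"
      unfolding drift_lap_def lap_def by (subst euclidean_inner) (simp add: grad_inner_Basis)
    have "(\<Sum>b\<in>Basis. F b x * (N x \<bullet> b))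
        = (\<Sum>b\<in>Basis. gauss x * (drift_lap f x * (nu b x * pd b f x) - (\<Sum>c\<in>Basis. pd c f x * pd b (pd c f) x * nu b x)))"
      unfolding F_def by (intro sum.cong refl) (simp add: nu_eq[OF x] algebra_simps sum_distrib_left)
    also have "\<dots> = gauss x * (drift_lap f x * fn x - (\<Sum>b\<in>Basis. \<Sum>c\<in>Basis. pd c f x * pd b (pd c f) x * nu b x))"
      unfolding fn_def by (simp only: sum_distrib_left[symmetric] sum_subtractf)
    finally have lhs: "(\<Sum>b\<in>Basis. F b x * (N x \<bullet> b)) = gauss x * (fn x * (\<tau> x - (1/2) * xw x)
          - (fn x)\<^sup>2 * ((1/2) * xn x + H x) - (\<Sum>b\<in>Basis. w b x * dfn b) + h x)"
      unfolding drift alg .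
    have qx: "q x = gauss x * (fn x * \<tau> x + (\<Sum>b\<in>Basis. w b x * dfn b) - (1/2) * fn x * xw x)"
    proof -
      have dg: "gauss differentiable (at x)" "fn differentiable (at x)" "(\<lambda>x. gauss x * fn x) differentiable (at x)"
        by (intro d smooth_intros smooth_on_gauss sfn)+
      have "q x = (\<Sum>b\<in>Basis. gauss x * fn x * Dt b (w b) x + w b x * Dt b (\<lambda>x. gauss x * fn x) x)"
        unfolding q_def Y_def by (intro sum.cong refl Dt_mult dg d sw)
      also have "\<dots> = gauss x * fn x * \<tau> x + (\<Sum>b\<in>Basis. w b x * pd b (\<lambda>x. gauss x * fn x) x)"
        using tangential_sum_Dt[OF tang[OF x]] by (simp add: sum.distrib sum_distrib_left \<tau>_def)
      also have "(\<Sum>b\<in>Basis. w b x * pd b (\<lambda>x. gauss x * fn x) x)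
          = (\<Sum>b\<in>Basis. gauss x * (w b x * dfn b) - (1/2) * gauss x * fn x * ((x \<bullet> b) * w b x))"
        by (intro sum.cong refl) (simp add: pd_mult[OF dg(1,2)] pfn pd_gauss algebra_simps)
      also have "\<dots> = gauss x * (\<Sum>b\<in>Basis. w b x * dfn b) - (1/2) * gauss x * fn x * xw x"
        unfolding xw_def by (simp only: sum_subtractf sum_distrib_left)
      finally show ?thesis by (simp add: algebra_simps)
    qed
    show ?thesis
      unfolding lhs qx j1_def j2_def j3_def by (simp add: algebra_simps power2_eq_square)
  qed
  have cont: "continuous_on UNIV (\<lambda>x. (drift_lap f x)\<^sup>2 * gauss x)" "continuous_on UNIV (\<lambda>x. hess_norm2 f x * gauss x)"
    "continuous_on UNIV (\<lambda>x. (norm (grad f x))\<^sup>2 * gauss x)" "continuous_on UNIV (pd b (F b))" if "b \<in> Basis" for b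
    unfolding drift_lap_def lap_def hess_norm2_def
    by (intro continuous_intros continuous_on_grad smooth_on_continuous smooth_on_gauss smooth_on_pd sF f that; assumption)+
  obtain b0 :: "real^'n" where b0: "b0 \<in> Basis" using nonempty_Basis by blast
  note si = cont(1-3)[OF b0, THEN set_integrable_D]
  have "?L - ?A - 1/2 * ?B = (LINT x:D|lborel. (drift_lap f x)\<^sup>2 * gauss x - hess_norm2 f x * gauss x
      - (1/2) * ((norm (grad f x))\<^sup>2 * gauss x))"
    using si by (simp add: set_integral_diff)
  also have "\<dots> = (LINT x:D|lborel. (\<Sum>b\<in>Basis. pd b (F b) x))"
    unfolding divF by (simp add: algebra_simps)
  also have "\<dots> = (\<Sum>b\<in>Basis. LINT x:D|lborel. pd b (F b) x)"
    unfolding set_lebesgue_integral_def scaleR_sum_right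
    by (rule Bochner_Integration.integral_sum)
      (use set_integrable_D[OF cont(4)] in \<open>simp add: set_integrable_def\<close>)
  also have "\<dots> = (\<Sum>b\<in>Basis. \<integral>x. F b x * (N x \<bullet> b) \<partial>\<sigma>)"
    by (intro sum.cong refl divergence_theorem sF)
  also have "\<dots> = (\<integral>x. (\<Sum>b\<in>Basis. F b x * (N x \<bullet> b)) \<partial>\<sigma>)"
  proof (rule Bochner_Integration.integral_sum[symmetric])
    fix b :: "real^'n" assume b: "b \<in> Basis"
    have [measurable]: "F b \<in> borel_measurable borel"
      by (intro borel_measurable_continuous_onI smooth_on_continuous sF b)
    show "integrable \<sigma> (\<lambda>x. F b x * (N x \<bullet> b))"
      by (rule integrable_\<sigma>_continuous[OF _ smooth_on_continuous[of "\<lambda>x. F b x * nu b x"]])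
        (measurable, intro smooth_intros sF smooth_nu b, simp add: nu_eq b)
  qed
  also have "\<dots> = (\<integral>x. 2 * j1 x - j2 x - j3 x - q x \<partial>\<sigma>)"
  proof (rule integral_\<sigma>_cong(1)[OF _ _ flux])
    have [measurable]: "F b \<in> borel_measurable borel" if "b \<in> Basis" for b
      by (intro borel_measurable_continuous_onI smooth_on_continuous sF that)
    show "(\<lambda>x. \<Sum>b\<in>Basis. F b x * (N x \<bullet> b)) \<in> borel_measurable borel" by measurable
    show "smooth_on UNIV (\<lambda>x. 2 * j1 x - j2 x - j3 x - q x)" by (intro smooth_intros s1 s2 s3 sq)
  qed
  also have "\<dots> = 2 * (\<integral>x. j1 x \<partial>\<sigma>) - (\<integral>x. j2 x \<partial>\<sigma>) - (\<integral>x. j3 x \<partial>\<sigma>) - (\<integral>x. q x \<partial>\<sigma>)"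
    using 1(2) 2(2) 3(2) q(2) by simp
  finally show ?thesis using q(1) 1(1) 2(1) 3(1) by simp
qed

end

theorem theorem3p1:
  fixes \<Omega> :: "(real^'n) set"
    and \<phi> f g u :: "real^'n \<Rightarrow> real"
    and \<sigma> :: "(real^'n) measure"
  assumes dim: "CARD('n) = CARD('m::finite) + 1" and n2: "CARD('m) \<ge> 2"
    and bdd: "bounded \<Omega>" and conn: "connected \<Omega>" and ne: "\<Omega> \<noteq> {}"
    and defphi: "smooth_on UNIV \<phi>" "\<Omega> = {x. \<phi> x < 0}"
    and bdry: "\<forall>x. \<phi> x = 0 \<longrightarrow> grad \<phi> x \<noteq> 0"
    and area: "area_measure TYPE('m) (frontier \<Omega>) \<sigma>"
    and fsmooth: "\<exists>W. open W \<and> closure \<Omega> \<subseteq> W \<and> smooth_on W f"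
    and eq: "\<forall>x\<in>\<Omega>. drift_lap f x = g x"
    and bc: "\<forall>x\<in>frontier \<Omega>. f x = u x"
  shows "(LINT x:\<Omega>|lborel. (g x)\<^sup>2 * gauss x)
       = (LINT x:\<Omega>|lborel. hess_norm2 f x * gauss x)
         + (1/2) * (LINT x:\<Omega>|lborel. (norm (grad f x))\<^sup>2 * gauss x)
         + 2 * (LINT x|\<sigma>. (grad f x \<bullet> outer_normal \<phi> x)
                 * drift_tlap (frontier \<Omega>) (outer_normal \<phi>) u x * gauss x)
         - (LINT x|\<sigma>. sff (frontier \<Omega>) (outer_normal \<phi>) x
                 (tgrad (frontier \<Omega>) (outer_normal \<phi>) u x)
                 (tgrad (frontier \<Omega>) (outer_normal \<phi>) u x) * gauss x)
         - (LINT x|\<sigma>. (grad f x \<bullet> outer_normal \<phi> x)\<^sup>2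
                 * ((x \<bullet> outer_normal \<phi> x) / 2 + mean_curv (frontier \<Omega>) (outer_normal \<phi>) x)
                 * gauss x)"
proof -
  interpret regular_sublevel \<phi>
    by unfold_locales (use defphi bdd bdry in auto)
  have \<Omega>: "\<Omega> = D" using defphi by (simp add: D_def)
  have fr: "frontier \<Omega> = S" unfolding \<Omega> by (rule frontier_D)
  interpret level_domain \<phi> \<sigma> "TYPE('m)"
    by unfold_locales (use dim area fr in \<open>auto simp: S_def\<close>)
  obtain W where W: "open W" "closure D \<subseteq> W" "smooth_on W f" using fsmooth \<Omega> by auto
  \<comment> \<open>F agrees with f on an open set containing the closed domain, so first and second
    derivatives coincide in D and on S.\<close>
  obtain F V where F: "smooth_on UNIV F" "open V" "closure D \<subseteq> V" "\<And>x. x \<in> V \<Longrightarrow> F x = f x"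
    using smooth_extension[OF compact_closure_D W] by blast
  have DV: "x \<in> V" if "x \<in> D" for x using that F(3) closure_subset by blast
  have SV: "x \<in> V" if "x \<in> S" for x using that F(3) S_subset_closure_D by blast
  have pd1: "pd b f x = pd b F x" if "x \<in> V" for b x
    by (rule pd_cong_open[OF F(2) that]) (simp add: F(4))
  have pd2: "pd b (pd c f) x = pd b (pd c F) x" if "x \<in> V" for b c x
    by (rule pd_cong_open[OF F(2) that]) (simp add: pd1)
  have gr: "grad f x = grad F x" if "x \<in> V" for x using pd1[OF that] by (simp add: grad_def)
  have hs: "hess_norm2 f x = hess_norm2 F x" if "x \<in> V" for x using pd2[OF that] by (simp add: hess_norm2_def)
  have dr: "drift_lap f x = drift_lap F x" if "x \<in> V" for x
    using pd2[OF that] gr[OF that] by (simp add: drift_lap_def lap_def)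
  have set_eq: "(LINT x:D|lborel. p x) = (LINT x:D|lborel. q x)" if "\<And>x. x \<in> D \<Longrightarrow> p x = q x" for p q :: "real^'n \<Rightarrow> real"
    using that unfolding set_lebesgue_integral_def
    by (intro Bochner_Integration.integral_cong refl) (auto split: split_indicator)
  have [measurable]: "grad f \<in> borel_measurable borel" "grad F \<in> borel_measurable borel"
    by (rule borel_measurable_grad)+
  have AE: "AE x in \<sigma>. grad f x = grad F x"
    using AE_S by eventually_elim (simp add: gr SV)
  \<comment> \<open>Agreement on S suffices because \<sigma> charges only S, but both sides must be
    Borel; for f, uncontrolled far from the domain, this rests on
    \<open>borel_measurable_grad\<close>.\<close>
  have \<sigma>_eq: "(\<integral>x. p x \<partial>\<sigma>) = (\<integral>x. q x \<partial>\<sigma>)"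
    if "p \<in> borel_measurable borel" "q \<in> borel_measurable borel" "\<And>x. x \<in> S \<Longrightarrow> p x = q x" for p q :: "real^'n \<Rightarrow> real"
    by (rule integral_cong_AE) (use that AE_S in \<open>auto simp: borel_\<sigma> elim!: eventually_mono\<close>)
  have u: "F x = u x" if "x \<in> S" for x using F(4)[OF SV[OF that]] bc that fr by simp
  have 1: "(\<integral>x. (grad f x \<bullet> N x) * drift_tlap S N u x * gauss x \<partial>\<sigma>)
      = (\<integral>x. (grad F x \<bullet> N x) * drift_tlap S N u x * gauss x \<partial>\<sigma>)"
    by (rule \<sigma>_eq) (measurable, measurable, simp add: gr SV)
  have 2: "(\<integral>x. (grad f x \<bullet> N x)\<^sup>2 * ((x \<bullet> N x) / 2 + mean_curv S N x) * gauss x \<partial>\<sigma>)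
      = (\<integral>x. (grad F x \<bullet> N x)\<^sup>2 * ((x \<bullet> N x) / 2 + mean_curv S N x) * gauss x \<partial>\<sigma>)"
    by (rule \<sigma>_eq) (measurable, measurable, simp add: gr SV)
  have 3: "(LINT x:D|lborel. (g x)\<^sup>2 * gauss x) = (LINT x:D|lborel. (drift_lap F x)\<^sup>2 * gauss x)"
    by (rule set_eq) (use eq \<Omega> dr DV in auto)
  have 4: "(LINT x:D|lborel. hess_norm2 f x * gauss x) = (LINT x:D|lborel. hess_norm2 F x * gauss x)"
    by (rule set_eq) (simp add: hs DV)
  have 5: "(LINT x:D|lborel. (norm (grad f x))\<^sup>2 * gauss x) = (LINT x:D|lborel. (norm (grad F x))\<^sup>2 * gauss x)"
    by (rule set_eq) (simp add: gr DV)
  show ?thesis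
    unfolding fr unfolding \<Omega> 1 2 3 4 5 by (rule reilly_smooth[OF F(1) u])
qed

end
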